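(* Let $n\ge 1$ and let $m_i$ ($1\le i\le n$) and $m_{ij}=m_{ji}$ ($1\le i<j\le n$) be real numbers for which the series defining $\mathrm{F}_-\big((m_i,m_{ij})_{ij}\big)$ converges and all the generalized Selberg integrals occurring below converge (for instance all $m_i,m_{ij}\ge 0$). Then $$\mathrm{F}_-\big((m_i,m_{ij})_{ij}\big)=\sum_{\sigma\in S_n} q(\sigma)\;\tilde{\mathrm{F}}_-\big((m_{\sigma^{-1}(i)},\,m_{\sigma^{-1}(i)\sigma^{-1}(j)})_{ij}\big),$$ where $q(\sigma)$ is the braiding factor for the braiding matrix $q_{ij}=e^{\pi i\, m_{ij}}$, and where the reduced quantum monodromy number is $$\tilde{\mathrm{F}}_-\big((m_i,m_{ij})_{ij}\big):=\frac{1}{(2\pi i)^n}\sum_{k=0}^n(-1)^k\Big(\prod_{i=k+1}^n e^{2\pi i\, m_i}\Big)\sum_{\eta\in S_{k,\overline{n-k}}}\Big(\prod_{i<j,\ \eta(i)>\eta(j)}e^{\pi i\, m_{ij}}\Big)\,\mathrm{Sel}\big((m_{\eta^{-1}(i)};0;m_{\eta^{-1}(i)\eta^{-1}(j)})_{ij}\big).$$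
   Context: Throughout $i=\sqrt{-1}$ when used as a scalar and $m_{ji}:=m_{ij}$. For real $m$ define $r(m):=0$ if $m\in\mathbb{Z}\setminus\{-1\}$, $r(-1):=1$, and $r(m):=\frac{e^{2\pi i (m+1)}-1}{2\pi i\,(m+1)}$ if $m\notin\mathbb{Z}$ (the formal residue of $z^m$ along the lift of the unit circle starting in the principal branch). The quantum monodromy number is the series $$\mathrm{F}_-\big((m_i,m_{ij})_{ij}\big):=\sum_{(k_{ij})_{i<j}\in\mathbb{N}_0^{\binom n2}}\ \prod_{i=1}^n r\Big(m_i+\sum_{j>i}(m_{ij}-k_{ij})+\sum_{j<i}k_{ji}\Big)\prod_{i<j}(-1)^{k_{ij}}\binom{m_{ij}}{k_{ij}},$$ with generalized binomial coefficients. The generalized Selberg integral is $$\mathrm{Sel}\big((m_i;\bar m_i;m_{ij})_{i<j}\big):=\int_{1\ge z_1>z_2>\dots>z_n\ge 0}\prod_i z_i^{m_i}\prod_i(1-z_i)^{\bar m_i}\prod_{i<j}(z_i-z_j)^{m_{ij}}\,dz_1\cdots dz_n .$$ The braiding factor $q:S_n\to\mathbb{C}^\times$ is defined by $q(\mathrm{id})=1$ and $q((k,k+1)\sigma)=e^{\pi i\, m_{\sigma^{-1}(k)\sigma^{-1}(k+1)}}\,q(\sigma)$ whenever the length satisfies $\ell((k,k+1)\sigma)=\ell(\sigma)+1$ (here $(k,k+1)$ is the simple transposition and $\ell$ the Coxeter length). For $0\le k\le n$, $S_{k,\overline{n-k}}:=\{\eta\in S_n:\ \eta(i)<\eta(j)\text{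 for all }i<j\le k,\ \eta(i)>\eta(j)\text{ for all }k<i<j\}$, a set of $\binom nk$ permutations. *)

theory Defs
  imports "HOL-Analysis.Analysis" "HOL-Combinatorics.Transposition" "HOL-Combinatorics.Permutations"
begin

text \<open>Indices are 0-based: 1..n of the paper becomes 0..<n.\<close>

definition rres :: "real \<Rightarrow> complex" where
  "rres m = (if m \<in> \<int> then (if m = -1 then 1 else 0)
     else (exp (2 * pi * \<i> * complex_of_real (m + 1)) - 1) / (2 * pi * \<i> * complex_of_real (m + 1)))"

definition Fidx :: "nat \<Rightarrow> (nat \<Rightarrow> nat \<Rightarrow> nat) set" where
  "Fidx n = {k. \<forall>i j. \<not> (i < j \<and> j < n) \<longrightarrow> k i j = 0}"

definition pairs :: "nat \<Rightarrow> (nat \<times> nat) set" where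
  "pairs n = {(i, j). i < j \<and> j < n}"

definition Fterm :: "nat \<Rightarrow> (nat \<Rightarrow> real) \<Rightarrow> (nat \<Rightarrow> nat \<Rightarrow> real) \<Rightarrow> (nat \<Rightarrow> nat \<Rightarrow> nat) \<Rightarrow> complex" where
  "Fterm n m mm k =
     (\<Prod>i<n. rres (m i + (\<Sum>j\<in>{i<..<n}. (mm i j - real (k i j))) + (\<Sum>j<i. real (k j i))))
     * (\<Prod>(i, j)\<in>pairs n. complex_of_real ((-1) ^ k i j * (mm i j gchoose k i j)))"

definition F_minus :: "nat \<Rightarrow> (nat \<Rightarrow> real) \<Rightarrow> (nat \<Rightarrow> nat \<Rightarrow> real) \<Rightarrow> complex" where
  "F_minus n m mm = infsum (Fterm n m mm) (Fidx n)"

definition F_minus_converges :: "nat \<Rightarrow> (nat \<Rightarrow> real) \<Rightarrow> (nat \<Rightarrow> nat \<Rightarrow> real) \<Rightarrow> bool" where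
  "F_minus_converges n m mm \<longleftrightarrow> Fterm n m mm summable_on Fidx n"

definition sel_space :: "nat \<Rightarrow> (nat \<Rightarrow> real) measure" where
  "sel_space n = PiM {0..<n} (\<lambda>_. lborel)"

definition sel_region :: "nat \<Rightarrow> (nat \<Rightarrow> real) set" where
  "sel_region n = {z \<in> space (sel_space n). z 0 \<le> 1 \<and> 0 \<le> z (n - 1) \<and> (\<forall>i. i + 1 < n \<longrightarrow> z (i + 1) < z i)}"

definition sel_integrand :: "nat \<Rightarrow> (nat \<Rightarrow> real) \<Rightarrow> (nat \<Rightarrow> real) \<Rightarrow> (nat \<Rightarrow> nat \<Rightarrow> real) \<Rightarrow> (nat \<Rightarrow> real) \<Rightarrow> real" where
  "sel_integrand n m mbar mm z =
     (\<Prod>i<n. z i powr m i) * (\<Prod>i<n. (1 - z i) powr mbar i) * (\<Prod>(i, j)\<in>pairs n. (z i - z j) powr mm i j)"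

definition Sel :: "nat \<Rightarrow> (nat \<Rightarrow> real) \<Rightarrow> (nat \<Rightarrow> real) \<Rightarrow> (nat \<Rightarrow> nat \<Rightarrow> real) \<Rightarrow> real" where
  "Sel n m mbar mm = set_lebesgue_integral (sel_space n) (sel_region n) (sel_integrand n m mbar mm)"

definition Sel_converges :: "nat \<Rightarrow> (nat \<Rightarrow> real) \<Rightarrow> (nat \<Rightarrow> real) \<Rightarrow> (nat \<Rightarrow> nat \<Rightarrow> real) \<Rightarrow> bool" where
  "Sel_converges n m mbar mm \<longleftrightarrow> set_integrable (sel_space n) (sel_region n) (sel_integrand n m mbar mm)"

definition word_perm :: "nat list \<Rightarrow> nat \<Rightarrow> nat" where
  "word_perm ks = foldr (\<lambda>k f. Transposition.transpose k (k + 1) \<circ> f) ks id"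

definition coxeter_length :: "nat \<Rightarrow> (nat \<Rightarrow> nat) \<Rightarrow> nat" where
  "coxeter_length n \<sigma> = (LEAST l. \<exists>ks. length ks = l \<and> (\<forall>k\<in>set ks. k + 1 < n) \<and> \<sigma> = word_perm ks)"

definition is_braiding_factor :: "nat \<Rightarrow> (nat \<Rightarrow> nat \<Rightarrow> real) \<Rightarrow> ((nat \<Rightarrow> nat) \<Rightarrow> complex) \<Rightarrow> bool" where
  "is_braiding_factor n mm q \<longleftrightarrow> q id = 1 \<and>
     (\<forall>\<sigma> k. \<sigma> permutes {0..<n} \<and> k + 1 < n \<and>
        coxeter_length n (Transposition.transpose k (k + 1) \<circ> \<sigma>) = coxeter_length n \<sigma> + 1 \<longrightarrow>
        q (Transposition.transpose k (k + 1) \<circ> \<sigma>) =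
          exp (pi * \<i> * complex_of_real (mm (inv \<sigma> k) (inv \<sigma> (k + 1)))) * q \<sigma>)"

definition S_shuffle :: "nat \<Rightarrow> nat \<Rightarrow> (nat \<Rightarrow> nat) set" where
  "S_shuffle n k = {\<eta>. \<eta> permutes {0..<n} \<and>
      (\<forall>i j. i < j \<and> j < k \<longrightarrow> \<eta> i < \<eta> j) \<and>
      (\<forall>i j. k \<le> i \<and> i < j \<and> j < n \<longrightarrow> \<eta> i > \<eta> j)}"

definition F_tilde :: "nat \<Rightarrow> (nat \<Rightarrow> real) \<Rightarrow> (nat \<Rightarrow> nat \<Rightarrow> real) \<Rightarrow> complex" where
  "F_tilde n m mm = 1 / (2 * pi * \<i>) ^ n *
     (\<Sum>k\<in>{0..n}. (-1) ^ k * (\<Prod>i\<in>{k..<n}. exp (2 * pi * \<i> * complex_of_real (m i))) *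
        (\<Sum>\<eta>\<in>S_shuffle n k.
           (\<Prod>(i, j)\<in>{(i, j)\<in>pairs n. \<eta> i > \<eta> j}. exp (pi * \<i> * complex_of_real (mm i j))) *
           complex_of_real (Sel n (\<lambda>i. m (inv \<eta> i)) (\<lambda>_. 0) (\<lambda>i j. mm (inv \<eta> i) (inv \<eta> j)))))"

end

(*
  All integrals run along the unit circle lifted to arguments in [0, 2 pi], where r(m) is the mean of
  z^(m+1). Give the variables radii R_0 > R_1 > ... > R_(n-1) slightly below 1: then the product of the
  binomial series of (1 - z_j / z_i)^(m_ij) converges absolutely, and the integral of the product of
  z_i^(m_i) and (z_i - z_j)^(m_ij) over the circles is the series F_- with the k-th term damped by powers of
  R_j / R_i. Starting from the innermost variable, each circle is collapsed onto the two sides of the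
  segment [0, R_i]; since the variables inside already lie on the positive axis, only the boundary values
  of (z_i - x_j)^(m_ij) on the two sides of the axis enter. This turns the integral into a sum over the
  sets E of variables on the lower side, of integrals over the box of the absolute value of the integrand
  times a phase that depends only on E and on the order of the coordinates.

  For small exponents the collapse is obtained from that for large exponents by shifting all of them
  by s: both sides are holomorphic in s for Re s > 0 and continuous at s = 0. Letting the radii tend to 1,
  dominated convergence applies on both sides precisely because F_- and the Selberg integrals converge.

  Cutting the cube according to the order tau of the coordinates yields Selberg integrals. A pair
  (E, tau) corresponds to (sigma, k, eta) via E = {v. sigma v >= k} and tau = eta o sigma, and the phases
  agree pair by pair, because q(sigma) is the product of e^(pi i m_ij) over the inversions of sigma.
*)

theory Submission
  imports Defs "HOL-Complex_Analysis.Complex_Analysis"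
begin

section \<open>Collapsing a circle onto a slit\<close>

text \<open>Separate radii are used because no integrability over the torus is assumed: on equal
  radii the integrand may be singular wherever two variables meet. The collapse rests on a primitive
  on each closed half-disc, so the branch has to be continuous up to the branch points; that forces
  positive exponents first, and continuation afterwards. Adding the same \<open>s\<close> to every
  exponent multiplies the integrand by one factor \<open>exp (s * u)\<close>, where \<open>u\<close>
  is a sum of logarithms. On the slits \<open>Re u\<close> tends to \<open>-\<infinity>\<close> at
  the singularities, but it stays bounded above and \<open>Im u\<close> stays bounded, so a single
  Laplace-type argument serves both sides. The convention \<open>0 powr a = 0\<close>, valid also
  for \<open>a = 0\<close>, makes the weight vanish as soon as two coordinates coincide or one is 0,
  and makes the factor \<open>(1 - z i) powr 0\<close> of the Selberg integrand vanish at
  \<open>z i = 1\<close>. With the half-open cube \<open>{0..<1}\<close> the decomposition into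
  orderings therefore holds at every point, and no null sets have to be removed.\<close>

lemma upper_branch_circle:
  fixes x R t m :: real
  assumes "0 \<le> x" "x < R" "0 \<le> t" "t \<le> pi"
  shows "exp (\<i> * pi * m / 2) * (-\<i> * (rcis R t - x)) powr m
       = exp (m * (ln R + \<i> * t)) * (1 - x / rcis R t) powr m"
proof -
  have R: "R > 0" using assms by simp
  let ?z = "rcis R t"
  have z0: "?z \<noteq> 0" using R by auto
  have zexp: "exp (ln R + \<i> * t) = ?z"
    using R by (simp add: exp_add rcis_def cis_conv_exp exp_of_real)
  have "norm (x / ?z) < 1" using assms R by (simp add: norm_divide)
  hence "\<bar>Re (x / ?z)\<bar> < 1" using abs_Re_le_cmod le_less_trans by blast
  hence re: "Re (1 - x / ?z) > 0" by simp
  hence n1: "1 - x / ?z \<noteq> 0" by auto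
  have n2: "?z - x \<noteq> 0" using n1 z0 by (auto simp: field_simps)
  \<comment> \<open>Rotation by \<open>-\<i>\<close> takes the closed upper half-plane to the closed
    right one, away from the cut of the principal power; \<open>pi / 2\<close> restores the argument
    of \<open>z - x\<close>, which then lies in [0, pi].\<close>
  have re2: "Re (-\<i> * (?z - x)) \<ge> 0" using assms R by (simp add: sin_ge_zero)
  have a: "\<bar>Im (Ln (-\<i> * (?z - x)))\<bar> \<le> pi / 2"
    using Re_Ln_pos_le re2 n2 by simp
  have b: "\<bar>Im (Ln (1 - x / ?z))\<bar> < pi / 2"
    using Re_Ln_pos_lt n1 re by blast
  \<comment> \<open>Both sides are logarithms of \<open>?z - x\<close>. The imaginary part of the
    left one lies in [0, pi], that of the right one in (-pi/2, 3 pi/2), so they differ by less than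
    2 pi and hence coincide.\<close>
  have "\<i> * pi / 2 + Ln (-\<i> * (?z - x)) = (ln R + \<i> * t) + Ln (1 - x / ?z)"
  proof (rule exp_complex_eqI)
    have "exp (\<i> * pi / 2 + Ln (-\<i> * (?z - x))) = exp (\<i> * pi / 2) * (-\<i> * (?z - x))"
      using n2 by (simp add: exp_add)
    also have "exp (\<i> * pi / 2) = \<i>" by (simp add: exp_eq_polar complex_eq_iff)
    also have "\<i> * (-\<i> * (?z - x)) = ?z - x" by (simp add: algebra_simps)
    also have "\<dots> = ?z * (1 - x / ?z)" using z0 by (simp add: field_simps)
    also have "?z * (1 - x / ?z) = exp ((ln R + \<i> * t) + Ln (1 - x / ?z))"
      unfolding exp_add[of "ln R + \<i> * t" "Ln (1 - x / ?z)"] zexp exp_Ln[OF n1] ..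
    finally show "exp (\<i> * pi / 2 + Ln (-\<i> * (?z - x))) = exp ((ln R + \<i> * t) + Ln (1 - x / ?z))" .
    show "\<bar>Im (\<i> * pi / 2 + Ln (-\<i> * (?z - x))) - Im ((ln R + \<i> * t) + Ln (1 - x / ?z))\<bar> < 2 * pi"
    proof -
      have "Im (\<i> * pi / 2 + Ln (-\<i> * (?z - x))) - Im ((ln R + \<i> * t) + Ln (1 - x / ?z))
        = pi / 2 + Im (Ln (-\<i> * (?z - x))) - t - Im (Ln (1 - x / ?z))" by simp
      thus ?thesis using a b assms pi_gt_zero by (simp only: abs_less_iff abs_le_iff) linarith
    qed
  qed
  hence "exp (m * (\<i> * pi / 2 + Ln (-\<i> * (?z - x)))) = exp (m * ((ln R + \<i> * t) + Ln (1 - x / ?z)))"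
    by simp
  thus ?thesis using n1 n2 by (simp add: powr_def exp_add algebra_simps)
qed

text \<open>Rotation by \<open>\<i>\<close> takes the closed lower half-plane to the right one, and
  \<open>3 * pi / 2\<close> restores the argument of \<open>z - x\<close> in [pi, 2 pi]. This
  continues the upper branch across the axis to the left of \<open>x\<close>.\<close>

lemma lower_branch_circle:
  fixes x R t m :: real
  assumes "0 \<le> x" "x < R" "pi \<le> t" "t \<le> 2 * pi"
  shows "exp (3 * \<i> * pi * m / 2) * (\<i> * (rcis R t - x)) powr m
       = exp (m * (ln R + \<i> * t)) * (1 - x / rcis R t) powr m"
proof -
  have R: "R > 0" using assms by simp
  let ?z = "rcis R t"
  have z0: "?z \<noteq> 0" using R by auto
  have zexp: "exp (ln R + \<i> * t) = ?z"
    using R by (simp add: exp_add rcis_def cis_conv_exp exp_of_real)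
  have "norm (x / ?z) < 1" using assms R by (simp add: norm_divide)
  hence "\<bar>Re (x / ?z)\<bar> < 1" using abs_Re_le_cmod le_less_trans by blast
  hence re: "Re (1 - x / ?z) > 0" by simp
  hence n1: "1 - x / ?z \<noteq> 0" by auto
  have n2: "?z - x \<noteq> 0" using n1 z0 by (auto simp: field_simps)
  have "sin t \<le> 0" using sin_le_zero[of t] assms by (cases "t = 2 * pi") auto
  hence re2: "Re (\<i> * (?z - x)) \<ge> 0" using R by (simp add: mult_nonneg_nonpos)
  have a: "\<bar>Im (Ln (\<i> * (?z - x)))\<bar> \<le> pi / 2"
    using Re_Ln_pos_le re2 n2 by simp
  have b: "\<bar>Im (Ln (1 - x / ?z))\<bar> < pi / 2"
    using Re_Ln_pos_lt n1 re by blast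
  have "3 * \<i> * pi / 2 + Ln (\<i> * (?z - x)) = (ln R + \<i> * t) + Ln (1 - x / ?z)"
  proof (rule exp_complex_eqI)
    have "exp (3 * \<i> * pi / 2 + Ln (\<i> * (?z - x))) = exp (3 * \<i> * pi / 2) * (\<i> * (?z - x))"
      using n2 by (simp add: exp_add)
    also have "exp (3 * \<i> * pi / 2) = -\<i>"
    proof -
      have "3 * \<i> * pi / 2 = \<i> * pi + \<i> * pi / 2" by simp
      also have "exp \<dots> = exp (\<i> * pi) * exp (\<i> * pi / 2)" by (rule exp_add)
      also have "\<dots> = -\<i>" by (simp add: exp_eq_polar complex_eq_iff)
      finally show ?thesis .
    qed
    also have "-\<i> * (\<i> * (?z - x)) = ?z - x" by (simp add: algebra_simps)
    also have "\<dots> = ?z * (1 - x / ?z)" using z0 by (simp add: field_simps)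
    also have "?z * (1 - x / ?z) = exp ((ln R + \<i> * t) + Ln (1 - x / ?z))"
      unfolding exp_add[of "ln R + \<i> * t" "Ln (1 - x / ?z)"] zexp exp_Ln[OF n1] ..
    finally show "exp (3 * \<i> * pi / 2 + Ln (\<i> * (?z - x))) = exp ((ln R + \<i> * t) + Ln (1 - x / ?z))" .
    show "\<bar>Im (3 * \<i> * pi / 2 + Ln (\<i> * (?z - x))) - Im ((ln R + \<i> * t) + Ln (1 - x / ?z))\<bar> < 2 * pi"
    proof -
      have "Im (3 * \<i> * pi / 2 + Ln (\<i> * (?z - x))) - Im ((ln R + \<i> * t) + Ln (1 - x / ?z))
        = 3 * pi / 2 + Im (Ln (\<i> * (?z - x))) - t - Im (Ln (1 - x / ?z))" by simp
      thus ?thesis using a b assms pi_gt_zero by (simp only: abs_less_iff abs_le_iff) linarith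
    qed
  qed
  hence "exp (m * (3 * \<i> * pi / 2 + Ln (\<i> * (?z - x)))) = exp (m * ((ln R + \<i> * t) + Ln (1 - x / ?z)))"
    by simp
  thus ?thesis using n1 n2 by (simp add: powr_def exp_add algebra_simps)
qed

lemma i_times_real_powr:
  fixes y m :: real
  assumes "y > 0"
  shows "(\<i> * y) powr m = exp (\<i> * pi * m / 2) * complex_of_real (y powr m)"
    and "(-\<i> * y) powr m = exp (- (\<i> * pi * m / 2)) * complex_of_real (y powr m)"
proof -
  have 1: "Ln (\<i> * y) = ln y + \<i> * pi / 2"
    using assms by (subst mult.commute, subst Ln_times_of_real) (auto simp: Ln_of_real)
  have 2: "Ln (-\<i> * y) = ln y - \<i> * pi / 2"
    using assms by (subst mult.commute, subst Ln_times_of_real) (auto simp: Ln_of_real)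
  have 3: "complex_of_real (y powr m) = exp (complex_of_real m * complex_of_real (ln y))"
    using assms by (simp add: powr_def exp_of_real flip: of_real_mult)
  show "(\<i> * y) powr m = exp (\<i> * pi * m / 2) * complex_of_real (y powr m)"
  proof -
    have "(\<i> * y) powr m = exp (m * (ln y + \<i> * pi / 2))"
      using assms by (simp only: powr_def 1) simp
    also have "m * (ln y + \<i> * pi / 2) = \<i> * pi * m / 2 + complex_of_real m * complex_of_real (ln y)"
      by (simp add: algebra_simps)
    finally show ?thesis unfolding 3 exp_add .
  qed
  show "(-\<i> * y) powr m = exp (- (\<i> * pi * m / 2)) * complex_of_real (y powr m)"
  proof -
    have "(-\<i> * y) powr m = exp (m * (ln y - \<i> * pi / 2))"
      using assms by (simp only: powr_def 2) simp
    also have "m * (ln y - \<i> * pi / 2) = - (\<i> * pi * m / 2) + complex_of_real m * complex_of_real (ln y)"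
      by (simp add: algebra_simps)
    finally show ?thesis unfolding 3 exp_add .
  qed
qed

text \<open>Seen from above, \<open>r - x\<close> has argument 0 to the right of \<open>x\<close>
  and pi to the left. At \<open>r = x\<close> both sides are 0 for every \<open>m\<close>.\<close>

lemma upper_branch_real:
  fixes x r m :: real
  shows "exp (\<i> * pi * m / 2) * (-\<i> * (r - x)) powr m
       = (if r < x then exp (\<i> * pi * m) else 1) * complex_of_real (\<bar>r - x\<bar> powr m)"
proof -
  consider "r < x" | "r = x" | "r > x" by linarith
  thus ?thesis
  proof cases
    case 1
    have e: "-\<i> * (r - x) = \<i> * complex_of_real (x - r)" by (simp add: algebra_simps)
    show ?thesis unfolding e
      using 1 i_times_real_powr(1)[of "x - r" m]
      exp_add[of "\<i> * pi * m / 2" "\<i> * pi * m / 2"] by (simp add: mult.assoc)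
  next
    case 3
    show ?thesis
      using 3 i_times_real_powr(2)[of "r - x" m]
      exp_add[of "\<i> * pi * m / 2" "- (\<i> * pi * m / 2)"] by (simp add: mult.assoc)
  qed auto
qed

text \<open>Seen from below, the argument is 2 pi to the right of \<open>x\<close> and again pi to
  the left, so the two sides of the slit differ only to the right of the branch point.\<close>

lemma lower_branch_real:
  fixes x r m :: real
  shows "exp (3 * \<i> * pi * m / 2) * (\<i> * (r - x)) powr m
       = (if r < x then exp (\<i> * pi * m) else exp (2 * \<i> * pi * m)) * complex_of_real (\<bar>r - x\<bar> powr m)"
proof -
  consider "r < x" | "r = x" | "r > x" by linarith
  thus ?thesis
  proof cases
    case 1
    have e: "\<i> * (r - x) = -\<i> * complex_of_real (x - r)" by (simp add: algebra_simps)
    show ?thesis unfolding e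
      using 1 i_times_real_powr(2)[of "x - r" m]
      exp_add[of "3 * \<i> * pi * m / 2" "- (\<i> * pi * m / 2)"] by (simp add: mult.assoc)
  next
    case 3
    show ?thesis
      using 3 i_times_real_powr(1)[of "r - x" m]
      exp_add[of "3 * \<i> * pi * m / 2" "\<i> * pi * m / 2"] by (simp add: mult.assoc)
  qed auto
qed


text \<open>Each half-disc is convex and carries one branch, which is continuous up to the boundary
  because the exponents are positive; hence it has a primitive there, and the half-circle can be
  exchanged for the diameter. The factor \<open>g\<close> stands for the variables on larger
  circles.\<close>

lemma circle_integral_collapse:
  fixes X M :: "'a \<Rightarrow> real" and R R' :: real
  assumes X: "\<And>j. j \<in> J \<Longrightarrow> 0 \<le> X j \<and> X j < R" and M: "\<And>j. j \<in> J \<Longrightarrow> 0 < M j"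
    and R: "0 < R" "R < R'" and g: "g holomorphic_on ball 0 R'"
  shows "(\<integral>t. indicator {0..2*pi} t *\<^sub>R (\<i> * rcis R t * (g (rcis R t) *
            (\<Prod>j\<in>J. exp (M j * (complex_of_real (ln R) + \<i> * t)) * (1 - X j / rcis R t) powr M j))) \<partial>lborel)
       = (\<integral>r. indicator {0..R} r *\<^sub>R (g (complex_of_real r) *
            ((\<Prod>j\<in>J. (if r < X j then exp (\<i> * pi * M j) else exp (2 * \<i> * pi * M j)) * complex_of_real (\<bar>r - X j\<bar> powr M j))
           - (\<Prod>j\<in>J. (if r < X j then exp (\<i> * pi * M j) else 1) * complex_of_real (\<bar>r - X j\<bar> powr M j)))) \<partial>lborel)"
proof -
  define hu where "hu z = g z * (\<Prod>j\<in>J. exp (\<i> * pi * M j / 2) * (-\<i> * (z - X j)) powr M j)" for z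
  define hl where "hl z = g z * (\<Prod>j\<in>J. exp (3 * \<i> * pi * M j / 2) * (\<i> * (z - X j)) powr M j)" for z
  define U where "U = cball 0 R \<inter> {z::complex. Im z \<ge> 0}"
  define L where "L = cball 0 R \<inter> {z::complex. Im z \<le> 0}"
  have gc: "continuous_on (cball 0 R) g"
    using g R holomorphic_on_imp_continuous_on continuous_on_subset
    by (metis cball_subset_ball_iff dist_self add_0 )
  have cU: "continuous_on U hu"
    unfolding hu_def U_def using M
    by (auto intro!: continuous_intros continuous_on_subset[OF gc])
  have cL: "continuous_on L hl"
    unfolding hl_def L_def using M
    by (auto intro!: continuous_intros continuous_on_subset[OF gc])
  have dU: "hu field_differentiable at z" if "z \<in> interior U - {}" for z
  proof -
    have "interior U = ball 0 R \<inter> {z. Im z > 0}"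
      unfolding U_def using interior_halfspace_ge[of \<i> 0] by (simp add: interior_Int inner_complex_def)
    hence z: "z \<in> ball 0 R' \<inter> {z. Im z > 0}" using that R by auto
    have "hu holomorphic_on (ball 0 R' \<inter> {z. Im z > 0})"
      unfolding hu_def by (auto intro!: holomorphic_intros holomorphic_on_subset[OF g] simp: complex_nonpos_Reals_iff)
    thus ?thesis
      using z by (intro holomorphic_on_imp_differentiable_at[of _ "ball 0 R' \<inter> {z. Im z > 0}"])
        (auto intro!: open_Int open_halfspace_Im_gt)
  qed
  have dL: "hl field_differentiable at z" if "z \<in> interior L - {}" for z
  proof -
    have "interior L = ball 0 R \<inter> {z. Im z < 0}"
      unfolding L_def using interior_halfspace_le[of \<i> 0] by (simp add: interior_Int inner_complex_def)
    hence z: "z \<in> ball 0 R' \<inter> {z. Im z < 0}" using that R by auto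
    have "hl holomorphic_on (ball 0 R' \<inter> {z. Im z < 0})"
      unfolding hl_def by (auto intro!: holomorphic_intros holomorphic_on_subset[OF g] simp: complex_nonpos_Reals_iff)
    thus ?thesis
      using z by (intro holomorphic_on_imp_differentiable_at[of _ "ball 0 R' \<inter> {z. Im z < 0}"])
        (auto intro!: open_Int open_halfspace_Im_lt)
  qed
  have "convex U" "convex L"
    unfolding U_def L_def by (auto intro!: convex_Int convex_halfspace_Im_ge convex_halfspace_Im_le)
  obtain Hu where Hu: "\<And>z. z \<in> U \<Longrightarrow> (Hu has_field_derivative hu z) (at z within U)"
    using holomorphic_convex_primitive[OF \<open>convex U\<close> _ cU dU] by auto
  obtain Hl where Hl: "\<And>z. z \<in> L \<Longrightarrow> (Hl has_field_derivative hl z) (at z within L)"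
    using holomorphic_convex_primitive[OF \<open>convex L\<close> _ cL dL] by auto
  have arc: "(rcis R has_vector_derivative \<i> * rcis R t) (at t within S)" for t S
  proof -
    have "((\<lambda>z. of_real R * exp (\<i> * z)) has_field_derivative \<i> * rcis R t) (at (of_real t))"
      by (auto intro!: derivative_eq_intros simp: rcis_def cis_conv_exp)
    from has_vector_derivative_real_field[OF this] show ?thesis
      by (simp add: rcis_def[abs_def] cis_conv_exp)
  qed
  have seg: "(complex_of_real has_vector_derivative 1) (at r within S)" for r S
    by (auto intro!: derivative_eq_intros)
  have carc: "continuous_on S (rcis R)" for S
    by (auto simp: rcis_def intro!: continuous_intros)
  have arcU: "rcis R ` {0..pi} \<subseteq> U"
    using R by (auto simp: U_def intro!: mult_nonneg_nonneg sin_ge_zero)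
  have arcL: "rcis R ` {pi..2*pi} \<subseteq> L"
  proof -
    have "sin t \<le> 0" if "pi \<le> t" "t \<le> 2 * pi" for t :: real
      using sin_le_zero[of t] that by (cases "t = 2 * pi") auto
    thus ?thesis using R by (auto simp: L_def intro!: mult_nonneg_nonpos)
  qed
  have segU: "complex_of_real ` {-R..R} \<subseteq> U" and segL: "complex_of_real ` {-R..R} \<subseteq> L"
    by (auto simp: U_def L_def)
  have IU: "has_bochner_integral lborel (\<lambda>t. indicator {0..pi} t *\<^sub>R (\<i> * rcis R t * hu (rcis R t)))
      ((Hu \<circ> rcis R) pi - (Hu \<circ> rcis R) 0)"
  proof (rule has_bochner_integral_FTC_Icc)
    show "continuous_on {0..pi} (\<lambda>t. \<i> * rcis R t * hu (rcis R t))"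
      using arcU by (intro continuous_intros carc continuous_on_compose2[OF cU]) auto
    fix t assume t: "0 \<le> t" "t \<le> pi"
    have "rcis R t \<in> U" using t arcU by auto
    show "(Hu \<circ> rcis R has_vector_derivative \<i> * rcis R t * hu (rcis R t)) (at t within {0..pi})"
      by (rule field_vector_diff_chain_within[OF arc DERIV_subset[OF Hu[OF \<open>rcis R t \<in> U\<close>] arcU]])
  qed auto
  have IL: "has_bochner_integral lborel (\<lambda>t. indicator {pi..2*pi} t *\<^sub>R (\<i> * rcis R t * hl (rcis R t)))
      ((Hl \<circ> rcis R) (2*pi) - (Hl \<circ> rcis R) pi)"
  proof (rule has_bochner_integral_FTC_Icc)
    show "continuous_on {pi..2*pi} (\<lambda>t. \<i> * rcis R t * hl (rcis R t))"
      using arcL by (intro continuous_intros carc continuous_on_compose2[OF cL]) auto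
    fix t assume t: "pi \<le> t" "t \<le> 2*pi"
    have "rcis R t \<in> L" using t arcL by auto
    show "(Hl \<circ> rcis R has_vector_derivative \<i> * rcis R t * hl (rcis R t)) (at t within {pi..2*pi})"
      by (rule field_vector_diff_chain_within[OF arc DERIV_subset[OF Hl[OF \<open>rcis R t \<in> L\<close>] arcL]])
  qed auto
  have JU: "has_bochner_integral lborel (\<lambda>r. indicator {-R..R} r *\<^sub>R (1 * hu (complex_of_real r)))
      ((Hu \<circ> of_real) R - (Hu \<circ> of_real) (-R))"
  proof (rule has_bochner_integral_FTC_Icc)
    show "continuous_on {-R..R} (\<lambda>r. 1 * hu (complex_of_real r))"
      using segU by (intro continuous_intros continuous_on_compose2[OF cU]) auto
    fix r assume r: "-R \<le> r" "r \<le> R"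
    have "complex_of_real r \<in> U" using r segU by auto
    show "(Hu \<circ> of_real has_vector_derivative 1 * hu (complex_of_real r)) (at r within {-R..R})"
      by (rule field_vector_diff_chain_within[OF seg DERIV_subset[OF Hu[OF \<open>of_real r \<in> U\<close>] segU]])
  qed (use R in auto)
  have JL: "has_bochner_integral lborel (\<lambda>r. indicator {-R..R} r *\<^sub>R (1 * hl (complex_of_real r)))
      ((Hl \<circ> of_real) R - (Hl \<circ> of_real) (-R))"
  proof (rule has_bochner_integral_FTC_Icc)
    show "continuous_on {-R..R} (\<lambda>r. 1 * hl (complex_of_real r))"
      using segL by (intro continuous_intros continuous_on_compose2[OF cL]) auto
    fix r assume r: "-R \<le> r" "r \<le> R"
    have "complex_of_real r \<in> L" using r segL by auto
    show "(Hl \<circ> of_real has_vector_derivative 1 * hl (complex_of_real r)) (at r within {-R..R})"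
      by (rule field_vector_diff_chain_within[OF seg DERIV_subset[OF Hl[OF \<open>of_real r \<in> L\<close>] segL]])
  qed (use R in auto)
  have ends: "rcis R pi = of_real (-R)" "rcis R (2*pi) = of_real R" "rcis R 0 = of_real R"
    by (auto simp: rcis_def)
  let ?F = "\<lambda>t. g (rcis R t) * (\<Prod>j\<in>J. exp (M j * (complex_of_real (ln R) + \<i> * t)) * (1 - X j / rcis R t) powr M j)"
  have circ: "has_bochner_integral lborel (\<lambda>t. indicator {0..2*pi} t *\<^sub>R (\<i> * rcis R t * ?F t))
     (((Hu \<circ> rcis R) pi - (Hu \<circ> rcis R) 0) + ((Hl \<circ> rcis R) (2*pi) - (Hl \<circ> rcis R) pi))"
  proof -
    let ?G = "\<lambda>t. indicator {0..pi} t *\<^sub>R (\<i> * rcis R t * hu (rcis R t))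
        + indicator {pi..2*pi} t *\<^sub>R (\<i> * rcis R t * hl (rcis R t))"
    have G: "has_bochner_integral lborel ?G
       (((Hu \<circ> rcis R) pi - (Hu \<circ> rcis R) 0) + ((Hl \<circ> rcis R) (2*pi) - (Hl \<circ> rcis R) pi))"
      using has_bochner_integral_add[OF IU IL] .
    \<comment> \<open>At \<open>t = pi\<close> both half-circles contribute, so the two functions
      agree only off this point. Measurability is obtained by redefining one value.\<close>
    have eq: "indicator {0..2*pi} t *\<^sub>R (\<i> * rcis R t * ?F t) = ?G t" if "t \<noteq> pi" for t
    proof -
      have u: "hu (rcis R t) = ?F t" if "0 \<le> t" "t \<le> pi"
        unfolding hu_def using X that by (intro arg_cong2[where f="(*)"] prod.cong refl upper_branch_circle) auto
      have l: "hl (rcis R t) = ?F t" if "pi \<le> t" "t \<le> 2 * pi"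
        unfolding hl_def using X that by (intro arg_cong2[where f="(*)"] prod.cong refl lower_branch_circle) auto
      show ?thesis using u l \<open>t \<noteq> pi\<close> by (auto simp: indicator_def)
    qed
    have meas: "(\<lambda>t. indicator {0..2*pi} t *\<^sub>R (\<i> * rcis R t * ?F t)) \<in> borel_measurable lborel"
    proof -
      have "(\<lambda>t. if t = pi then indicator {0..2*pi} pi *\<^sub>R (\<i> * rcis R pi * ?F pi) else ?G t) \<in> borel_measurable lborel"
        by (intro measurable_If measurable_const borel_measurable_has_bochner_integral[OF G]) auto
      also have "(\<lambda>t. if t = pi then indicator {0..2*pi} pi *\<^sub>R (\<i> * rcis R pi * ?F pi) else ?G t)
          = (\<lambda>t. indicator {0..2*pi} t *\<^sub>R (\<i> * rcis R t * ?F t))"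
        using eq by auto
      finally show ?thesis .
    qed
    have ae: "AE t in lborel. ?G t = indicator {0..2*pi} t *\<^sub>R (\<i> * rcis R t * ?F t)"
      using AE_lborel_singleton[of pi] by eventually_elim (use eq in auto)
    show ?thesis
      by (rule has_bochner_integralI_AE[OF G meas ae])
  qed
  have real: "has_bochner_integral lborel (\<lambda>r. indicator {0..R} r *\<^sub>R (g (complex_of_real r) *
            ((\<Prod>j\<in>J. (if r < X j then exp (\<i> * pi * M j) else exp (2 * \<i> * pi * M j)) * complex_of_real (\<bar>r - X j\<bar> powr M j))
           - (\<Prod>j\<in>J. (if r < X j then exp (\<i> * pi * M j) else 1) * complex_of_real (\<bar>r - X j\<bar> powr M j)))))
      (((Hl \<circ> of_real) R - (Hl \<circ> of_real) (-R)) - ((Hu \<circ> of_real) R - (Hu \<circ> of_real) (-R)))"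
    (is "has_bochner_integral _ ?D _")
  proof -
    have "indicator {-R..R} r *\<^sub>R (1 * hl (complex_of_real r)) - indicator {-R..R} r *\<^sub>R (1 * hu (complex_of_real r)) = ?D r" for r
    proof -
      have u: "hu (complex_of_real r) = g (complex_of_real r) *
        (\<Prod>j\<in>J. (if r < X j then exp (\<i> * pi * M j) else 1) * complex_of_real (\<bar>r - X j\<bar> powr M j))"
        unfolding hu_def by (simp only: upper_branch_real[unfolded of_real_diff])
      have l: "hl (complex_of_real r) = g (complex_of_real r) *
        (\<Prod>j\<in>J. (if r < X j then exp (\<i> * pi * M j) else exp (2 * \<i> * pi * M j)) * complex_of_real (\<bar>r - X j\<bar> powr M j))"
        unfolding hl_def by (simp only: lower_branch_real[unfolded of_real_diff])
      \<comment> \<open>A negative \<open>r\<close> lies to the left of every node, so all factors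
        have argument pi from both sides; only [0, R] survives in the difference.\<close>
      have "hl (complex_of_real r) = hu (complex_of_real r)" if "r < 0"
        unfolding u l using X that by (intro arg_cong2[where f="(*)"] prod.cong refl) force
      thus ?thesis
        by (cases "r < 0") (auto simp: indicator_def u l algebra_simps)
    qed
    thus ?thesis using has_bochner_integral_diff[OF JL JU] by simp
  qed
  show ?thesis
    using has_bochner_integral_integral_eq[OF circ] has_bochner_integral_integral_eq[OF real]
    by (simp add: ends)
qed

section \<open>Holomorphic dependence on the exponents\<close>

lemma norm_exp_diff_quotient_le:
  fixes h u :: complex
  assumes "h \<noteq> 0"
  shows "norm ((exp (h * u) - 1) / h) \<le> norm u * exp (norm (h * u))"
proof -
  have "norm (exp (h * u) - exp 0) \<le> exp (norm (h * u)) * norm (h * u - 0)"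
  proof (rule field_differentiable_bound[of "cball 0 (norm (h * u))"])
    fix z :: complex assume "z \<in> cball 0 (norm (h * u))"
    thus "norm (exp z) \<le> exp (norm (h * u))"
      using norm_exp[of z] by (simp add: order_trans)
  qed (auto intro!: derivative_eq_intros)
  thus ?thesis using assms by (simp add: norm_divide norm_mult field_simps)
qed

text \<open>For negative \<open>v\<close> the inequality
  \<open>c * (-v) \<le> exp (c * (-v))\<close> trades the factor \<open>\<bar>v\<bar>\<close>, which
  differentiation in \<open>s\<close> produces, for a small part \<open>c\<close> of the exponential
  decay.\<close>

lemma abs_mult_exp_le:
  fixes v c K :: real
  assumes "v \<le> K" "0 < c" "0 \<le> K"
  shows "\<bar>v\<bar> * exp (c * v) \<le> K * exp (c * K) + 1 / c"
proof (cases "v \<ge> 0")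
  case True
  hence "\<bar>v\<bar> * exp (c * v) \<le> K * exp (c * K)"
    using assms by (intro mult_mono) auto
  thus ?thesis using assms by (simp add: add_increasing2)
next
  case False
  have "c * (-v) \<le> exp (c * (-v))" using exp_ge_add_one_self[of "c * (-v)"] by linarith
  hence "c * (-v) * exp (c * v) \<le> exp (c * (-v)) * exp (c * v)" by (intro mult_right_mono) auto
  also have "\<dots> = 1" by (simp flip: exp_add)
  finally have "\<bar>v\<bar> * exp (c * v) \<le> 1 / c" using False assms by (simp add: field_simps)
  moreover have "0 \<le> K * exp (c * K)" using assms by simp
  ultimately show ?thesis by linarith
qed

text \<open>Since \<open>Re s \<ge> 0\<close>, very negative values of \<open>Re u\<close> only
  help; this is what admits logarithms of quantities tending to 0.\<close>

lemma norm_exp_le_of_bounds: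
  fixes s u :: complex
  assumes "Re u \<le> K" "\<bar>Im u\<bar> \<le> K" "Re s \<ge> 0"
  shows "norm (exp (s * u)) \<le> exp (norm s * (2 * K))"
proof -
  have K: "K \<ge> 0" using assms by linarith
  have "Re (s * u) = Re s * Re u - Im s * Im u" by simp
  also have "\<dots> \<le> Re s * K + \<bar>Im s\<bar> * K"
  proof -
    have "- (Im s * Im u) \<le> \<bar>Im s\<bar> * \<bar>Im u\<bar>" by (metis abs_ge_minus_self abs_mult)
    also have "\<dots> \<le> \<bar>Im s\<bar> * K" using assms by (intro mult_left_mono) auto
    finally show ?thesis using mult_left_mono[OF assms(1,3)] by linarith
  qed
  also have "\<dots> \<le> norm s * K + norm s * K"
    using K complex_Re_le_cmod[of s] abs_Im_le_cmod[of s] by (intro add_mono mult_right_mono) auto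
  finally show ?thesis by (simp add: mult_ac)
qed

text \<open>The bounds on \<open>u\<close> are asked for only where \<open>g\<close> is nonzero,
  because the logarithms used for \<open>u\<close> are controlled only inside the box of
  integration.\<close>

lemma integrable_mult_exp:
  fixes g u :: "'a \<Rightarrow> complex"
  assumes g: "integrable M g" and u: "u \<in> borel_measurable M"
    and K: "\<And>y. g y \<noteq> 0 \<Longrightarrow> Re (u y) \<le> K \<and> \<bar>Im (u y)\<bar> \<le> K" and s: "Re s \<ge> 0"
  shows "integrable M (\<lambda>y. g y * exp (s * u y))"
proof (rule Bochner_Integration.integrable_bound)
  show "integrable M (\<lambda>y. exp (norm s * (2 * K)) * norm (g y))" using g by auto
  show "(\<lambda>y. g y * exp (s * u y)) \<in> borel_measurable M"
    using g u by (auto intro!: borel_measurable_times borel_measurable_continuous_on[where f=exp] continuous_intros)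
  show "AE y in M. norm (g y * exp (s * u y)) \<le> norm (exp (norm s * (2 * K)) * norm (g y))"
  proof (rule AE_I2)
    fix y
    show "norm (g y * exp (s * u y)) \<le> norm (exp (norm s * (2 * K)) * norm (g y))"
      using K[of y] s norm_exp_le_of_bounds[of "u y" K s]
      by (cases "g y = 0") (auto simp: norm_mult mult.commute mult_left_mono)
  qed
qed

text \<open>A Laplace-type transform: the exponent \<open>u\<close> may tend to \<open>-\<infinity>\<close>, so the integral
  converges only for \<open>Re s \<ge> 0\<close>.\<close>

lemma holomorphic_integral_mult_exp:
  fixes g u :: "'a \<Rightarrow> complex"
  assumes g: "integrable M g" and u: "u \<in> borel_measurable M"
    and K: "\<And>y. g y \<noteq> 0 \<Longrightarrow> Re (u y) \<le> K \<and> \<bar>Im (u y)\<bar> \<le> K"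
  shows "(\<lambda>s. \<integral>y. g y * exp (s * u y) \<partial>M) holomorphic_on {s. Re s > 0}"
proof -
  have "((\<lambda>s. \<integral>y. g y * exp (s * u y) \<partial>M) has_field_derivative (\<integral>y. g y * (exp (s * u y) * u y) \<partial>M)) (at s)"
    if s: "Re s > 0" for s
    unfolding DERIV_def tendsto_at_iff_sequentially
  proof (intro allI impI, unfold o_def)
    fix X :: "nat \<Rightarrow> complex" assume X: "\<forall>i. X i \<in> UNIV - {0}" "X \<longlonglongrightarrow> 0"
    \<comment> \<open>The decay rate \<open>Re s = 4 * c\<close> is spent in quarters: one pays for
      the increment of norm below \<open>c\<close>, one for the factor
      \<open>\<bar>Re (u y)\<bar>\<close>, and the remaining half is discarded at the cost of
      \<open>2 * c * K\<close>.\<close>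
    define c where "c = Re s / 4"
    have c: "c > 0" using s by (simp add: c_def)
    obtain N where N: "\<And>i. i \<ge> N \<Longrightarrow> norm (X i) < c"
      using X(2) c unfolding LIMSEQ_def by (auto simp: dist_norm)
    define Y where "Y i = X (i + N)" for i
    have Y0: "Y i \<noteq> 0" and Yc: "norm (Y i) < c" for i using X(1) N by (auto simp: Y_def)
    have Yl: "Y \<longlonglongrightarrow> 0" unfolding Y_def using X(2) by (rule LIMSEQ_ignore_initial_segment)
    define C where "C = exp (norm s * (2 * K)) * exp (c * K) * exp (2 * c * K) * exp (2 * c * K) *
        (K * exp (c * K) + 1 / c + K * exp (c * K))"
    have bnd: "norm (exp (s * u y) * ((exp (Y i * u y) - 1) / Y i)) \<le> C" if "g y \<noteq> 0" for i y
    proof -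
      let ?a = "Re (u y)" and ?b = "Im (u y)"
      have ab: "?a \<le> K" "\<bar>?b\<bar> \<le> K" "0 \<le> K" using K[OF that] by auto
      have nu: "norm (u y) \<le> \<bar>?a\<bar> + K" using cmod_le[of "u y"] ab by linarith
      have 1: "norm ((exp (Y i * u y) - 1) / Y i) \<le> norm (u y) * exp (norm (Y i * u y))"
        by (rule norm_exp_diff_quotient_le[OF Y0])
      have 2: "norm (Y i * u y) \<le> c * (\<bar>?a\<bar> + K)"
        unfolding norm_mult using Yc[of i] nu c by (intro mult_mono) auto
      have a2: "\<bar>?a\<bar> \<le> 2 * K - ?a" using ab by linarith
      have p: "c * \<bar>?a\<bar> \<le> 2 * (c * K) - c * ?a"
        using mult_left_mono[OF a2, of c] c by (simp add: algebra_simps)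
      have rs: "Re s * ?a = 4 * (c * ?a)" by (simp add: c_def)
      have 3: "norm (exp (s * u y)) = exp (Re s * ?a - Im s * ?b)" by simp
      have "- (Im s * ?b) \<le> \<bar>Im s\<bar> * \<bar>?b\<bar>" by (metis abs_ge_minus_self abs_mult)
      also have "\<dots> \<le> norm s * (2 * K)"
        using ab abs_Im_le_cmod[of s] by (intro mult_mono) auto
      finally have 4: "Re s * ?a - Im s * ?b + c * (\<bar>?a\<bar> + K) \<le> norm s * (2 * K) + c * K + 2 * c * K + c * ?a + 2 * c * ?a"
        using p unfolding rs distrib_left mult.assoc by linarith
      have 5: "2 * c * ?a \<le> 2 * c * K" using ab c by simp
      have "norm (exp (s * u y) * ((exp (Y i * u y) - 1) / Y i)) \<le>
          exp (Re s * ?a - Im s * ?b) * ((\<bar>?a\<bar> + K) * exp (c * (\<bar>?a\<bar> + K)))"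
        unfolding norm_mult[of "exp _"] 3 using nu 2 ab
        by (intro mult_left_mono order_trans[OF 1] mult_mono) auto
      also have "\<dots> = (\<bar>?a\<bar> + K) * exp (Re s * ?a - Im s * ?b + c * (\<bar>?a\<bar> + K))"
        by (simp add: exp_add)
      also have "\<dots> \<le> (\<bar>?a\<bar> + K) * exp (norm s * (2 * K) + c * K + 2 * c * K + 2 * c * K + c * ?a)"
      proof (intro mult_left_mono)
        have "Re s * ?a - Im s * ?b + c * (\<bar>?a\<bar> + K) \<le> norm s * (2 * K) + c * K + 2 * c * K + 2 * c * K + c * ?a"
          using 4 5 by linarith
        thus "exp (Re s * ?a - Im s * ?b + c * (\<bar>?a\<bar> + K)) \<le> exp (norm s * (2 * K) + c * K + 2 * c * K + 2 * c * K + c * ?a)"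
          by (simp only: exp_le_cancel_iff)
      qed (use ab in auto)
      also have "\<dots> = exp (norm s * (2 * K)) * exp (c * K) * exp (2 * c * K) * exp (2 * c * K) * (\<bar>?a\<bar> * exp (c * ?a) + K * exp (c * ?a))"
        unfolding exp_add by (simp only: ring_distribs mult_ac)
      also have "\<dots> \<le> exp (norm s * (2 * K)) * exp (c * K) * exp (2 * c * K) * exp (2 * c * K) * (K * exp (c * K) + 1 / c + K * exp (c * K))"
        using abs_mult_exp_le[OF ab(1) c ab(3)] ab c
        by (intro mult_left_mono add_mono) auto
      finally show ?thesis unfolding C_def .
    qed
    have lim: "(\<lambda>i. \<integral>y. g y * (exp (s * u y) * ((exp (Y i * u y) - 1) / Y i)) \<partial>M)
      \<longlonglongrightarrow> (\<integral>y. g y * (exp (s * u y) * u y) \<partial>M)"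
    proof (rule integral_dominated_convergence[where w="\<lambda>y. C * norm (g y)"])
      show "integrable M (\<lambda>y. C * norm (g y))" using g by auto
      show "AE y in M. (\<lambda>i. g y * (exp (s * u y) * ((exp (Y i * u y) - 1) / Y i))) \<longlonglongrightarrow> g y * (exp (s * u y) * u y)"
      proof (rule AE_I2)
        fix y
        have "((\<lambda>h. exp (h * u y)) has_field_derivative u y) (at 0)"
          by (auto intro!: derivative_eq_intros)
        hence "((\<lambda>h. (exp (h * u y) - 1) / h) \<longlongrightarrow> u y) (at 0)"
          by (simp add: DERIV_def)
        hence "(\<lambda>i. (exp (Y i * u y) - 1) / Y i) \<longlonglongrightarrow> u y"
          using Y0 Yl by (auto simp: tendsto_at_iff_sequentially o_def)
        thus "(\<lambda>i. g y * (exp (s * u y) * ((exp (Y i * u y) - 1) / Y i))) \<longlonglongrightarrow> g y * (exp (s * u y) * u y)"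
          by (intro tendsto_intros)
      qed
      show "AE y in M. norm (g y * (exp (s * u y) * ((exp (Y i * u y) - 1) / Y i))) \<le> C * norm (g y)" for i
      proof (rule AE_I2)
        fix y show "norm (g y * (exp (s * u y) * ((exp (Y i * u y) - 1) / Y i))) \<le> C * norm (g y)"
          unfolding norm_mult[of "g y"] using mult_left_mono[OF bnd[of y i], of "norm (g y)"]
          by (cases "g y = 0") (simp_all only: norm_zero mult.commute[of C] norm_ge_zero mult_zero_left mult_zero_right order_refl not_False_eq_True simp_thms)
      qed
      have [measurable]: "g \<in> borel_measurable M" "u \<in> borel_measurable M" using g u by auto
      have e: "(\<lambda>y. exp (h * u y)) \<in> borel_measurable M" for h
        by (intro borel_measurable_continuous_on[where f=exp] continuous_intros) measurable
      show "(\<lambda>y. g y * (exp (s * u y) * u y)) \<in> borel_measurable M"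
        using e by measurable
      show "(\<lambda>y. g y * (exp (s * u y) * ((exp (Y i * u y) - 1) / Y i))) \<in> borel_measurable M" for i
        using e by measurable
    qed
    have eq: "((\<integral>y. g y * exp ((s + Y i) * u y) \<partial>M) - (\<integral>y. g y * exp (s * u y) \<partial>M)) / Y i
       = (\<integral>y. g y * (exp (s * u y) * ((exp (Y i * u y) - 1) / Y i)) \<partial>M)" for i
    proof -
      have "Re (s + Y i) \<ge> 0" using Yc[of i] abs_Re_le_cmod[of "Y i"] c unfolding c_def by (simp add: abs_le_iff)
      hence "(\<integral>y. g y * exp ((s + Y i) * u y) \<partial>M) - (\<integral>y. g y * exp (s * u y) \<partial>M)
         = (\<integral>y. g y * exp ((s + Y i) * u y) - g y * exp (s * u y) \<partial>M)"
        using s by (intro Bochner_Integration.integral_diff[symmetric] integrable_mult_exp[OF g u K]) auto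
      thus ?thesis by (simp add: exp_add algebra_simps diff_divide_distrib flip: integral_divide_zero)
    qed
    have "(\<lambda>i. ((\<integral>y. g y * exp ((s + X (i + N)) * u y) \<partial>M) - (\<integral>y. g y * exp (s * u y) \<partial>M)) / X (i + N))
       \<longlonglongrightarrow> (\<integral>y. g y * (exp (s * u y) * u y) \<partial>M)"
      using lim unfolding eq[symmetric] by (simp add: Y_def)
    thus "(\<lambda>i. ((\<integral>y. g y * exp ((s + X i) * u y) \<partial>M) - (\<integral>y. g y * exp (s * u y) \<partial>M)) / X i)
       \<longlonglongrightarrow> (\<integral>y. g y * (exp (s * u y) * u y) \<partial>M)"
      by (rule LIMSEQ_offset)
  qed
  thus ?thesis
    unfolding holomorphic_on_def field_differentiable_def
    by (auto intro: has_field_derivative_at_within)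
qed

lemma integral_mult_exp_tendsto:
  fixes g u :: "'a \<Rightarrow> complex"
  assumes g: "integrable M g" and u: "u \<in> borel_measurable M"
    and K: "\<And>y. g y \<noteq> 0 \<Longrightarrow> Re (u y) \<le> K \<and> \<bar>Im (u y)\<bar> \<le> K"
  shows "(\<lambda>i. \<integral>y. g y * exp (complex_of_real (1 / Suc i) * u y) \<partial>M) \<longlonglongrightarrow> (\<integral>y. g y \<partial>M)"
proof (rule integral_dominated_convergence[where w="\<lambda>y. exp (2 * \<bar>K\<bar>) * norm (g y)"])
  show "integrable M (\<lambda>y. exp (2 * \<bar>K\<bar>) * norm (g y))" using g by auto
  have "(\<lambda>i. 1 / Suc i) \<longlonglongrightarrow> (0::real)" using LIMSEQ_inverse_real_of_nat by (simp add: field_simps)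
  from tendsto_of_real[OF this, where ?'a=complex] have l: "(\<lambda>i. complex_of_real (1 / Suc i)) \<longlonglongrightarrow> 0" by simp
  show "AE y in M. (\<lambda>i. g y * exp (complex_of_real (1 / Suc i) * u y)) \<longlonglongrightarrow> g y"
  proof (rule AE_I2)
    fix y
    have "(\<lambda>i. g y * exp (complex_of_real (1 / Suc i) * u y)) \<longlonglongrightarrow> g y * exp (0 * u y)"
      by (intro tendsto_intros l)
    thus "(\<lambda>i. g y * exp (complex_of_real (1 / Suc i) * u y)) \<longlonglongrightarrow> g y" by simp
  qed
  show "AE y in M. norm (g y * exp (complex_of_real (1 / Suc i) * u y)) \<le> exp (2 * \<bar>K\<bar>) * norm (g y)" for i
  proof (rule AE_I2)
    fix y
    show "norm (g y * exp (complex_of_real (1 / Suc i) * u y)) \<le> exp (2 * \<bar>K\<bar>) * norm (g y)"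
    proof (cases "g y = 0")
      case False
      have "norm (exp (complex_of_real (1 / Suc i) * u y)) \<le> exp (norm (complex_of_real (1 / Suc i)) * (2 * K))"
        using K[OF False] by (intro norm_exp_le_of_bounds) auto
      also have "norm (complex_of_real (1 / Suc i)) * (2 * K) \<le> 1 * (2 * \<bar>K\<bar>)"
        unfolding norm_of_real using K[OF False] by (intro mult_mono) auto
      finally show ?thesis by (simp add: norm_mult mult.commute mult_left_mono)
    qed auto
  qed
  show "(\<lambda>y. g y * exp (complex_of_real (1 / Suc i) * u y)) \<in> borel_measurable M" for i
    using g u by (intro borel_measurable_times borel_measurable_continuous_on[where f=exp] continuous_intros) auto
qed (use g in auto)

text \<open>Analytic continuation extends the equation to all \<open>s > 0\<close>; then let \<open>s\<close> tend to \<open>0\<close>.\<close>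

lemma integral_eq_by_continuation:
  fixes g u :: "'a \<Rightarrow> complex" and h v :: "'b \<Rightarrow> 'a \<Rightarrow> complex"
  assumes g: "integrable M g" and u: "u \<in> borel_measurable M"
    and K: "\<And>y. g y \<noteq> 0 \<Longrightarrow> Re (u y) \<le> K \<and> \<bar>Im (u y)\<bar> \<le> K"
    and h: "\<And>e. e \<in> E \<Longrightarrow> integrable M (h e)" and v: "\<And>e. e \<in> E \<Longrightarrow> v e \<in> borel_measurable M"
    and L: "\<And>e y. e \<in> E \<Longrightarrow> h e y \<noteq> 0 \<Longrightarrow> Re (v e y) \<le> L \<and> \<bar>Im (v e y)\<bar> \<le> L"
    and eq: "\<And>s. s > S \<Longrightarrow> (\<integral>y. g y * exp (complex_of_real s * u y) \<partial>M) = (\<Sum>e\<in>E. \<integral>y. h e y * exp (complex_of_real s * v e y) \<partial>M)"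
  shows "(\<integral>y. g y \<partial>M) = (\<Sum>e\<in>E. \<integral>y. h e y \<partial>M)"
proof -
  define f where "f s = (\<integral>y. g y * exp (s * u y) \<partial>M) - (\<Sum>e\<in>E. \<integral>y. h e y * exp (s * v e y) \<partial>M)" for s
  define S' where "S' = max 0 S + 1"
  have S': "S' > 0" "S' > S" by (auto simp: S'_def)
  have hol: "f holomorphic_on {s. Re s > 0}"
    unfolding f_def
    by (intro holomorphic_on_diff holomorphic_on_sum holomorphic_integral_mult_exp[OF g u K]
        holomorphic_integral_mult_exp[OF h v L])
  have "f (complex_of_real (1 / Suc i)) = 0" for i
  proof (rule analytic_continuation[OF hol, of "complex_of_real ` {S'..}" "of_real (S' + 1)"])
    show "open {s. Re s > 0}" by (rule open_halfspace_Re_gt)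
    show "connected {s. Re s > 0}" by (intro convex_connected convex_halfspace_Re_gt)
    show "complex_of_real (S' + 1) islimpt complex_of_real ` {S'..}"
    proof -
      have "(S' + 1) islimpt {S'..}" by (intro interior_limit_point) auto
      thus ?thesis
        unfolding islimpt_approachable
        by (metis (no_types, lifting) dist_of_real image_eqI of_real_eq_iff)
    qed
    show "f z = 0" if "z \<in> complex_of_real ` {S'..}" for z
      using that S' eq by (force simp: f_def)
  qed (use S' in auto)
  moreover have "(\<lambda>i. f (complex_of_real (1 / Suc i))) \<longlonglongrightarrow> (\<integral>y. g y \<partial>M) - (\<Sum>e\<in>E. \<integral>y. h e y \<partial>M)"
    unfolding f_def
    by (intro tendsto_diff tendsto_sum integral_mult_exp_tendsto[OF g u K] integral_mult_exp_tendsto[OF h v L])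
  ultimately have "(\<lambda>i. 0) \<longlonglongrightarrow> (\<integral>y. g y \<partial>M) - (\<Sum>e\<in>E. \<integral>y. h e y \<partial>M)"
    by simp
  thus ?thesis using LIMSEQ_unique[OF tendsto_const] by fastforce
qed

section \<open>Deforming one variable after the other\<close>

definition expo :: "(nat \<Rightarrow> real) \<Rightarrow> (nat \<Rightarrow> nat \<Rightarrow> real) \<Rightarrow> nat \<Rightarrow> nat \<Rightarrow> real" where
  "expo m mm i j = (if j = i then m i else mm i j)"

definition node :: "(nat \<Rightarrow> real) \<Rightarrow> nat \<Rightarrow> nat \<Rightarrow> real" where
  "node y i j = (if j = i then 0 else y j)"

text \<open>Deforming the contours from the innermost variable outwards passes through integrands where the
  variables \<open>i < p\<close> still run over the circles of radius \<open>R i\<close>, parametrised by the angle \<open>y i\<close>,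
  and the variables \<open>i \<ge> p\<close> run over the real segments \<open>[0, R i]\<close>. The exponent of
  \<open>z\<^sub>i - z\<^sub>j\<close> is \<open>M i j\<close>; the diagonal entry \<open>M i i\<close> is the exponent of \<open>z\<^sub>i = z\<^sub>i - 0\<close>, so
  \<open>node\<close> puts the point \<open>0\<close> in the diagonal position. A factor \<open>(z\<^sub>i - z\<^sub>j)\<^bsup>M i j\<^esup>\<close> is the branch
  \<open>z\<^sub>i\<^bsup>M i j\<^esup> (1 - z\<^sub>j / z\<^sub>i)\<^bsup>M i j\<^esup>\<close> with the argument of \<open>z\<^sub>i\<close> in \<open>[0, 2\<pi>]\<close>.\<close>

definition circle_factor ::
  "nat \<Rightarrow> (nat \<Rightarrow> real) \<Rightarrow> (nat \<Rightarrow> nat \<Rightarrow> real) \<Rightarrow> nat \<Rightarrow> (nat \<Rightarrow> real) \<Rightarrow> nat \<Rightarrow> complex" where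
  "circle_factor n R M p y i =
     indicator {0..2*pi} (y i) *\<^sub>R (\<i> * rcis (R i) (y i) *
       (\<Prod>j\<in>{i..<n}. exp (M i j * (complex_of_real (ln (R i)) + \<i> * y i)) *
          (1 - (if j = i then 0 else if j < p then rcis (R j) (y j) else complex_of_real (y j)) / rcis (R i) (y i)) powr M i j))"

text \<open>The difference of the boundary values on the lower and the upper side of the slit \<open>[0, R i]\<close>.\<close>

definition line_factor ::
  "nat \<Rightarrow> (nat \<Rightarrow> real) \<Rightarrow> (nat \<Rightarrow> nat \<Rightarrow> real) \<Rightarrow> (nat \<Rightarrow> real) \<Rightarrow> nat \<Rightarrow> complex" where
  "line_factor n R M y i =
     indicator {0..R i} (y i) *\<^sub>R
       ((\<Prod>j\<in>{i..<n}. (if y i < node y i j then exp (\<i> * pi * M i j) else exp (2 * \<i> * pi * M i j)) * complex_of_real (\<bar>y i - node y i j\<bar> powr M i j))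
      - (\<Prod>j\<in>{i..<n}. (if y i < node y i j then exp (\<i> * pi * M i j) else 1) * complex_of_real (\<bar>y i - node y i j\<bar> powr M i j)))"

definition hybrid ::
  "nat \<Rightarrow> (nat \<Rightarrow> real) \<Rightarrow> (nat \<Rightarrow> nat \<Rightarrow> real) \<Rightarrow> nat \<Rightarrow> (nat \<Rightarrow> real) \<Rightarrow> complex" where
  "hybrid n R M p y = (\<Prod>i<n. if i < p then circle_factor n R M p y i else line_factor n R M y i)"

section \<open>Measurability and integrability of the hybrid integrands\<close>

interpretation lborel_product: product_sigma_finite "\<lambda>_::nat. lborel :: real measure"
  by standard

lemma integrable_of_box_bound:
  fixes f :: "(nat \<Rightarrow> real) \<Rightarrow> complex"
  assumes "f \<in> borel_measurable (PiM {0..<n} (\<lambda>_. lborel))"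
    and "\<And>y. norm (f y) \<le> B * (\<Prod>i\<in>{0..<n}. indicator {0..b i} (y i))"
  shows "integrable (PiM {0..<n} (\<lambda>_. lborel)) f"
proof (rule Bochner_Integration.integrable_bound)
  have "integrable lborel (indicator {0..b} :: real \<Rightarrow> real)" for b :: real
    by (cases "0 \<le> b") (auto intro!: integrable_real_indicator)
  hence "integrable (PiM {0..<n} (\<lambda>_. lborel)) (\<lambda>y. (\<Prod>i\<in>{0..<n}. indicator {0..b i} (y i) :: real))"
    by (intro lborel_product.product_integrable_prod) auto
  thus "integrable (PiM {0..<n} (\<lambda>_. lborel)) (\<lambda>y. B * (\<Prod>i\<in>{0..<n}. indicator {0..b i} (y i) :: real))"
    by simp
  show "AE y in PiM {0..<n} (\<lambda>_. lborel). norm (f y) \<le> norm (B * (\<Prod>i\<in>{0..<n}. indicator {0..b i} (y i) :: real))"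
    using assms(2) by (intro AE_I2) (simp add: order_trans[OF _ abs_ge_self])
qed (fact assms(1))

lemma measurable_exp_complex [measurable (raw)]:
  fixes f :: "'a \<Rightarrow> complex"
  assumes [measurable]: "f \<in> borel_measurable N"
  shows "(\<lambda>x. exp (f x)) \<in> borel_measurable N"
proof -
  have [measurable]: "(exp :: complex \<Rightarrow> complex) \<in> borel_measurable borel"
    by (intro borel_measurable_continuous_onI continuous_intros)
  show ?thesis by measurable
qed

lemma measurable_powr_complex [measurable (raw)]:
  fixes f :: "'a \<Rightarrow> complex"
  assumes [measurable]: "f \<in> borel_measurable N"
  shows "(\<lambda>x. f x powr c) \<in> borel_measurable N"
  unfolding powr_def by measurable

lemma measurable_rcis [measurable (raw)]:
  assumes [measurable]: "f \<in> borel_measurable N"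
  shows "(\<lambda>x. rcis r (f x)) \<in> borel_measurable N"
proof -
  have [measurable]: "rcis r \<in> borel_measurable borel"
    unfolding rcis_def[abs_def] by (intro borel_measurable_continuous_onI continuous_intros)
  show ?thesis by measurable
qed

lemma measurable_coord:
  fixes j n :: nat
  shows "j < n \<Longrightarrow> (\<lambda>y. y j) \<in> borel_measurable (PiM {0..<n} (\<lambda>_. lborel :: real measure))"
  using measurable_component_singleton[of j "{0..<n}" "\<lambda>_. lborel :: real measure"]
  unfolding measurable_lborel2 by simp

lemma measurable_circle_factor:
  assumes "i < n"
  shows "(\<lambda>y. circle_factor n R M p y i) \<in> borel_measurable (PiM {0..<n} (\<lambda>_. lborel))"
proof -
  note [measurable] = measurable_coord[OF assms]
  have fac: "(\<lambda>y. exp (M i j * (complex_of_real (ln (R i)) + \<i> * y i)) *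
          (1 - (if j = i then 0 else if j < p then rcis (R j) (y j) else complex_of_real (y j)) / rcis (R i) (y i)) powr M i j)
      \<in> borel_measurable (PiM {0..<n} (\<lambda>_. lborel))" if "j \<in> {i..<n}" for j
  proof -
    have [measurable]: "(\<lambda>y. y j) \<in> borel_measurable (PiM {0..<n} (\<lambda>_. lborel :: real measure))"
      using that by (intro measurable_coord) auto
    show ?thesis by measurable
  qed
  have z: "(\<lambda>y. \<i> * rcis (R i) (y i)) \<in> borel_measurable (PiM {0..<n} (\<lambda>_. lborel))"
    and ind: "(\<lambda>y. indicator {0..2*pi} (y i) :: real) \<in> borel_measurable (PiM {0..<n} (\<lambda>_. lborel))"
    by measurable
  show ?thesis unfolding circle_factor_def
    by (rule borel_measurable_scaleR[OF ind borel_measurable_times[OF z borel_measurable_prod[OF fac]]])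
qed

lemma measurable_line_factor:
  assumes "i < n"
  shows "(\<lambda>y. line_factor n R M y i) \<in> borel_measurable (PiM {0..<n} (\<lambda>_. lborel))"
proof -
  note [measurable] = measurable_coord[OF assms]
  have "(\<lambda>y. (if y i < node y i j then c else d) * complex_of_real (\<bar>y i - node y i j\<bar> powr M i j))
      \<in> borel_measurable (PiM {0..<n} (\<lambda>_. lborel))" if "j \<in> {i..<n}" for j and c d :: complex
  proof -
    have [measurable]: "(\<lambda>y. y j) \<in> borel_measurable (PiM {0..<n} (\<lambda>_. lborel :: real measure))"
      using that by (intro measurable_coord) auto
    have [measurable]: "(\<lambda>y. node y i j) \<in> borel_measurable (PiM {0..<n} (\<lambda>_. lborel))"
      unfolding node_def by measurable
    show ?thesis by measurable
  qed
  note fac = this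
  have ind: "(\<lambda>y. indicator {0..R i} (y i) :: real) \<in> borel_measurable (PiM {0..<n} (\<lambda>_. lborel))"
    by measurable
  show ?thesis unfolding line_factor_def
    by (rule borel_measurable_scaleR[OF ind borel_measurable_diff[OF borel_measurable_prod[OF fac] borel_measurable_prod[OF fac]]])
qed

lemma measurable_hybrid:
  "hybrid n R M p \<in> borel_measurable (PiM {0..<n} (\<lambda>_. lborel))"
  unfolding hybrid_def[abs_def]
proof (rule borel_measurable_prod)
  fix i assume "i \<in> {..<n}"
  thus "(\<lambda>y. if i < p then circle_factor n R M p y i else line_factor n R M y i)
      \<in> borel_measurable (PiM {0..<n} (\<lambda>_. lborel))"
    using measurable_circle_factor[of i n R M p] measurable_line_factor[of i n R M] by (cases "i < p") auto
qed

lemma norm_complex_powr_real: "norm (w powr complex_of_real c) = norm w powr c"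
  by (cases "w = 0") (auto simp: norm_powr_real_powr')

lemma powr_le_max:
  fixes x :: real
  assumes "0 < d" "d \<le> x" "x \<le> e"
  shows "x powr c \<le> max (e powr c) (d powr c)"
proof (cases "c \<ge> 0")
  case True
  hence "x powr c \<le> e powr c" using assms by (intro powr_mono2) auto
  thus ?thesis by simp
next
  case False
  hence "x powr c \<le> d powr c" using assms by (intro powr_mono2') auto
  thus ?thesis by simp
qed

text \<open>On a circle the quotients of variables stay within \<open>R j / R i < 1\<close>, so each
  base has norm between \<open>1 - R j / R i\<close> and 2; a power of it is bounded for exponents
  of either sign.\<close>

lemma norm_circle_factor_le:
  assumes R: "\<And>i j. i < j \<Longrightarrow> j < n \<Longrightarrow> R j < R i" "\<And>i. i < n \<Longrightarrow> 0 < R i"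
    and box: "\<And>j. j < n \<Longrightarrow> \<not> j < p \<Longrightarrow> 0 \<le> y j \<and> y j \<le> R j" and i: "i < n"
  shows "norm (circle_factor n R M p y i) \<le>
     R i * (\<Prod>j\<in>{i..<n}. R i powr M i j * max (2 powr M i j) ((if j = i then 1 else 1 - R j / R i) powr M i j))"
proof -
  have Ri: "R i > 0" using R i by auto
  let ?z = "rcis (R i) (y i)"
  let ?w = "\<lambda>j. 1 - (if j = i then 0 else if j < p then rcis (R j) (y j) else complex_of_real (y j)) / ?z"
  have w: "norm (?w j powr complex_of_real (M i j)) \<le> max (2 powr M i j) ((if j = i then 1 else 1 - R j / R i) powr M i j)"
    if j: "j \<in> {i..<n}" for j
  proof (cases "j = i")
    case True thus ?thesis by simp
  next
    case False
    hence ij: "i < j" "j < n" using j by auto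
    let ?q = "(if j < p then rcis (R j) (y j) else complex_of_real (y j)) / ?z"
    have "norm (if j < p then rcis (R j) (y j) else complex_of_real (y j)) \<le> R j"
      using R(2)[of j] ij box[of j] by auto
    hence q: "norm ?q \<le> R j / R i" using Ri by (simp add: norm_divide divide_right_mono)
    have lt: "R j / R i < 1" using R(1)[OF ij] Ri by simp
    have "1 - R j / R i \<le> norm (1 - ?q)"
      using q norm_triangle_ineq2[of 1 ?q] by simp
    moreover have "norm (1 - ?q) \<le> 2"
      using q lt norm_triangle_ineq4[of 1 ?q] by simp
    ultimately have "norm (1 - ?q) powr M i j \<le> max (2 powr M i j) ((1 - R j / R i) powr M i j)"
      using lt by (intro powr_le_max) auto
    thus ?thesis using False by (simp add: norm_complex_powr_real)
  qed
  have e: "norm (exp (complex_of_real (M i j) * (complex_of_real (ln (R i)) + \<i> * y i))) = R i powr M i j" for j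
    using Ri by (simp add: powr_def)
  have "norm (circle_factor n R M p y i) \<le> norm (\<i> * ?z * (\<Prod>j\<in>{i..<n}. exp (M i j * (complex_of_real (ln (R i)) + \<i> * y i)) * ?w j powr M i j))"
    unfolding circle_factor_def by (auto simp: indicator_def)
  also have "\<dots> = R i * (\<Prod>j\<in>{i..<n}. R i powr M i j * norm (?w j powr complex_of_real (M i j)))"
    unfolding norm_mult e prod_norm[symmetric] using Ri by simp
  also have "\<dots> \<le> R i * (\<Prod>j\<in>{i..<n}. R i powr M i j * max (2 powr M i j) ((if j = i then 1 else 1 - R j / R i) powr M i j))"
    using Ri w by (intro mult_left_mono prod_mono) auto
  finally show ?thesis .
qed

lemma norm_line_factor_le:
  assumes box: "\<And>j. j \<in> {i..<n} \<Longrightarrow> 0 \<le> y j \<and> y j \<le> 1" and M: "\<And>j. j \<in> {i..<n} \<Longrightarrow> 0 < M i j" and i: "i < n"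
  shows "norm (line_factor n R M y i) \<le> 2"
proof -
  have 1: "norm (complex_of_real (\<bar>y i - node y i j\<bar> powr M i j)) \<le> 1" if "j \<in> {i..<n}" for j
    using box[OF that] box[of i] i M[OF that] by (auto simp: node_def intro!: powr_le1)
  have ph: "norm (if b then exp (\<i> * pi * M i j) else exp (2 * \<i> * pi * M i j)) = 1"
    "norm (if b then exp (\<i> * pi * M i j) else 1) = 1" for b j by auto
  have 2: "norm (\<Prod>j\<in>{i..<n}. (if y i < node y i j then exp (\<i> * pi * M i j) else exp (2 * \<i> * pi * M i j)) * complex_of_real (\<bar>y i - node y i j\<bar> powr M i j)) \<le> 1"
    unfolding prod_norm[symmetric]
    by (intro prod_le_1 conjI norm_ge_zero, simp only: norm_mult ph mult_1) (rule 1)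
  have 3: "norm (\<Prod>j\<in>{i..<n}. (if y i < node y i j then exp (\<i> * pi * M i j) else 1) * complex_of_real (\<bar>y i - node y i j\<bar> powr M i j)) \<le> 1"
    unfolding prod_norm[symmetric]
    by (intro prod_le_1 conjI norm_ge_zero, simp only: norm_mult ph mult_1) (rule 1)
  show ?thesis unfolding line_factor_def
    using norm_triangle_le_diff[OF add_mono[OF 2 3]] by (auto simp: indicator_def)
qed

lemma integrable_hybrid:
  assumes R: "\<And>i j. i < j \<Longrightarrow> j < n \<Longrightarrow> R j < R i" "\<And>i. i < n \<Longrightarrow> 0 < R i \<and> R i \<le> 1"
    and M: "\<And>i j. p \<le> i \<Longrightarrow> i \<le> j \<Longrightarrow> j < n \<Longrightarrow> 0 < M i j"
  shows "integrable (PiM {0..<n} (\<lambda>_. lborel)) (hybrid n R M p)"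
proof -
  define B where "B i = R i * (\<Prod>j\<in>{i..<n}. R i powr M i j * max (2 powr M i j) ((if j = i then 1 else 1 - R j / R i) powr M i j))" for i
  define b where "b i = (if i < p then 2 * pi else R i)" for i
  have "norm (hybrid n R M p y) \<le> (\<Prod>i<n. max (B i) 2) * (\<Prod>i\<in>{0..<n}. indicator {0..b i} (y i))" for y
  proof (cases "\<forall>i<n. y i \<in> {0..b i}")
    case True
    have box: "0 \<le> y j \<and> y j \<le> R j" if "j < n" "\<not> j < p" for j
      using True that by (auto simp: b_def)
    have "norm (if i < p then circle_factor n R M p y i else line_factor n R M y i) \<le> max (B i) 2" if i: "i < n" for i
    proof (cases "i < p")
      case True
      have "norm (circle_factor n R M p y i) \<le> B i" unfolding B_def
        using R box i by (intro norm_circle_factor_le) auto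
      thus ?thesis using True by simp
    next
      case False
      have "norm (line_factor n R M y i) \<le> 2"
      proof (rule norm_line_factor_le)
        fix j assume "j \<in> {i..<n}"
        thus "0 \<le> y j \<and> y j \<le> 1" using box[of j] R(2)[of j] False by auto
      qed (use M False i in auto)
      thus ?thesis using False by simp
    qed
    hence "norm (hybrid n R M p y) \<le> (\<Prod>i<n. max (B i) 2)"
      unfolding hybrid_def prod_norm[symmetric] by (intro prod_mono) auto
    also have "\<dots> = (\<Prod>i<n. max (B i) 2) * (\<Prod>i\<in>{0..<n}. indicator {0..b i} (y i))"
      using True by simp
    finally show ?thesis .
  next
    case False
    then obtain i where i: "i < n" "y i \<notin> {0..b i}" by auto
    hence "(if i < p then circle_factor n R M p y i else line_factor n R M y i) = 0"
      by (auto simp: b_def circle_factor_def line_factor_def indicator_def)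
    hence "hybrid n R M p y = 0" unfolding hybrid_def using i by (intro prod_zero) blast+
    moreover have "0 \<le> (\<Prod>i<n. max (B i) 2) * (\<Prod>i\<in>{0..<n}. indicator {0..b i} (y i) :: real)"
      by (intro mult_nonneg_nonneg prod_nonneg) (auto simp: le_max_iff_disj)
    ultimately show ?thesis by simp
  qed
  thus ?thesis by (rule integrable_of_box_bound[OF measurable_hybrid])
qed

text \<open>By Fubini the other coordinates may be frozen. The line factors with
  \<open>i > p\<close> do not involve variable \<open>p\<close>, the circle factors with
  \<open>i < p\<close> are holomorphic in it, and its own factor is exactly the integrand of the
  one-variable collapse.\<close>

lemma integral_hybrid_Suc:
  assumes R: "\<And>i j. i < j \<Longrightarrow> j < n \<Longrightarrow> R j < R i" "\<And>i. i < n \<Longrightarrow> 0 < R i \<and> R i \<le> 1"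
    and M: "\<And>i j. i \<le> j \<Longrightarrow> j < n \<Longrightarrow> 0 < M i j" and p: "p < n"
  shows "(\<integral>y. hybrid n R M (Suc p) y \<partial>PiM {0..<n} (\<lambda>_. lborel)) = (\<integral>y. hybrid n R M p y \<partial>PiM {0..<n} (\<lambda>_. lborel))"
proof -
  let ?I = "{0..<n} - {p}"
  have I: "insert p ?I = {0..<n}" using p by auto
  have int: "integrable (PiM (insert p ?I) (\<lambda>_. lborel)) (hybrid n R M q)" for q
    unfolding I using R M by (intro integrable_hybrid) auto
  have "(\<integral>t. hybrid n R M (Suc p) (x(p := t)) \<partial>lborel) = (\<integral>r. hybrid n R M p (x(p := r)) \<partial>lborel)" for x
  proof -
    let ?z = "\<lambda>i. rcis (R i) (x i)"
    \<comment> \<open>The circle factor of an outer variable \<open>i < p\<close> without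
      \<open>(1 - z_p / z_i) powr M i p\<close>, the only part in which variable \<open>p\<close>
      occurs; those parts are collected in \<open>g\<close>.\<close>
    define A where "A i = indicator {0..2*pi} (x i) *\<^sub>R (\<i> * ?z i * (exp (M i p * (complex_of_real (ln (R i)) + \<i> * x i)) *
       (\<Prod>j\<in>{i..<n} - {p}. exp (M i j * (complex_of_real (ln (R i)) + \<i> * x i)) *
          (1 - (if j = i then 0 else if j < p then rcis (R j) (x j) else complex_of_real (x j)) / ?z i) powr M i j)))" for i
    define C where "C = (\<Prod>i<p. A i) * (\<Prod>i\<in>{p<..<n}. line_factor n R M x i)"
    define g where "g z = (\<Prod>i<p. (1 - z / ?z i) powr M i p)" for z
    have split: "(\<Prod>i<n. h i) = (\<Prod>i<p. h i) * (h p * (\<Prod>i\<in>{p<..<n}. h i))" for h :: "nat \<Rightarrow> complex"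
    proof -
      have e: "{..<n} = {..<p} \<union> insert p {p<..<n}" using p by auto
      show ?thesis unfolding e by (subst prod.union_disjoint) auto
    qed
    have circ: "circle_factor n R M q (x(p := t)) i = A i * (1 - (if p < q then rcis (R p) t else of_real t) / ?z i) powr M i p"
      if "i < p" "q = p \<or> q = Suc p" for i t q
    proof -
      have pi: "p \<in> {i..<n}" using that p by auto
      have "(\<Prod>j\<in>{i..<n}. exp (M i j * (complex_of_real (ln (R i)) + \<i> * x i)) *
          (1 - (if j = i then 0 else if j < q then rcis (R j) ((x(p := t)) j) else complex_of_real ((x(p := t)) j)) / ?z i) powr M i j)
        = (exp (M i p * (complex_of_real (ln (R i)) + \<i> * x i)) * (1 - (if p < q then rcis (R p) t else of_real t) / ?z i) powr M i p)
          * (\<Prod>j\<in>{i..<n} - {p}. exp (M i j * (complex_of_real (ln (R i)) + \<i> * x i)) *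
          (1 - (if j = i then 0 else if j < p then rcis (R j) (x j) else complex_of_real (x j)) / ?z i) powr M i j)"
      proof (subst prod.remove[OF _ pi], simp, rule arg_cong2[where f="(*)"], goal_cases)
        case 1 show ?case using that by auto
      next
        case 2
        have "j < q \<longleftrightarrow> j < p" if "j \<in> {i..<n} - {p}" for j
          using that \<open>q = p \<or> q = Suc p\<close> by auto
        thus ?case by (intro prod.cong refl) simp
      qed
      thus ?thesis using that unfolding circle_factor_def A_def by (simp add: mult_ac)
    qed
    have line: "line_factor n R M (x(p := t)) i = line_factor n R M x i" if "i > p" for t i
      proof -
      have "node (x(p := t)) i j = node x i j" if "j \<in> {i..<n}" for j
        using that \<open>i > p\<close> by (auto simp: node_def)
      thus ?thesis using that unfolding line_factor_def by simp
    qed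
    have L: "hybrid n R M (Suc p) (x(p := t)) = C * (indicator {0..2*pi} t *\<^sub>R (\<i> * rcis (R p) t * (g (rcis (R p) t) *
            (\<Prod>j\<in>{p..<n}. exp (M p j * (complex_of_real (ln (R p)) + \<i> * t)) * (1 - node x p j / rcis (R p) t) powr M p j))))" for t
    proof -
      have "circle_factor n R M (Suc p) (x(p := t)) p = indicator {0..2*pi} t *\<^sub>R (\<i> * rcis (R p) t *
            (\<Prod>j\<in>{p..<n}. exp (M p j * (complex_of_real (ln (R p)) + \<i> * t)) * (1 - node x p j / rcis (R p) t) powr M p j))"
        proof -
        have "(if j = p then 0 else if j < Suc p then rcis (R j) ((x(p := t)) j) else complex_of_real ((x(p := t)) j)) = node x p j"
          if "j \<in> {p..<n}" for j using that by (auto simp: node_def)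
        thus ?thesis unfolding circle_factor_def by simp
      qed
      moreover have "(\<Prod>i<p. circle_factor n R M (Suc p) (x(p := t)) i) = (\<Prod>i<p. A i) * g (rcis (R p) t)"
        unfolding g_def by (simp add: circ prod.distrib[symmetric])
      ultimately show ?thesis unfolding hybrid_def split C_def by (simp add: line mult_ac)
    qed
    have Rr: "hybrid n R M p (x(p := r)) = C * (indicator {0..R p} r *\<^sub>R (g (complex_of_real r) *
            ((\<Prod>j\<in>{p..<n}. (if r < node x p j then exp (\<i> * pi * M p j) else exp (2 * \<i> * pi * M p j)) * complex_of_real (\<bar>r - node x p j\<bar> powr M p j))
           - (\<Prod>j\<in>{p..<n}. (if r < node x p j then exp (\<i> * pi * M p j) else 1) * complex_of_real (\<bar>r - node x p j\<bar> powr M p j)))))" for r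
    proof -
      have node: "node (x(p := r)) p j = node x p j" for j by (simp add: node_def)
      have "(\<Prod>i<p. circle_factor n R M p (x(p := r)) i) = (\<Prod>i<p. A i) * g (of_real r)"
        unfolding g_def by (simp add: circ prod.distrib[symmetric])
      thus ?thesis unfolding hybrid_def split C_def by (simp add: line line_factor_def[of n R M _ p] node mult_ac)
    qed
    \<comment> \<open>The collapse needs its nodes in [0, R p). A frozen coordinate outside its
      segment makes its line factor, hence \<open>C\<close> and both integrals, vanish.\<close>
    show ?thesis
    proof (cases "\<forall>j\<in>{p<..<n}. x j \<in> {0..R j}")
      case False
      then obtain j where "j \<in> {p<..<n}" "x j \<notin> {0..R j}" by auto
      hence "line_factor n R M x j = 0" by (auto simp: line_factor_def)
      hence "(\<Prod>i\<in>{p<..<n}. line_factor n R M x i) = 0"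
        using \<open>j \<in> {p<..<n}\<close> by (intro prod_zero) blast+
      hence "C = 0" unfolding C_def by simp
      thus ?thesis unfolding L Rr by simp
    next
      case True
      \<comment> \<open>\<open>g\<close> is holomorphic inside the smallest outer circle, whose
        radius is \<open>R (p - 1)\<close>. For \<open>p = 0\<close> the product \<open>g\<close> is
        empty and any larger radius will do.\<close>
      define R' where "R' = (if p = 0 then R p + 1 else R (p - 1))"
      have R': "R p < R'" using R(1)[of "p - 1" p] p by (auto simp: R'_def)
      have "R' \<le> R i" if "i < p" for i
        using that R(1)[of i "p - 1"] p by (cases "i = p - 1") (auto simp: R'_def intro: less_imp_le)
      have gh: "g holomorphic_on ball 0 R'"
        unfolding g_def
      proof (intro holomorphic_intros)
        fix z :: complex and i assume z: "z \<in> ball 0 R'" and i: "i \<in> {..<p}"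
        have Ri: "R i > 0" using R(2)[of i] i p by auto
        hence "norm (z / ?z i) < 1" using z \<open>\<And>i. i < p \<Longrightarrow> R' \<le> R i\<close>[of i] i by (auto simp: norm_divide)
        hence "Re (z / ?z i) < 1" using complex_Re_le_cmod le_less_trans by blast
        thus "1 - z / ?z i \<notin> \<real>\<^sub>\<le>\<^sub>0" by (auto simp: complex_nonpos_Reals_iff)
        show "?z i \<noteq> 0" using Ri by auto
      qed
      have "(\<integral>t. indicator {0..2*pi} t *\<^sub>R (\<i> * rcis (R p) t * (g (rcis (R p) t) *
            (\<Prod>j\<in>{p..<n}. exp (M p j * (complex_of_real (ln (R p)) + \<i> * t)) * (1 - node x p j / rcis (R p) t) powr M p j))) \<partial>lborel)
       = (\<integral>r. indicator {0..R p} r *\<^sub>R (g (complex_of_real r) *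
            ((\<Prod>j\<in>{p..<n}. (if r < node x p j then exp (\<i> * pi * M p j) else exp (2 * \<i> * pi * M p j)) * complex_of_real (\<bar>r - node x p j\<bar> powr M p j))
           - (\<Prod>j\<in>{p..<n}. (if r < node x p j then exp (\<i> * pi * M p j) else 1) * complex_of_real (\<bar>r - node x p j\<bar> powr M p j)))) \<partial>lborel)"
      proof (rule circle_integral_collapse)
        fix j assume j: "j \<in> {p..<n}"
        show "0 \<le> node x p j \<and> node x p j < R p"
          using j True R(1)[of p j] R(2)[OF p]
          by (cases "j = p") (auto simp: node_def intro: le_less_trans)
        show "0 < M p j" using M j by auto
      qed (use R(2)[OF p] R' gh in auto)
      thus ?thesis by (simp only: L Rr integral_mult_right_zero)
    qed
  qed
  note inner = this
  have fold: "(\<integral>y. hybrid n R M q y \<partial>PiM {0..<n} (\<lambda>_. lborel))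
      = (\<integral>x. (\<integral>t. hybrid n R M q (x(p := t)) \<partial>lborel) \<partial>PiM ?I (\<lambda>_. lborel))" for q
    using lborel_product.product_integral_insert[OF _ _ int] unfolding I by simp
  show ?thesis unfolding fold inner ..
qed

lemma integral_hybrid_collapse:
  assumes R: "\<And>i j. i < j \<Longrightarrow> j < n \<Longrightarrow> R j < R i" "\<And>i. i < n \<Longrightarrow> 0 < R i \<and> R i \<le> 1"
    and M: "\<And>i j. i \<le> j \<Longrightarrow> j < n \<Longrightarrow> 0 < M i j"
  shows "(\<integral>y. hybrid n R M n y \<partial>PiM {0..<n} (\<lambda>_. lborel)) = (\<integral>y. hybrid n R M 0 y \<partial>PiM {0..<n} (\<lambda>_. lborel))"
proof -
  have "p \<le> n \<Longrightarrow> (\<integral>y. hybrid n R M p y \<partial>PiM {0..<n} (\<lambda>_. lborel)) = (\<integral>y. hybrid n R M 0 y \<partial>PiM {0..<n} (\<lambda>_. lborel))" for p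
  proof (induction p)
    case (Suc p)
    thus ?case using integral_hybrid_Suc[where n=n and R=R and M=M and p=p, OF R M] by simp
  qed simp
  from this[of n] show ?thesis by simp
qed

section \<open>The series as an integral over circles\<close>

text \<open>A finite set of functions lies in the product of its finite coordinate projections,
  where the sum of products factors into a product of finite sums.\<close>

lemma summable_on_prod_PiE_nonneg:
  fixes f :: "'a \<Rightarrow> 'b \<Rightarrow> real"
  assumes "finite A" "\<And>x. x \<in> A \<Longrightarrow> f x summable_on B x" "\<And>x y. x \<in> A \<Longrightarrow> y \<in> B x \<Longrightarrow> 0 \<le> f x y"
  shows "(\<lambda>g. \<Prod>x\<in>A. f x (g x)) summable_on PiE A B"
proof (rule nonneg_bdd_above_summable_on)
  show "0 \<le> (\<Prod>x\<in>A. f x (g x))" if "g \<in> PiE A B" for g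
    using that assms(3) by (intro prod_nonneg) (auto simp: PiE_mem)
  show "bdd_above (sum (\<lambda>g. \<Prod>x\<in>A. f x (g x)) ` {F. F \<subseteq> PiE A B \<and> finite F})"
  proof (rule bdd_aboveI2)
    fix S assume "S \<in> {F. F \<subseteq> PiE A B \<and> finite F}"
    hence S: "S \<subseteq> PiE A B" "finite S" by auto
    define T where "T x = (\<lambda>g. g x) ` S" for x
    have T: "finite (T x)" "x \<in> A \<Longrightarrow> T x \<subseteq> B x" for x
      using S by (auto simp: T_def PiE_mem)
    have "S \<subseteq> PiE A T" using S by (auto simp: T_def PiE_def)
    hence "(\<Sum>g\<in>S. \<Prod>x\<in>A. f x (g x)) \<le> (\<Sum>g\<in>PiE A T. \<Prod>x\<in>A. f x (g x))"
      using T assms by (intro sum_mono2 finite_PiE prod_nonneg) (auto simp: PiE_mem subset_iff)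
    also have "\<dots> = (\<Prod>x\<in>A. \<Sum>y\<in>T x. f x y)"
      using T assms by (intro prod_sum_PiE[symmetric]) auto
    also have "\<dots> \<le> (\<Prod>x\<in>A. infsum (f x) (B x))"
      using T assms by (intro prod_mono conjI sum_nonneg finite_sum_le_infsum) (auto simp: subset_iff)
    finally show "(\<Sum>g\<in>S. \<Prod>x\<in>A. f x (g x)) \<le> (\<Prod>x\<in>A. infsum (f x) (B x))" .
  qed
qed

text \<open>The error of a finite partial sum is pointwise at most the tail of \<open>c\<close>
  times \<open>w\<close>, and integrating this gives the tail times \<open>W\<close>. The tolerance
  is divided by \<open>W + 1\<close> because \<open>W\<close> may be 0.\<close>

lemma has_sum_integral_dominated:
  fixes f :: "'k \<Rightarrow> 'a \<Rightarrow> complex"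
  assumes f: "\<And>k. k \<in> K \<Longrightarrow> integrable M (f k)" and g: "integrable M g"
    and w: "integrable M w" "\<And>y. 0 \<le> w y" and c: "c summable_on K"
    and bnd: "\<And>k y. k \<in> K \<Longrightarrow> norm (f k y) \<le> c k * w y"
    and eq: "\<And>y. g y = infsum (\<lambda>k. f k y) K"
  shows "((\<lambda>k. \<integral>y. f k y \<partial>M) has_sum (\<integral>y. g y \<partial>M)) K"
  unfolding has_sum_def tendsto_iff
proof (intro allI impI)
  fix e :: real assume e: "e > 0"
  define W where "W = (\<integral>y. w y \<partial>M)"
  have W: "W \<ge> 0" unfolding W_def using w(2) by (intro Bochner_Integration.integral_nonneg)
  have "(c has_sum infsum c K) K" using c by simp
  moreover have "e / (W + 1) > 0" using e W by simp
  ultimately have ev: "\<forall>\<^sub>F S in finite_subsets_at_top K. dist (sum c S) (infsum c K) < e / (W + 1)"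
    unfolding has_sum_def tendsto_iff by blast
  have ev2: "\<forall>\<^sub>F S in finite_subsets_at_top K. finite S \<and> S \<subseteq> K"
    by (rule eventually_finite_subsets_at_top_weakI) auto
  from ev ev2 show "\<forall>\<^sub>F S in finite_subsets_at_top K. dist (\<Sum>k\<in>S. \<integral>y. f k y \<partial>M) (\<integral>y. g y \<partial>M) < e"
  proof eventually_elim
    case (elim S)
    hence S: "finite S" "S \<subseteq> K" by auto
    let ?t = "infsum c K - sum c S"
    have pt: "norm (g y - (\<Sum>k\<in>S. f k y)) \<le> ?t * w y" for y
    proof -
      have cw: "(\<lambda>k. c k * w y) summable_on K" using c by (rule summable_on_cmult_left)
      have abs: "(\<lambda>k. norm (f k y)) summable_on K"
        by (rule Infinite_Sum.abs_summable_on_comparison_test'[OF cw bnd])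
      hence sm: "(\<lambda>k. f k y) summable_on K" by (rule abs_summable_summable)
      have d: "((\<lambda>k. f k y) has_sum (g y - (\<Sum>k\<in>S. f k y))) (K - S)"
        unfolding eq using S sm by (intro has_sum_Diff has_sum_infsum has_sum_finite)
      have d2: "((\<lambda>k. c k * w y) has_sum (infsum c K * w y - (\<Sum>k\<in>S. c k * w y))) (K - S)"
        using S c by (intro has_sum_Diff has_sum_cmult_left has_sum_infsum has_sum_finite)
      have "norm (g y - (\<Sum>k\<in>S. f k y)) \<le> infsum c K * w y - (\<Sum>k\<in>S. c k * w y)"
        using norm_infsum_le[OF d d2] bnd by auto
      thus ?thesis by (simp add: left_diff_distrib sum_distrib_right)
    qed
    have intS: "integrable M (\<lambda>y. \<Sum>k\<in>S. f k y)" using S f by auto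
    have "dist (\<Sum>k\<in>S. \<integral>y. f k y \<partial>M) (\<integral>y. g y \<partial>M) = norm (\<integral>y. g y - (\<Sum>k\<in>S. f k y) \<partial>M)"
      using S f g intS by (simp add: dist_norm norm_minus_commute subset_iff)
    also have "\<dots> \<le> (\<integral>y. ?t * w y \<partial>M)"
      using pt w g intS by (intro order_trans[OF integral_norm_bound integral_mono]) auto
    also have "\<dots> = ?t * W" by (simp add: W_def)
    also have "\<dots> \<le> (e / (W + 1)) * W"
      using elim W by (intro mult_right_mono) (auto simp: dist_real_def)
    also have "\<dots> < e" using e W by (simp add: field_simps)
    finally show ?case .
  qed
qed

section \<open>Binomial series and sums over multi-indices\<close>

lemma gbinomial_of_real: "(complex_of_real a gchoose k) = complex_of_real (a gchoose k)"
  by (simp add: gbinomial_prod_rev)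

lemma summable_gbinomial_abs:
  fixes a r :: real
  assumes "0 \<le> r" "r < 1"
  shows "summable (\<lambda>k. \<bar>a gchoose k\<bar> * r ^ k)"
proof -
  \<comment> \<open>An auxiliary point strictly between \<open>r\<close> and 1: convergence of the
    power series there gives absolute convergence at \<open>r\<close>.\<close>
  have "\<bar>(1 + r) / 2\<bar> < 1" using assms by simp
  from sums_summable[OF gen_binomial_real[OF this]] have "summable (\<lambda>k. (a gchoose k) * ((1 + r) / 2) ^ k)" .
  from powser_insidea[OF this, of r] show ?thesis using assms by (simp add: abs_mult power_abs)
qed

lemma infsum_gbinomial:
  fixes a :: real and z :: complex
  assumes "norm z < 1"
  shows "infsum (\<lambda>k. complex_of_real ((-1) ^ k * (a gchoose k)) * z ^ k) UNIV = (1 - z) powr a"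
    and "(\<lambda>k. norm (complex_of_real ((-1) ^ k * (a gchoose k)) * z ^ k)) summable_on UNIV"
proof -
  let ?f = "\<lambda>k. complex_of_real ((-1) ^ k * (a gchoose k)) * z ^ k"
  have s: "?f sums (1 - z) powr a"
    using gen_binomial_complex[of "-z" "complex_of_real a"] assms
    by (simp add: gbinomial_of_real power_minus[of z] mult_ac)
  have n: "summable (\<lambda>k. norm (?f k))"
    using summable_gbinomial_abs[of "norm z" a] assms by (simp add: norm_mult norm_power abs_mult power_abs)
  show "infsum ?f UNIV = (1 - z) powr a"
    using norm_summable_imp_has_sum[OF n s] by (rule infsumI)
  show "(\<lambda>k. norm (?f k)) summable_on UNIV"
    using n by (intro norm_summable_imp_summable_on) simp
qed

text \<open>Links two encodings of a multi-index: the sums over product sets run over functions that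
  are \<open>undefined\<close> outside \<open>pairs n\<close>, while elements of
  \<open>Fidx n\<close> are 0 there.\<close>

definition Fidx_of :: "nat \<Rightarrow> (nat \<times> nat \<Rightarrow> nat) \<Rightarrow> nat \<Rightarrow> nat \<Rightarrow> nat" where
  "Fidx_of n g i j = (if (i, j) \<in> pairs n then g (i, j) else 0)"

lemma bij_betw_Fidx_of: "bij_betw (Fidx_of n) (PiE (pairs n) (\<lambda>_. UNIV)) (Fidx n)"
proof (rule bij_betw_byWitness[where f'="\<lambda>k. restrict (\<lambda>(i, j). k i j) (pairs n)"])
  show "\<forall>g\<in>PiE (pairs n) (\<lambda>_. UNIV). restrict (\<lambda>(i, j). Fidx_of n g i j) (pairs n) = g"
    by (auto simp: Fidx_of_def fun_eq_iff restrict_def PiE_def extensional_def)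
  show "\<forall>k\<in>Fidx n. Fidx_of n (restrict (\<lambda>(i, j). k i j) (pairs n)) = k"
    by (auto simp: Fidx_of_def fun_eq_iff Fidx_def pairs_def)
  show "(\<lambda>k. restrict (\<lambda>(i, j). k i j) (pairs n)) ` Fidx n \<subseteq> PiE (pairs n) (\<lambda>_. UNIV)"
    by (auto simp: PiE_def extensional_def)
qed (auto simp: Fidx_of_def Fidx_def pairs_def)

lemma prod_case_prod_mult:
  "(\<Prod>(i, j)\<in>A. f i j * g i j) = (\<Prod>(i, j)\<in>A. f i j) * (\<Prod>(i, j)\<in>A. g i j)"
  by (simp add: split_def prod.distrib)

lemma pairs_Sigma: "pairs n = (SIGMA i:{..<n}. {i<..<n})"
  by (auto simp: pairs_def)

lemma finite_pairs: "finite (pairs n)"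
  unfolding pairs_Sigma by auto

lemma prod_pairs: "(\<Prod>(i, j)\<in>pairs n. f i j) = (\<Prod>i<n. \<Prod>j\<in>{i<..<n}. f i j)"
  unfolding pairs_Sigma by (simp add: prod.Sigma)

lemma prod_pairs_swap: "(\<Prod>(i, j)\<in>pairs n. f i j) = (\<Prod>j<n. \<Prod>i<j. f i j)"
proof -
  have "(\<Prod>(i, j)\<in>pairs n. f i j) = (\<Prod>(j, i)\<in>(SIGMA j:{..<n}. {..<j}). f i j)"
    by (rule prod.reindex_bij_witness[of _ "\<lambda>(i, j). (j, i)" "\<lambda>(i, j). (j, i)"]) (auto simp: pairs_def)
  thus ?thesis by (simp add: prod.Sigma)
qed

lemma infsum_prod_Fidx:
  fixes f :: "nat \<Rightarrow> nat \<Rightarrow> nat \<Rightarrow> complex"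
  assumes "\<And>i j. (i, j) \<in> pairs n \<Longrightarrow> (\<lambda>k. norm (f i j k)) summable_on UNIV"
  shows "infsum (\<lambda>k. \<Prod>(i, j)\<in>pairs n. f i j (k i j)) (Fidx n) = (\<Prod>(i, j)\<in>pairs n. infsum (f i j) UNIV)"
proof -
  have "infsum (\<lambda>k. \<Prod>(i, j)\<in>pairs n. f i j (k i j)) (Fidx n)
      = infsum (\<lambda>g. \<Prod>(i, j)\<in>pairs n. f i j (Fidx_of n g i j)) (PiE (pairs n) (\<lambda>_. UNIV))"
    using infsum_reindex_bij_betw[OF bij_betw_Fidx_of, of "\<lambda>k. \<Prod>(i, j)\<in>pairs n. f i j (k i j)"] by simp
  also have "\<dots> = infsum (\<lambda>g. \<Prod>x\<in>pairs n. f (fst x) (snd x) (g x)) (PiE (pairs n) (\<lambda>_. UNIV))"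
    by (intro infsum_cong prod.cong) (auto simp: Fidx_of_def)
  also have "\<dots> = (\<Prod>x\<in>pairs n. infsum (f (fst x) (snd x)) UNIV)"
    using assms by (intro infsum_prod_PiE_abs finite_pairs) auto
  finally show ?thesis by (simp add: case_prod_beta)
qed

lemma summable_prod_Fidx:
  fixes f :: "nat \<Rightarrow> nat \<Rightarrow> nat \<Rightarrow> real"
  assumes "\<And>i j. (i, j) \<in> pairs n \<Longrightarrow> f i j summable_on UNIV" "\<And>i j k. 0 \<le> f i j k"
  shows "(\<lambda>k. \<Prod>(i, j)\<in>pairs n. f i j (k i j)) summable_on Fidx n"
proof -
  have "(\<lambda>g. \<Prod>x\<in>pairs n. f (fst x) (snd x) (g x)) summable_on PiE (pairs n) (\<lambda>_. UNIV)"
    using assms by (intro summable_on_prod_PiE_nonneg finite_pairs) auto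
  also have "?this \<longleftrightarrow> (\<lambda>g. \<Prod>(i, j)\<in>pairs n. f i j (Fidx_of n g i j)) summable_on PiE (pairs n) (\<lambda>_. UNIV)"
    by (intro summable_on_cong prod.cong) (auto simp: Fidx_of_def)
  also have "\<dots> \<longleftrightarrow> (\<lambda>k. \<Prod>(i, j)\<in>pairs n. f i j (k i j)) summable_on Fidx n"
    by (rule summable_on_reindex_bij_betw[OF bij_betw_Fidx_of])
  finally show ?thesis .
qed

text \<open>With \<open>z = exp (\<i> * t)\<close> and \<open>dz = \<i> * z * dt\<close> this is the
  integral of \<open>z^a\<close> along the lifted unit circle. For integral \<open>a\<close>
  different from -1 the primitive is periodic, and for \<open>a = -1\<close> it is linear.\<close>

lemma integral_circle_rres:
  fixes a :: real
  shows "(\<integral>t. indicator {0..2*pi} t *\<^sub>R (\<i> * exp (\<i> * complex_of_real (t * (a + 1)))) \<partial>lborel) = 2 * pi * \<i> * rres a" (is ?eq)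
    and "integrable lborel (\<lambda>t. indicator {0..2*pi} t *\<^sub>R (\<i> * exp (\<i> * complex_of_real (t * (a + 1)))))" (is ?int)
proof -
  define F where "F t = (if a = -1 then \<i> * complex_of_real t else exp (\<i> * complex_of_real (t * (a + 1))) / (a + 1))" for t
  have H: "has_bochner_integral lborel (\<lambda>t. indicator {0..2*pi} t *\<^sub>R (\<i> * exp (\<i> * complex_of_real (t * (a + 1))))) (F (2 * pi) - F 0)"
  proof (rule has_bochner_integral_FTC_Icc)
    fix t :: real
    have "((\<lambda>z. if a = -1 then \<i> * z else exp (\<i> * (z * (a + 1))) / (a + 1)) has_field_derivative (\<i> * exp (\<i> * complex_of_real (t * (a + 1))))) (at (of_real t))"
    proof (cases "a = -1")
      case True thus ?thesis by (auto intro!: derivative_eq_intros)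
    next
      case False
      hence "complex_of_real a + 1 \<noteq> 0" by (metis add_eq_0_iff2 of_real_1 of_real_add of_real_eq_0_iff)
      thus ?thesis using False by (auto intro!: derivative_eq_intros simp: mult_ac)
    qed
    from has_vector_derivative_real_field[OF this]
    show "(F has_vector_derivative \<i> * exp (\<i> * complex_of_real (t * (a + 1)))) (at t within {0..2 * pi})"
      unfolding F_def by (cases "a = -1") simp_all
  qed (auto intro!: continuous_intros)
  have "F (2 * pi) - F 0 = 2 * pi * \<i> * rres a"
  proof (cases "a = -1")
    case True thus ?thesis by (simp add: F_def rres_def)
  next
    case False
    have e: "exp (\<i> * complex_of_real (2 * pi * (a + 1))) = exp (2 * pi * \<i> * complex_of_real (a + 1))"
      by (simp add: mult_ac)
    show ?thesis
    proof (cases "a \<in> \<int>")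
      case True
      then obtain b :: int where b: "a = of_int b" by (auto elim: Ints_cases)
      have "exp (2 * pi * \<i> * complex_of_real (a + 1)) = 1"
        using exp_integer_2pi[of "a + 1"] b by (simp add: mult_ac)
      thus ?thesis using False True by (simp only: F_def e) (simp add: rres_def)
    next
      case no: False
      show ?thesis proof -
        have alg: "E / x - 1 / x = c * ((E - 1) / (c * x))" if "c \<noteq> 0" for E x c :: complex
          using that by (simp flip: diff_divide_distrib)
        show ?thesis using False no alg[of "2 * pi * \<i>"] by (simp only: F_def e) (simp add: rres_def)
      qed
    qed
  qed
  thus ?eq ?int using H by (auto simp: has_bochner_integral_iff)
qed


text \<open>The strict decrease of the radii makes the product of the binomial series converge
  absolutely and uniformly in the angles, whatever the exponents are; so summation and integration
  may be exchanged.\<close>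

lemma integral_circles_series:
  assumes R: "\<And>i j. i < j \<Longrightarrow> j < n \<Longrightarrow> R j < R i" "\<And>i. i < n \<Longrightarrow> 0 < R i \<and> R i \<le> 1"
  shows "(\<integral>y. hybrid n R (expo m mm) n y \<partial>PiM {0..<n} (\<lambda>_. lborel)) =
     (2 * pi * \<i>) ^ n * (\<Prod>i<n. complex_of_real (R i powr (m i + 1 + (\<Sum>j\<in>{i<..<n}. mm i j)))) *
     infsum (\<lambda>k. Fterm n m mm k * complex_of_real (\<Prod>(i, j)\<in>pairs n. (R j / R i) ^ k i j)) (Fidx n)"
proof -
  \<comment> \<open>\<open>b i\<close> is the total power of \<open>z_i\<close> before expansion,
    with 1 coming from \<open>dz\<close>; \<open>a k i\<close> is the power in the term with index
    \<open>k\<close>, without that 1, as \<open>rres\<close> expects it.\<close>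
  define b where "b i = m i + 1 + (\<Sum>j\<in>{i<..<n}. mm i j)" for i
  define a where "a k i = m i + (\<Sum>j\<in>{i<..<n}. (mm i j - real (k i j))) + (\<Sum>j<i. real (k j i))" for i and k :: "nat \<Rightarrow> nat \<Rightarrow> nat"
  define P where "P = (\<Prod>i<n. complex_of_real (R i powr b i))"
  define cf where "cf k = (\<Prod>(i, j)\<in>pairs n. complex_of_real ((-1) ^ k i j * (mm i j gchoose k i j)))
      * complex_of_real (\<Prod>(i, j)\<in>pairs n. (R j / R i) ^ k i j)" for k
  define f where "f k y = P * cf k * (\<Prod>i\<in>{0..<n}. indicator {0..2*pi} (y i) *\<^sub>R (\<i> * exp (\<i> * complex_of_real (y i * (a k i + 1)))))" for k and y :: "nat \<Rightarrow> real"
  define w where "w y = norm P * (\<Prod>i\<in>{0..<n}. indicator {0..2*pi} (y i))" for y :: "nat \<Rightarrow> real"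
  have rho: "0 < R j / R i" "R j / R i < 1" if "(i, j) \<in> pairs n" for i j
    using that R(1)[of i j] R(2)[of i] R(2)[of j] by (auto simp: pairs_def)
  have nq: "norm (rcis (R j / R i) t) < 1" if "(i, j) \<in> pairs n" for i j t
    using rho[OF that] by simp
  have int: "integrable (PiM {0..<n} (\<lambda>_. lborel)) (hybrid n R (expo m mm) n)"
    using R by (intro integrable_hybrid) auto
  have cs: "(\<lambda>k. norm (cf k)) summable_on Fidx n"
  proof -
    have "(\<lambda>k. \<Prod>(i, j)\<in>pairs n. \<bar>mm i j gchoose k i j\<bar> * \<bar>R j / R i\<bar> ^ k i j) summable_on Fidx n"
    proof (rule summable_prod_Fidx)
      fix i j assume "(i, j) \<in> pairs n"
      hence "summable (\<lambda>k. \<bar>mm i j gchoose k\<bar> * \<bar>R j / R i\<bar> ^ k)"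
        using rho[of i j] by (intro summable_gbinomial_abs) auto
      thus "(\<lambda>k. \<bar>mm i j gchoose k\<bar> * \<bar>R j / R i\<bar> ^ k) summable_on UNIV"
        by (intro norm_summable_imp_summable_on) (simp add: abs_mult power_abs)
    qed auto
    also have "(\<lambda>k. \<Prod>(i, j)\<in>pairs n. \<bar>mm i j gchoose k i j\<bar> * \<bar>R j / R i\<bar> ^ k i j) = (\<lambda>k. norm (cf k))"
    proof
      fix k
      have "norm (cf k) = (\<Prod>(i, j)\<in>pairs n. \<bar>mm i j gchoose k i j\<bar>) * (\<Prod>(i, j)\<in>pairs n. \<bar>R j / R i\<bar> ^ k i j)"
        unfolding cf_def norm_mult norm_of_real abs_prod prod_norm[symmetric]
        by (intro arg_cong2[where f="(*)"] prod.cong refl) (auto simp: norm_mult norm_power power_abs)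
      thus "(\<Prod>(i, j)\<in>pairs n. \<bar>mm i j gchoose k i j\<bar> * \<bar>R j / R i\<bar> ^ k i j) = norm (cf k)"
        by (simp add: case_prod_beta prod.distrib)
    qed
    finally show ?thesis .
  qed
  \<comment> \<open>The monomial \<open>(z_j / z_i) ^ k i j\<close> moves \<open>k i j\<close> units
    of exponent from \<open>z_i\<close> to \<open>z_j\<close>; collecting per variable gives a row
    sum with minus sign and a column sum with plus sign.\<close>
  have phase: "(\<Prod>i<n. exp (\<i> * complex_of_real (y i * b i))) * (\<Prod>(i, j)\<in>pairs n. rcis (R j / R i) (y j - y i) ^ k i j)
     = (\<Prod>i<n. exp (\<i> * complex_of_real (y i * (a k i + 1)))) * complex_of_real (\<Prod>(i, j)\<in>pairs n. (R j / R i) ^ k i j)" for k y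
  proof -
    have "rcis (R j / R i) (y j - y i) ^ k i j = complex_of_real ((R j / R i) ^ k i j) *
        (exp (\<i> * complex_of_real (y j * real (k i j))) * exp (- (\<i> * complex_of_real (y i * real (k i j)))))" for i j
      by (simp add: rcis_def cis_conv_exp power_mult_distrib power_divide flip: exp_add exp_of_nat_mult) (simp add: algebra_simps)
    hence "(\<Prod>(i, j)\<in>pairs n. rcis (R j / R i) (y j - y i) ^ k i j)
      = (\<Prod>(i, j)\<in>pairs n. complex_of_real ((R j / R i) ^ k i j)) *
        ((\<Prod>(i, j)\<in>pairs n. exp (\<i> * complex_of_real (y j * real (k i j)))) * (\<Prod>(i, j)\<in>pairs n. exp (- (\<i> * complex_of_real (y i * real (k i j))))))"
      by (simp only: prod_case_prod_mult)
    also have "(\<Prod>(i, j)\<in>pairs n. exp (\<i> * complex_of_real (y j * real (k i j)))) = (\<Prod>j<n. exp (\<i> * complex_of_real (y j * (\<Sum>i<j. real (k i j)))))"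
      unfolding prod_pairs_swap by (simp add: exp_sum[symmetric] sum_distrib_left)
    also have "(\<Prod>(i, j)\<in>pairs n. exp (- (\<i> * complex_of_real (y i * real (k i j))))) = (\<Prod>i<n. exp (- (\<i> * complex_of_real (y i * (\<Sum>j\<in>{i<..<n}. real (k i j))))))"
      unfolding prod_pairs by (simp add: exp_sum[symmetric] sum_distrib_left sum_negf)
    also have "(\<Prod>(i, j)\<in>pairs n. complex_of_real ((R j / R i) ^ k i j)) = complex_of_real (\<Prod>(i, j)\<in>pairs n. (R j / R i) ^ k i j)"
      by (simp add: case_prod_beta)
    finally have T: "(\<Prod>i<n. exp (\<i> * complex_of_real (y i * b i))) * (\<Prod>(i, j)\<in>pairs n. rcis (R j / R i) (y j - y i) ^ k i j)
      = (\<Prod>i<n. exp (\<i> * complex_of_real (y i * b i)) * (exp (\<i> * complex_of_real (y i * (\<Sum>j<i. real (k j i)))) *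
          exp (- (\<i> * complex_of_real (y i * (\<Sum>j\<in>{i<..<n}. real (k i j))))))) * complex_of_real (\<Prod>(i, j)\<in>pairs n. (R j / R i) ^ k i j)"
      by (simp only: prod.distrib mult_ac)
    have ei: "exp (\<i> * complex_of_real (y i * b i)) * (exp (\<i> * complex_of_real (y i * (\<Sum>j<i. real (k j i)))) *
          exp (- (\<i> * complex_of_real (y i * (\<Sum>j\<in>{i<..<n}. real (k i j)))))) = exp (\<i> * complex_of_real (y i * (a k i + 1)))" for i
      unfolding exp_add[symmetric] by (rule arg_cong[where f=exp]) (simp add: a_def b_def sum_subtractf algebra_simps)
    show ?thesis using T unfolding ei .
  qed
  have eq: "hybrid n R (expo m mm) n y = infsum (\<lambda>k. f k y) (Fidx n)" for y
  proof -
    have cfac: "circle_factor n R (expo m mm) n y i = complex_of_real (R i powr b i) * (complex_of_real (indicator {0..2*pi} (y i)) * \<i>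
        * exp (\<i> * complex_of_real (y i * b i))) * (\<Prod>j\<in>{i<..<n}. (1 - rcis (R j / R i) (y j - y i)) powr mm i j)" if i: "i < n" for i
    proof -
      have Ri: "R i > 0" using R(2)[OF i] by simp
      have I: "{i..<n} = insert i {i<..<n}" using i by auto
      have r: "rcis (R i) (y i) = exp (complex_of_real (ln (R i)) + \<i> * y i)"
        using Ri by (simp add: exp_add rcis_def cis_conv_exp exp_of_real)
      have "(\<Prod>j\<in>{i..<n}. exp (expo m mm i j * (complex_of_real (ln (R i)) + \<i> * y i)) *
          (1 - (if j = i then 0 else if j < n then rcis (R j) (y j) else complex_of_real (y j)) / rcis (R i) (y i)) powr expo m mm i j)
        = exp (m i * (complex_of_real (ln (R i)) + \<i> * y i)) *
          (\<Prod>j\<in>{i<..<n}. exp (mm i j * (complex_of_real (ln (R i)) + \<i> * y i)) * (1 - rcis (R j / R i) (y j - y i)) powr mm i j)"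
        unfolding I by (simp add: expo_def rcis_divide)
      also have "\<dots> = exp ((m i + (\<Sum>j\<in>{i<..<n}. mm i j)) * (complex_of_real (ln (R i)) + \<i> * y i)) *
          (\<Prod>j\<in>{i<..<n}. (1 - rcis (R j / R i) (y j - y i)) powr mm i j)"
        by (simp add: prod.distrib exp_sum[symmetric] sum_distrib_right distrib_right exp_add)
      finally have "circle_factor n R (expo m mm) n y i = complex_of_real (indicator {0..2*pi} (y i)) * (\<i> * (rcis (R i) (y i) *
         exp ((m i + (\<Sum>j\<in>{i<..<n}. mm i j)) * (complex_of_real (ln (R i)) + \<i> * y i))) *
          (\<Prod>j\<in>{i<..<n}. (1 - rcis (R j / R i) (y j - y i)) powr mm i j))"
        unfolding circle_factor_def by (simp add: scaleR_conv_of_real mult_ac)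
      also have "rcis (R i) (y i) * exp ((m i + (\<Sum>j\<in>{i<..<n}. mm i j)) * (complex_of_real (ln (R i)) + \<i> * y i))
         = complex_of_real (R i powr b i) * exp (\<i> * complex_of_real (y i * b i))"
      proof -
        have "complex_of_real (R i powr b i) = exp (complex_of_real (b i) * complex_of_real (ln (R i)))"
          using Ri by (simp add: powr_def exp_of_real flip: of_real_mult)
        thus ?thesis unfolding r by (simp add: b_def algebra_simps flip: exp_add)
      qed
      finally show ?thesis by (simp only: mult_ac)
    qed
    have "hybrid n R (expo m mm) n y = (\<Prod>i<n. circle_factor n R (expo m mm) n y i)"
      unfolding hybrid_def by (intro prod.cong) auto
    also have "\<dots> = (\<Prod>i<n. complex_of_real (R i powr b i) * (complex_of_real (indicator {0..2*pi} (y i)) * \<i>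
        * exp (\<i> * complex_of_real (y i * b i))) * (\<Prod>j\<in>{i<..<n}. (1 - rcis (R j / R i) (y j - y i)) powr mm i j))"
      by (intro prod.cong cfac) auto
    also have "\<dots> = P * ((\<Prod>i<n. complex_of_real (indicator {0..2*pi} (y i)) * \<i>) * (\<Prod>i<n. exp (\<i> * complex_of_real (y i * b i)))) *
        (\<Prod>(i, j)\<in>pairs n. (1 - rcis (R j / R i) (y j - y i)) powr mm i j)"
      unfolding P_def prod_pairs by (simp only: prod.distrib)
    also have "(\<Prod>(i, j)\<in>pairs n. (1 - rcis (R j / R i) (y j - y i)) powr complex_of_real (mm i j)) =
      (\<Prod>(i, j)\<in>pairs n. infsum (\<lambda>k. complex_of_real ((-1) ^ k * (mm i j gchoose k)) * rcis (R j / R i) (y j - y i) ^ k) UNIV)"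
      by (intro prod.cong refl) (clarify, simp only: prod.case infsum_gbinomial(1)[OF nq])
    also have "\<dots> = infsum (\<lambda>k. \<Prod>(i, j)\<in>pairs n. complex_of_real ((-1) ^ k i j * (mm i j gchoose k i j)) * rcis (R j / R i) (y j - y i) ^ k i j) (Fidx n)"
      by (intro infsum_prod_Fidx[symmetric] infsum_gbinomial(2) nq)
    also have "P * ((\<Prod>i<n. complex_of_real (indicator {0..2*pi} (y i)) * \<i>) * (\<Prod>i<n. exp (\<i> * complex_of_real (y i * b i)))) * \<dots>
       = infsum (\<lambda>k. P * ((\<Prod>i<n. complex_of_real (indicator {0..2*pi} (y i)) * \<i>) * (\<Prod>i<n. exp (\<i> * complex_of_real (y i * b i)))) *
          (\<Prod>(i, j)\<in>pairs n. complex_of_real ((-1) ^ k i j * (mm i j gchoose k i j)) * rcis (R j / R i) (y j - y i) ^ k i j)) (Fidx n)"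
      by (rule infsum_cmult_right'[symmetric])
    also have "\<dots> = infsum (\<lambda>k. f k y) (Fidx n)"
    proof (rule infsum_cong)
      fix k
      let ?I = "\<Prod>i<n. complex_of_real (indicator {0..2*pi} (y i)) * \<i>"
      let ?C = "\<Prod>(i, j)\<in>pairs n. complex_of_real ((-1) ^ k i j * (mm i j gchoose k i j))"
      have "(\<Prod>(i, j)\<in>pairs n. complex_of_real ((-1) ^ k i j * (mm i j gchoose k i j)) * rcis (R j / R i) (y j - y i) ^ k i j)
          = ?C * (\<Prod>(i, j)\<in>pairs n. rcis (R j / R i) (y j - y i) ^ k i j)"
        by (simp only: prod_case_prod_mult)
      hence "P * (?I * (\<Prod>i<n. exp (\<i> * complex_of_real (y i * b i)))) *
          (\<Prod>(i, j)\<in>pairs n. complex_of_real ((-1) ^ k i j * (mm i j gchoose k i j)) * rcis (R j / R i) (y j - y i) ^ k i j)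
         = P * ?I * ?C * ((\<Prod>i<n. exp (\<i> * complex_of_real (y i * b i))) * (\<Prod>(i, j)\<in>pairs n. rcis (R j / R i) (y j - y i) ^ k i j))"
        by (simp only: mult_ac)
      also have "\<dots> = P * cf k * (?I * (\<Prod>i<n. exp (\<i> * complex_of_real (y i * (a k i + 1)))))"
        unfolding phase cf_def by (simp only: mult_ac)
      also have "\<dots> = f k y"
        unfolding f_def prod.distrib[symmetric] lessThan_atLeast0 by (simp add: scaleR_conv_of_real mult.assoc)
      finally show "P * (?I * (\<Prod>i<n. exp (\<i> * complex_of_real (y i * b i)))) *
          (\<Prod>(i, j)\<in>pairs n. complex_of_real ((-1) ^ k i j * (mm i j gchoose k i j)) * rcis (R j / R i) (y j - y i) ^ k i j) = f k y" .
    qed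
    finally show ?thesis .
  qed
  have intf: "integrable (PiM {0..<n} (\<lambda>_. lborel)) (f k)" for k
    unfolding f_def
    by (intro integrable_mult_right lborel_product.product_integrable_prod integral_circle_rres(2)) auto
  have If: "(\<integral>y. f k y \<partial>PiM {0..<n} (\<lambda>_. lborel)) = (2 * pi * \<i>) ^ n * P * (Fterm n m mm k * complex_of_real (\<Prod>(i, j)\<in>pairs n. (R j / R i) ^ k i j))" for k
  proof -
    have "(\<integral>y. f k y \<partial>PiM {0..<n} (\<lambda>_. lborel)) = P * cf k * (\<Prod>i\<in>{0..<n}. 2 * pi * \<i> * rres (a k i))"
      unfolding f_def integral_mult_right_zero
      by (subst lborel_product.product_integral_prod) (simp_all only: finite_atLeastLessThan integral_circle_rres)
    also have "(\<Prod>i\<in>{0..<n}. 2 * pi * \<i> * rres (a k i)) = (2 * pi * \<i>) ^ n * (\<Prod>i<n. rres (a k i))"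
      by (simp add: prod.distrib lessThan_atLeast0)
    finally show ?thesis unfolding cf_def Fterm_def a_def by (simp only: mult_ac)
  qed
  have "((\<lambda>k. \<integral>y. f k y \<partial>PiM {0..<n} (\<lambda>_. lborel)) has_sum (\<integral>y. hybrid n R (expo m mm) n y \<partial>PiM {0..<n} (\<lambda>_. lborel))) (Fidx n)"
  proof (rule has_sum_integral_dominated[OF intf int _ _ cs _ eq])
    have "integrable (PiM {0..<n} (\<lambda>_. lborel)) (\<lambda>y. \<Prod>i\<in>{0..<n}. indicator {0..2*pi} (y i) :: real)"
      by (intro lborel_product.product_integrable_prod) (auto intro!: integrable_real_indicator)
    thus "integrable (PiM {0..<n} (\<lambda>_. lborel)) w" unfolding w_def by simp
    show "0 \<le> w y" for y unfolding w_def by (intro mult_nonneg_nonneg prod_nonneg) auto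
    show "norm (f k y) \<le> norm (cf k) * w y" for k y
      unfolding f_def w_def norm_mult prod_norm[symmetric] by (simp add: norm_mult mult_ac)
  qed
  from infsumI[OF this] show ?thesis
    unfolding If infsum_cmult_right' P_def b_def by simp
qed

section \<open>Passing to the unit cube\<close>

text \<open>Unordered summability of complex numbers is absolute, so \<open>norm (f k)\<close> is a
  majorant and dominated convergence applies to the counting measure.\<close>

lemma infsum_tendsto_dominated:
  fixes f :: "'k \<Rightarrow> complex" and c :: "nat \<Rightarrow> 'k \<Rightarrow> complex"
  assumes f: "f summable_on K" and c: "\<And>l k. norm (c l k) \<le> 1" "\<And>k. k \<in> K \<Longrightarrow> (\<lambda>l. c l k) \<longlonglongrightarrow> 1"
  shows "(\<lambda>l. infsum (\<lambda>k. f k * c l k) K) \<longlonglongrightarrow> infsum f K"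
proof -
  have fa: "(\<lambda>k. norm (f k)) summable_on K"
    using f summable_on_iff_abs_summable_on_complex by blast
  have fca: "(\<lambda>k. norm (f k * c l k)) summable_on K" for l
    using c(1) by (intro Infinite_Sum.abs_summable_on_comparison_test'[OF fa]) (simp add: norm_mult mult_left_le)
  have eq: "infsum g K = (\<integral>k. g k \<partial>count_space K)" and int: "integrable (count_space K) g"
    if "(\<lambda>k. norm (g k)) summable_on K" for g :: "'k \<Rightarrow> complex"
  proof -
    have "Infinite_Set_Sum.abs_summable_on g K" using that abs_summable_equivalent by blast
    thus "integrable (count_space K) g" "infsum g K = (\<integral>k. g k \<partial>count_space K)"
      using infsetsum_infsum[of g K] by (simp_all add: Infinite_Set_Sum.abs_summable_on_def infsetsum_def)
  qed
  show ?thesis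
    unfolding eq[OF fa] eq[OF fca]
  proof (rule integral_dominated_convergence[where w="\<lambda>k. norm (f k)"])
    show "integrable (count_space K) (\<lambda>k. norm (f k))" using int[OF fa] by simp
    show "AE k in count_space K. (\<lambda>l. f k * c l k) \<longlonglongrightarrow> f k"
    proof (rule AE_I2)
      fix k assume "k \<in> space (count_space K)"
      hence "(\<lambda>l. f k * c l k) \<longlonglongrightarrow> f k * 1" by (intro tendsto_intros c(2)) auto
      thus "(\<lambda>l. f k * c l k) \<longlonglongrightarrow> f k" by simp
    qed
    show "AE k in count_space K. norm (f k * c l k) \<le> norm (f k)" for l
      using c(1) by (intro AE_I2) (simp add: norm_mult mult_left_le)
  qed auto
qed

section \<open>Weights and phases on the cube\<close>

definition cube_weight :: "nat \<Rightarrow> (nat \<Rightarrow> nat \<Rightarrow> real) \<Rightarrow> (nat \<Rightarrow> real) \<Rightarrow> real" where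
  "cube_weight n M y = (\<Prod>i<n. \<Prod>j\<in>{i..<n}. \<bar>y i - node y i j\<bar> powr M i j)"

text \<open>The argument of the integrand in units of pi. To the left of a node a factor has
  argument pi on either side of the slit; to the right it has 2 pi below and 0 above, and
  \<open>E\<close> is the set of variables that run below.\<close>

definition phase :: "nat \<Rightarrow> (nat \<Rightarrow> nat \<Rightarrow> real) \<Rightarrow> nat set \<Rightarrow> (nat \<Rightarrow> real) \<Rightarrow> real" where
  "phase n M E y = (\<Sum>i<n. \<Sum>j\<in>{i..<n}. M i j * (if y i < node y i j then 1 else if i \<in> E then 2 else 0))"

lemma measurable_node:
  assumes "i < n" "j < n"
  shows "(\<lambda>y. node y i j) \<in> borel_measurable (PiM {0..<n} (\<lambda>_. lborel :: real measure))"
  unfolding node_def using measurable_coord[OF assms(2)] by (cases "j = i") auto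

lemma measurable_cube_weight: "cube_weight n M \<in> borel_measurable (PiM {0..<n} (\<lambda>_. lborel))"
proof -
  have "(\<lambda>y. \<bar>y i - node y i j\<bar> powr M i j) \<in> borel_measurable (PiM {0..<n} (\<lambda>_. lborel))"
    if "i < n" "j < n" for i j
  proof -
    note [measurable] = measurable_coord[OF that(1)] measurable_node[OF that]
    show ?thesis by measurable
  qed
  thus ?thesis unfolding cube_weight_def[abs_def] by (intro borel_measurable_prod) auto
qed

lemma measurable_phase: "phase n M E \<in> borel_measurable (PiM {0..<n} (\<lambda>_. lborel))"
proof -
  have "(\<lambda>y. M i j * (if y i < node y i j then 1 else if i \<in> E then 2 else 0)) \<in> borel_measurable (PiM {0..<n} (\<lambda>_. lborel))"
    if "i < n" "j < n" for i j
  proof -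
    note [measurable] = measurable_coord[OF that(1)] measurable_node[OF that]
    show ?thesis by measurable
  qed
  thus ?thesis unfolding phase_def[abs_def] by (intro borel_measurable_sum) auto
qed

text \<open>Expansion of a product of differences lower minus upper: \<open>E\<close> selects the
  lower terms, and every variable outside \<open>E\<close> contributes a sign.\<close>

lemma hybrid_0_expand:
  "hybrid n R M 0 y = (\<Sum>E\<in>Pow {..<n}. (-1) ^ card ({..<n} - E) *
     (complex_of_real ((\<Prod>i<n. indicator {0..R i} (y i)) * cube_weight n M y) * exp (\<i> * pi * phase n M E y)))"
proof -
  let ?lo = "\<lambda>i. \<Prod>j\<in>{i..<n}. (if y i < node y i j then exp (\<i> * pi * M i j) else exp (2 * \<i> * pi * M i j)) * complex_of_real (\<bar>y i - node y i j\<bar> powr M i j)"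
  let ?up = "\<lambda>i. \<Prod>j\<in>{i..<n}. (if y i < node y i j then exp (\<i> * pi * M i j) else 1) * complex_of_real (\<bar>y i - node y i j\<bar> powr M i j)"
  let ?ind = "\<lambda>i. complex_of_real (indicator {0..R i} (y i))"
  have "hybrid n R M 0 y = (\<Prod>i<n. ?ind i) * (\<Prod>i<n. ?lo i + (- ?up i))"
    unfolding hybrid_def line_factor_def by (simp add: scaleR_conv_of_real prod.distrib)
  also have "(\<Prod>i<n. ?lo i + (- ?up i)) = (\<Sum>E\<in>Pow {..<n}. (\<Prod>i\<in>E. ?lo i) * (\<Prod>i\<in>{..<n} - E. - ?up i))"
    by (rule prod_add) simp
  also have "\<dots> = (\<Sum>E\<in>Pow {..<n}. (-1) ^ card ({..<n} - E) * (complex_of_real (cube_weight n M y) * exp (\<i> * pi * phase n M E y)))"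
  proof (rule sum.cong[OF refl])
    fix E assume E: "E \<in> Pow {..<n}"
    have ph: "exp (\<i> * pi * phase n M E y) = (\<Prod>i<n. \<Prod>j\<in>{i..<n}. exp (\<i> * pi * (M i j * (if y i < node y i j then 1 else if i \<in> E then 2 else 0))))"
      unfolding phase_def by (simp add: exp_sum[symmetric] sum_distrib_left)
    have "(\<Prod>i\<in>E. ?lo i) * (\<Prod>i\<in>{..<n} - E. - ?up i) = (-1) ^ card ({..<n} - E) * ((\<Prod>i\<in>E. ?lo i) * (\<Prod>i\<in>{..<n} - E. ?up i))"
    proof -
      have "(\<Prod>i\<in>{..<n} - E. - ?up i) = (\<Prod>i\<in>{..<n} - E. (-1) * ?up i)" by simp
      also have "\<dots> = (-1) ^ card ({..<n} - E) * (\<Prod>i\<in>{..<n} - E. ?up i)" unfolding prod.distrib by simp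
      finally show ?thesis by (simp only: mult_ac)
    qed
    also have "(\<Prod>i\<in>E. ?lo i) * (\<Prod>i\<in>{..<n} - E. ?up i) = (\<Prod>i<n. if i \<in> E then ?lo i else ?up i)"
    proof -
      have "{..<n} \<inter> {i. i \<in> E} = E" "{..<n} \<inter> - {i. i \<in> E} = {..<n} - E" using E by auto
      thus ?thesis by (simp add: prod.If_cases)
    qed
    also have "\<dots> = (\<Prod>i<n. \<Prod>j\<in>{i..<n}. complex_of_real (\<bar>y i - node y i j\<bar> powr M i j) * exp (\<i> * pi * (M i j * (if y i < node y i j then 1 else if i \<in> E then 2 else 0))))"
    proof (rule prod.cong[OF refl])
      fix i
      show "(if i \<in> E then ?lo i else ?up i) = (\<Prod>j\<in>{i..<n}. complex_of_real (\<bar>y i - node y i j\<bar> powr M i j) * exp (\<i> * pi * (M i j * (if y i < node y i j then 1 else if i \<in> E then 2 else 0))))"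
        by (cases "i \<in> E") (auto intro!: prod.cong simp: mult_ac)
    qed
    also have "\<dots> = complex_of_real (cube_weight n M y) * exp (\<i> * pi * phase n M E y)"
      unfolding ph cube_weight_def by (simp add: prod.distrib)
    finally show "(\<Prod>i\<in>E. ?lo i) * (\<Prod>i\<in>{..<n} - E. - ?up i) = (-1) ^ card ({..<n} - E) * (complex_of_real (cube_weight n M y) * exp (\<i> * pi * phase n M E y))" .
  qed
  finally show ?thesis by (simp add: sum_distrib_left mult_ac)
qed

lemma cube_weight_shift:
  assumes "cube_weight n M y \<noteq> 0"
  shows "complex_of_real (cube_weight n (\<lambda>i j. M i j + s) y)
     = complex_of_real (cube_weight n M y) * exp (complex_of_real s * complex_of_real (\<Sum>i<n. \<Sum>j\<in>{i..<n}. ln \<bar>y i - node y i j\<bar>))"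
proof -
  have nz: "\<bar>y i - node y i j\<bar> \<noteq> 0" if "i < n" "j \<in> {i..<n}" for i j
    using assms that by (auto simp: cube_weight_def)
  have "cube_weight n (\<lambda>i j. M i j + s) y = (\<Prod>i<n. \<Prod>j\<in>{i..<n}. \<bar>y i - node y i j\<bar> powr M i j * exp (s * ln \<bar>y i - node y i j\<bar>))"
    unfolding cube_weight_def
  proof (intro prod.cong refl)
    fix i j assume "i \<in> {..<n}" "j \<in> {i..<n}"
    thus "\<bar>y i - node y i j\<bar> powr (M i j + s) = \<bar>y i - node y i j\<bar> powr M i j * exp (s * ln \<bar>y i - node y i j\<bar>)"
      unfolding powr_add using nz[of i j] by (simp add: powr_def[of _ s])
  qed
  also have "\<dots> = cube_weight n M y * exp (s * (\<Sum>i<n. \<Sum>j\<in>{i..<n}. ln \<bar>y i - node y i j\<bar>))"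
    unfolding cube_weight_def by (simp add: prod.distrib exp_sum[symmetric] sum_distrib_left)
  finally show ?thesis by (simp only: of_real_mult exp_of_real[symmetric])
qed

lemma phase_shift:
  "phase n (\<lambda>i j. M i j + s) E y = phase n M E y + s * phase n (\<lambda>_ _. 1) E y"
  unfolding phase_def by (simp add: sum.distrib sum_distrib_left distrib_right)

lemma circle_factor_shift:
  assumes R: "\<And>i j. i < j \<Longrightarrow> j < n \<Longrightarrow> R j < R i" "\<And>i. i < n \<Longrightarrow> 0 < R i" and i: "i < n"
  shows "circle_factor n R (\<lambda>i j. M i j + s) n y i = circle_factor n R M n y i *
     exp (complex_of_real s * (\<Sum>j\<in>{i..<n}. complex_of_real (ln (R i)) + \<i> * y i + Ln (1 - (if j = i then 0 else rcis (R j) (y j)) / rcis (R i) (y i))))"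
proof -
  let ?q = "\<lambda>j. (if j = i then 0 else rcis (R j) (y j)) / rcis (R i) (y i)"
  have nz: "1 - ?q j \<noteq> 0" if "j \<in> {i..<n}" for j
  proof -
    have "norm (?q j) < 1" using that R(1)[of i j] R(2)[of i] R(2)[of j] i by (auto simp: norm_divide)
    thus ?thesis by auto
  qed
  have "(\<Prod>j\<in>{i..<n}. exp (complex_of_real (M i j + s) * (complex_of_real (ln (R i)) + \<i> * y i)) * (1 - ?q j) powr complex_of_real (M i j + s))
     = (\<Prod>j\<in>{i..<n}. (exp (M i j * (complex_of_real (ln (R i)) + \<i> * y i)) * (1 - ?q j) powr M i j) *
         exp (complex_of_real s * (complex_of_real (ln (R i)) + \<i> * y i + Ln (1 - ?q j))))"
  proof (rule prod.cong[OF refl])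
    fix j assume "j \<in> {i..<n}"
    from nz[OF this] show "exp (complex_of_real (M i j + s) * (complex_of_real (ln (R i)) + \<i> * y i)) * (1 - ?q j) powr complex_of_real (M i j + s) =
       (exp (M i j * (complex_of_real (ln (R i)) + \<i> * y i)) * (1 - ?q j) powr M i j) *
         exp (complex_of_real s * (complex_of_real (ln (R i)) + \<i> * y i + Ln (1 - ?q j)))"
      unfolding of_real_add powr_add distrib_right distrib_left exp_add by (simp add: powr_def[of _ "complex_of_real s"])
  qed
  also have "\<dots> = (\<Prod>j\<in>{i..<n}. exp (M i j * (complex_of_real (ln (R i)) + \<i> * y i)) * (1 - ?q j) powr M i j) *
       exp (complex_of_real s * (\<Sum>j\<in>{i..<n}. complex_of_real (ln (R i)) + \<i> * y i + Ln (1 - ?q j)))"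
    unfolding prod.distrib[of _ "\<lambda>j. exp (complex_of_real s * _ j)"] sum_distrib_left exp_sum[OF finite_atLeastLessThan] ..
  finally have T: "(\<Prod>j\<in>{i..<n}. exp (complex_of_real (M i j + s) * (complex_of_real (ln (R i)) + \<i> * y i)) * (1 - ?q j) powr complex_of_real (M i j + s))
     = (\<Prod>j\<in>{i..<n}. exp (M i j * (complex_of_real (ln (R i)) + \<i> * y i)) * (1 - ?q j) powr M i j) *
       exp (complex_of_real s * (\<Sum>j\<in>{i..<n}. complex_of_real (ln (R i)) + \<i> * y i + Ln (1 - ?q j)))" .
  have cf: "circle_factor n R M' n y i = indicator {0..2*pi} (y i) *\<^sub>R (\<i> * rcis (R i) (y i) *
       (\<Prod>j\<in>{i..<n}. exp (M' i j * (complex_of_real (ln (R i)) + \<i> * y i)) * (1 - ?q j) powr M' i j))" for M'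
    unfolding circle_factor_def by (intro arg_cong2[where f=scaleR] arg_cong2[where f="(*)"] prod.cong refl) auto
  show ?thesis unfolding cf T by (simp only: mult_scaleR_left mult.assoc)
qed

text \<open>The majorant for the slit integrals comes from \<open>W\<close>: all boxes lie in the
  half-open unit cube, and every phase factor has norm 1.\<close>

lemma integral_circles_eq_line:
  assumes R: "\<And>i j. i < j \<Longrightarrow> j < n \<Longrightarrow> R j < R i" "\<And>i. i < n \<Longrightarrow> 0 < R i \<and> R i < 1"
    and W: "integrable (PiM {0..<n} (\<lambda>_. lborel)) (\<lambda>y. (\<Prod>i<n. indicator {0..<1} (y i)) * cube_weight n M y)"
  shows "(\<integral>y. hybrid n R M n y \<partial>PiM {0..<n} (\<lambda>_. lborel)) =
    (\<Sum>E\<in>Pow {..<n}. (-1) ^ card ({..<n} - E) *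
      (\<integral>y. complex_of_real ((\<Prod>i<n. indicator {0..R i} (y i)) * cube_weight n M y) * exp (\<i> * pi * phase n M E y) \<partial>PiM {0..<n} (\<lambda>_. lborel)))"
proof -
  let ?L = "PiM {0..<n} (\<lambda>_. lborel) :: (nat \<Rightarrow> real) measure"
  \<comment> \<open>\<open>u\<close> is the logarithm, along the chosen branch, of the product of
    all \<open>z_i\<close> and all \<open>z_i - z_j\<close>, and \<open>v E\<close> is its boundary
    value on the slits for the choice \<open>E\<close>; these multiply \<open>s\<close> when every
    exponent is shifted.\<close>
  define u where "u y = (\<Sum>i<n. \<Sum>j\<in>{i..<n}. complex_of_real (ln (R i)) + \<i> * y i + Ln (1 - (if j = i then 0 else rcis (R j) (y j)) / rcis (R i) (y i)))" for y
  define v where "v E y = complex_of_real (\<Sum>i<n. \<Sum>j\<in>{i..<n}. ln \<bar>y i - node y i j\<bar>) + \<i> * pi * phase n (\<lambda>_ _. 1) E y" for E y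
  define h where "h E y = (-1) ^ card ({..<n} - E) * (complex_of_real ((\<Prod>i<n. indicator {0..R i} (y i)) * cube_weight n M y) * exp (\<i> * pi * phase n M E y))" for E y
  \<comment> \<open>Each factor contributes an angle of at most 2 pi and a principal logarithm with
    imaginary part at most pi; real parts are at most 1 on the circles and nonpositive on the slits,
    where all distances are at most 1.\<close>
  define K where "K = (\<Sum>i<n. \<Sum>j\<in>{i..<n}. 3 * pi)"
  \<comment> \<open>Dominates every \<open>\<bar>M i j\<bar>\<close> with \<open>i, j < n\<close>,
    so that all exponents shifted by \<open>s > S\<close> are positive.\<close>
  define S where "S = (\<Sum>i<n. \<Sum>j<n. \<bar>M i j\<bar>)"
  note [measurable] = measurable_cube_weight[of n M] measurable_phase
  have ind_meas [measurable]: "(\<lambda>y. \<Prod>i<n. indicator {0..R i} (y i) :: real) \<in> borel_measurable ?L"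
  proof (intro borel_measurable_prod)
    fix i assume "i \<in> {..<n}"
    hence [measurable]: "(\<lambda>y. y i) \<in> borel_measurable ?L" by (intro measurable_coord) auto
    show "(\<lambda>y. indicator {0..R i} (y i) :: real) \<in> borel_measurable ?L" by measurable
  qed
    have hI: "integrable ?L (h E)" if "E \<in> Pow {..<n}" for E
    proof (rule Bochner_Integration.integrable_bound[OF W])
      show "h E \<in> borel_measurable ?L" unfolding h_def[abs_def] by measurable
      show "AE y in ?L. norm (h E y) \<le> norm ((\<Prod>i<n. indicator {0..<1} (y i)) * cube_weight n M y)"
      proof (rule AE_I2)
        fix y
        have "(\<Prod>i<n. indicator {0..R i} (y i) :: real) \<le> (\<Prod>i<n. indicator {0..<1} (y i))"
          using R(2) by (intro prod_mono) (force simp: indicator_def)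
        moreover have "0 \<le> (\<Prod>i<n. indicator {0..R i} (y i) :: real)" by (intro prod_nonneg) auto
        ultimately show "norm (h E y) \<le> norm ((\<Prod>i<n. indicator {0..<1} (y i)) * cube_weight n M y)"
          unfolding h_def norm_mult norm_of_real by (simp add: norm_power abs_mult mult_right_mono)
      qed
    qed
    have vM: "v E \<in> borel_measurable ?L" if "E \<in> Pow {..<n}" for E
    proof -
      have "(\<lambda>y. \<Sum>i<n. \<Sum>j\<in>{i..<n}. ln \<bar>y i - node y i j\<bar>) \<in> borel_measurable ?L"
      proof (intro borel_measurable_sum)
        fix i j assume ij: "i \<in> {..<n}" "j \<in> {i..<n}"
        hence [measurable]: "(\<lambda>y. y i) \<in> borel_measurable ?L" "(\<lambda>y. node y i j) \<in> borel_measurable ?L"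
          by (auto intro: measurable_coord measurable_node)
        show "(\<lambda>y. ln \<bar>y i - node y i j\<bar>) \<in> borel_measurable ?L" by measurable
      qed
      note [measurable] = this
      show ?thesis unfolding v_def[abs_def] by measurable
    qed
    have vB: "Re (v E y) \<le> K \<and> \<bar>Im (v E y)\<bar> \<le> K" if "E \<in> Pow {..<n}" "h E y \<noteq> 0" for E y
    proof -
      have K0: "0 \<le> K" unfolding K_def by (intro sum_nonneg) auto
      have nz: "cube_weight n M y \<noteq> 0" "(\<Prod>i<n. indicator {0..R i} (y i) :: real) \<noteq> 0" using that by (auto simp: h_def)
      have box: "0 \<le> y i \<and> y i < 1" if "i < n" for i
      proof -
        have "indicator {0..R i} (y i) \<noteq> (0::real)" using nz(2) that by (auto simp: prod_zero_iff)
        thus ?thesis using R(2)[OF that] by (auto simp: indicator_def split: if_splits)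
      qed
      have "Re (v E y) = (\<Sum>i<n. \<Sum>j\<in>{i..<n}. ln \<bar>y i - node y i j\<bar>)" unfolding v_def by simp
      also have "\<dots> \<le> 0"
      proof (intro sum_nonpos)
        fix i j assume ij: "i \<in> {..<n}" "j \<in> {i..<n}"
        have "\<bar>y i - node y i j\<bar> \<noteq> 0" using nz(1) ij by (auto simp: cube_weight_def)
        moreover have "\<bar>y i - node y i j\<bar> \<le> 1" using box[of i] box[of j] ij by (auto simp: node_def)
        ultimately show "ln \<bar>y i - node y i j\<bar> \<le> 0" by simp
      qed
      finally have 1: "Re (v E y) \<le> K" using K0 by linarith
      have "\<bar>phase n (\<lambda>_ _. 1) E y\<bar> \<le> (\<Sum>i<n. \<Sum>j\<in>{i..<n}. 3)"
        unfolding phase_def by (intro order_trans[OF sum_abs] sum_mono) auto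
      hence "\<bar>pi * phase n (\<lambda>_ _. 1) E y\<bar> \<le> pi * (\<Sum>i<n. \<Sum>j\<in>{i..<n}. 3)"
        unfolding abs_mult by (intro mult_mono) auto
      also have "\<dots> = K" unfolding K_def sum_distrib_left by (simp only: mult.commute)
      finally have "\<bar>Im (v E y)\<bar> \<le> K" unfolding v_def by simp
      with 1 show ?thesis by simp
    qed
  have "(\<integral>y. hybrid n R M n y \<partial>?L) = (\<Sum>E\<in>Pow {..<n}. \<integral>y. h E y \<partial>?L)"
  proof (rule integral_eq_by_continuation[where u=u and v=v and K=K and L=K and S=S, OF _ _ _ hI vM vB])
    show "integrable ?L (hybrid n R M n)" using R by (intro integrable_hybrid) (auto intro: less_imp_le)
    show "u \<in> borel_measurable ?L"
      unfolding u_def[abs_def]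
    proof (intro borel_measurable_sum)
      fix i j assume ij: "i \<in> {..<n}" "j \<in> {i..<n}"
      hence [measurable]: "(\<lambda>y. y i) \<in> borel_measurable ?L" "(\<lambda>y. y j) \<in> borel_measurable ?L" by (auto intro: measurable_coord)
      show "(\<lambda>y. complex_of_real (ln (R i)) + \<i> * y i + Ln (1 - (if j = i then 0 else rcis (R j) (y j)) / rcis (R i) (y i))) \<in> borel_measurable ?L"
        by measurable
    qed
    show "Re (u y) \<le> K \<and> \<bar>Im (u y)\<bar> \<le> K" if "hybrid n R M n y \<noteq> 0" for y
    proof -
      have box: "0 \<le> y i \<and> y i \<le> 2 * pi" if "i < n" for i
      proof (rule ccontr)
        assume "\<not> ?thesis"
        hence "circle_factor n R M n y i = 0" unfolding circle_factor_def by (auto simp: indicator_def)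
        hence "hybrid n R M n y = 0" unfolding hybrid_def using \<open>i < n\<close> by (intro prod_zero) (auto intro!: bexI[of _ i])
        thus False using \<open>hybrid n R M n y \<noteq> 0\<close> by simp
      qed
      have t: "Re (complex_of_real (ln (R i)) + \<i> * y i + Ln (1 - (if j = i then 0 else rcis (R j) (y j)) / rcis (R i) (y i))) \<le> 3 * pi
         \<and> \<bar>Im (complex_of_real (ln (R i)) + \<i> * y i + Ln (1 - (if j = i then 0 else rcis (R j) (y j)) / rcis (R i) (y i)))\<bar> \<le> 3 * pi"
        if ij: "i \<in> {..<n}" "j \<in> {i..<n}" for i j
      proof -
        let ?q = "(if j = i then 0 else rcis (R j) (y j)) / rcis (R i) (y i)"
        have q: "norm ?q < 1" using ij R(1)[of i j] R(2)[of i] R(2)[of j] by (auto simp: norm_divide)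
        hence nz: "1 - ?q \<noteq> 0" by auto
        have n2: "norm (1 - ?q) \<le> 2" using norm_triangle_ineq4[of 1 ?q] q by simp
        have p: "norm (1 - ?q) > 0" using nz by simp
        have "Re (Ln (1 - ?q)) = ln (norm (1 - ?q))" using nz by simp
        also have "\<dots> \<le> norm (1 - ?q) - 1" using p by (rule ln_le_minus_one)
        finally have 1: "Re (Ln (1 - ?q)) \<le> 1" using n2 by simp
        have 2: "\<bar>Im (Ln (1 - ?q))\<bar> \<le> pi" using Im_Ln_le_pi[OF nz] mpi_less_Im_Ln[OF nz] by (simp add: abs_le_iff)
        have 3: "ln (R i) \<le> 0" using R(2)[of i] ij by simp
        have 4: "0 \<le> y i" "y i \<le> 2 * pi" using box[of i] ij by auto
        have 5: "3 * pi \<ge> 1" using pi_gt3 by simp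
        show ?thesis using 1 2 3 4 5 by (simp add: abs_le_iff)
      qed
      have "Re (u y) \<le> K" unfolding u_def K_def Re_sum using t by (intro sum_mono) auto
      moreover have "\<bar>Im (u y)\<bar> \<le> K"
        unfolding u_def K_def Im_sum using t by (intro order_trans[OF sum_abs] sum_mono) blast+
      ultimately show ?thesis by simp
    qed
    fix s assume s: "s > S"
    have S0: "0 \<le> S" unfolding S_def by (intro sum_nonneg) auto
    let ?Ms = "\<lambda>i j. M i j + s"
    have pos: "0 < ?Ms i j" if "i \<le> j" "j < n" for i j
    proof -
      have "\<bar>M i j\<bar> \<le> (\<Sum>j<n. \<bar>M i j\<bar>)" using that by (intro member_le_sum) auto
      also have "\<dots> \<le> S" unfolding S_def using that by (intro member_le_sum[of i "{..<n}" "\<lambda>i. \<Sum>j<n. \<bar>M i j\<bar>"]) (auto intro: sum_nonneg)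
      finally show ?thesis using s by linarith
    qed
    have gu: "hybrid n R ?Ms n y = hybrid n R M n y * exp (complex_of_real s * u y)" for y
    proof -
      have "hybrid n R ?Ms n y = (\<Prod>i<n. circle_factor n R M n y i *
         exp (complex_of_real s * (\<Sum>j\<in>{i..<n}. complex_of_real (ln (R i)) + \<i> * y i + Ln (1 - (if j = i then 0 else rcis (R j) (y j)) / rcis (R i) (y i)))))"
        unfolding hybrid_def using R by (intro prod.cong refl) (simp add: circle_factor_shift)
      also have "\<dots> = hybrid n R M n y * exp (complex_of_real s * u y)"
        unfolding hybrid_def u_def sum_distrib_left[of _ _ "{..<n}"] exp_sum[OF finite_lessThan] prod.distrib by simp
      finally show ?thesis .
    qed
    have hv: "hybrid n R ?Ms 0 y = (\<Sum>E\<in>Pow {..<n}. h E y * exp (complex_of_real s * v E y))" for y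
      unfolding hybrid_0_expand
    proof (rule sum.cong[OF refl])
      fix E
      let ?i = "\<Prod>i<n. indicator {0..R i} (y i) :: real"
      show "(-1) ^ card ({..<n} - E) * (complex_of_real (?i * cube_weight n ?Ms y) * exp (\<i> * pi * phase n ?Ms E y)) = h E y * exp (complex_of_real s * v E y)"
      proof (cases "cube_weight n M y = 0")
        case True
        then obtain i j where "i < n" "j \<in> {i..<n}" "\<bar>y i - node y i j\<bar> = 0" by (auto simp: cube_weight_def)
        hence z: "(\<Prod>j\<in>{i..<n}. \<bar>y i - node y i j\<bar> powr ?Ms i j) = 0"
          by (intro prod_zero bexI[of _ j]) simp_all
        have "cube_weight n ?Ms y = 0"
          unfolding cube_weight_def
          by (rule prod_zero[OF finite_lessThan], rule bexI[of _ i], rule z) (simp add: \<open>i < n\<close>)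
        thus ?thesis using True by (simp add: h_def)
      next
        case False
        have "exp (\<i> * pi * phase n ?Ms E y) = exp (\<i> * pi * phase n M E y) * exp (complex_of_real s * (\<i> * pi * phase n (\<lambda>_ _. 1) E y))"
          unfolding phase_shift exp_add[symmetric] by (simp add: algebra_simps)
        thus ?thesis unfolding h_def v_def of_real_mult cube_weight_shift[OF False] distrib_left[of "complex_of_real s"] exp_add[of "complex_of_real s * _"]
          by (simp only: mult_ac)
      qed
    qed
    have ih: "integrable ?L (\<lambda>y. h E y * exp (complex_of_real s * v E y))" if "E \<in> Pow {..<n}" for E
      using S0 s by (intro integrable_mult_exp[OF hI vM vB] that) auto
    have "(\<integral>y. hybrid n R M n y * exp (complex_of_real s * u y) \<partial>?L) = (\<integral>y. hybrid n R ?Ms n y \<partial>?L)" by (simp only: gu)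
    also have "\<dots> = (\<integral>y. hybrid n R ?Ms 0 y \<partial>?L)"
      using R pos by (intro integral_hybrid_collapse) (auto intro: less_imp_le)
    also have "\<dots> = (\<Sum>E\<in>Pow {..<n}. \<integral>y. h E y * exp (complex_of_real s * v E y) \<partial>?L)"
      unfolding hv using ih by (intro Bochner_Integration.integral_sum) auto
    finally show "(\<integral>y. hybrid n R M n y * exp (complex_of_real s * u y) \<partial>?L) = (\<Sum>E\<in>Pow {..<n}. \<integral>y. h E y * exp (complex_of_real s * v E y) \<partial>?L)" .
  qed
  thus ?thesis unfolding h_def integral_mult_right_zero .
qed


lemma F_minus_eq_sum_cube_integrals:
  assumes F: "F_minus_converges n m mm"
    and W: "integrable (PiM {0..<n} (\<lambda>_. lborel)) (\<lambda>y. (\<Prod>i<n. indicator {0..<1} (y i)) * cube_weight n (expo m mm) y)"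
  shows "(2 * pi * \<i>) ^ n * F_minus n m mm =
    (\<Sum>E\<in>Pow {..<n}. (-1) ^ card ({..<n} - E) *
      (\<integral>y. complex_of_real ((\<Prod>i<n. indicator {0..<1} (y i)) * cube_weight n (expo m mm) y) * exp (\<i> * pi * phase n (expo m mm) E y)
        \<partial>PiM {0..<n} (\<lambda>_. lborel)))"
proof -
  let ?L = "PiM {0..<n} (\<lambda>_. lborel) :: (nat \<Rightarrow> real) measure"
  \<comment> \<open>The radii \<open>r l ^ Suc i\<close> decrease strictly in \<open>i\<close>, stay
    below 1 even for \<open>i = 0\<close>, and all of them, like their ratios, tend to 1.\<close>
  define r where "r l = 1 - 1 / real (Suc (Suc l))" for l
  define R where "R l i = r l ^ Suc i" for l i
  have r: "0 < r l" "r l < 1" for l by (auto simp: r_def field_simps)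
  have rl: "r \<longlonglongrightarrow> 1"
  proof -
    have "(\<lambda>l. 1 - 1 / real (Suc (Suc l))) \<longlonglongrightarrow> 1 - 0"
      using LIMSEQ_Suc[OF LIMSEQ_inverse_real_of_nat] by (intro tendsto_intros) (simp add: field_simps)
    thus ?thesis by (simp add: r_def[abs_def])
  qed
  have Rl: "(\<lambda>l. R l i) \<longlonglongrightarrow> 1" for i
    using tendsto_power[OF rl, of "Suc i"] by (simp add: R_def)
  have Rd: "R l j < R l i" if "i < j" "j < n" for i j l
    unfolding R_def using r[of l] that by (intro power_strict_decreasing) auto
  have R1: "0 < R l i \<and> R l i < 1" if "i < n" for i l
    unfolding R_def using r[of l] by (auto simp: power_less_one_iff simp del: power_Suc)
  define b where "b i = m i + 1 + (\<Sum>j\<in>{i<..<n}. mm i j)" for i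
  define c where "c l k = complex_of_real (if k \<in> Fidx n then (\<Prod>(i, j)\<in>pairs n. (R l j / R l i) ^ k i j) else 0)" for l k
  have eq: "(2 * pi * \<i>) ^ n * (\<Prod>i<n. complex_of_real (R l i powr b i)) * infsum (\<lambda>k. Fterm n m mm k * c l k) (Fidx n)
    = (\<Sum>E\<in>Pow {..<n}. (-1) ^ card ({..<n} - E) *
      (\<integral>y. complex_of_real ((\<Prod>i<n. indicator {0..R l i} (y i)) * cube_weight n (expo m mm) y) * exp (\<i> * pi * phase n (expo m mm) E y) \<partial>?L))" for l
  proof -
    have "(\<integral>y. hybrid n (R l) (expo m mm) n y \<partial>?L) = (2 * pi * \<i>) ^ n * (\<Prod>i<n. complex_of_real (R l i powr b i)) *
       infsum (\<lambda>k. Fterm n m mm k * complex_of_real (\<Prod>(i, j)\<in>pairs n. (R l j / R l i) ^ k i j)) (Fidx n)"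
      unfolding b_def using R1 Rd by (intro integral_circles_series) (auto intro: less_imp_le)
    also have "infsum (\<lambda>k. Fterm n m mm k * complex_of_real (\<Prod>(i, j)\<in>pairs n. (R l j / R l i) ^ k i j)) (Fidx n)
       = infsum (\<lambda>k. Fterm n m mm k * c l k) (Fidx n)"
      by (intro infsum_cong) (simp add: c_def)
    finally show ?thesis using integral_circles_eq_line[OF Rd R1 W] by simp
  qed
  have lim1: "(\<lambda>l. (2 * pi * \<i>) ^ n * (\<Prod>i<n. complex_of_real (R l i powr b i)) * infsum (\<lambda>k. Fterm n m mm k * c l k) (Fidx n))
     \<longlonglongrightarrow> (2 * pi * \<i>) ^ n * (\<Prod>i<n. complex_of_real (1 powr b i)) * infsum (Fterm n m mm) (Fidx n)"
  proof (intro tendsto_mult tendsto_const tendsto_prod tendsto_of_real tendsto_powr Rl infsum_tendsto_dominated)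
    show "Fterm n m mm summable_on Fidx n" using F by (simp add: F_minus_converges_def)
    show "norm (c l k) \<le> 1" for l k
    proof (cases "k \<in> Fidx n")
      case True
      have "0 \<le> (case x of (i, j) \<Rightarrow> (R l j / R l i) ^ k i j) \<and> (case x of (i, j) \<Rightarrow> (R l j / R l i) ^ k i j) \<le> 1" if "x \<in> pairs n" for x
        using that R1[of "fst x" l] R1[of "snd x" l] Rd[of "fst x" "snd x" l]
        by (auto simp: pairs_def intro!: power_le_one divide_nonneg_pos zero_le_power)
      hence "0 \<le> (\<Prod>(i, j)\<in>pairs n. (R l j / R l i) ^ k i j) \<and> (\<Prod>(i, j)\<in>pairs n. (R l j / R l i) ^ k i j) \<le> 1"
        by (intro conjI prod_nonneg prod_le_1) auto
      thus ?thesis unfolding c_def norm_of_real using True by simp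
    qed (simp add: c_def)
    show "(\<lambda>l. c l k) \<longlonglongrightarrow> 1" if "k \<in> Fidx n" for k
    proof -
      have "(\<lambda>l. \<Prod>x\<in>pairs n. (R l (snd x) / R l (fst x)) ^ k (fst x) (snd x)) \<longlonglongrightarrow> (\<Prod>x\<in>pairs n. (1 / 1) ^ k (fst x) (snd x))"
        by (intro tendsto_prod tendsto_power tendsto_divide Rl) auto
      hence "(\<lambda>l. complex_of_real (\<Prod>x\<in>pairs n. (R l (snd x) / R l (fst x)) ^ k (fst x) (snd x))) \<longlonglongrightarrow> complex_of_real 1"
        by (intro tendsto_of_real) simp
      thus ?thesis using that unfolding c_def by (simp add: split_def)
    qed
  qed auto
  have lim2: "(\<lambda>l. \<Sum>E\<in>Pow {..<n}. (-1) ^ card ({..<n} - E) *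
      (\<integral>y. complex_of_real ((\<Prod>i<n. indicator {0..R l i} (y i)) * cube_weight n (expo m mm) y) * exp (\<i> * pi * phase n (expo m mm) E y) \<partial>?L))
     \<longlonglongrightarrow> (\<Sum>E\<in>Pow {..<n}. (-1) ^ card ({..<n} - E) *
      (\<integral>y. complex_of_real ((\<Prod>i<n. indicator {0..<1} (y i)) * cube_weight n (expo m mm) y) * exp (\<i> * pi * phase n (expo m mm) E y) \<partial>?L))"
  proof (intro tendsto_sum tendsto_mult tendsto_const integral_dominated_convergence[where w="\<lambda>y. norm ((\<Prod>i<n. indicator {0..<1} (y i)) * cube_weight n (expo m mm) y)"])
    fix E
    note [measurable] = measurable_cube_weight[of n "expo m mm"] measurable_phase
    have ind_meas: "(\<lambda>y. \<Prod>i<n. indicator (A i) (y i) :: real) \<in> borel_measurable ?L" if "\<And>i. A i \<in> sets borel" for A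
    proof (intro borel_measurable_prod)
      fix i assume "i \<in> {..<n}"
      hence [measurable]: "(\<lambda>y. y i) \<in> borel_measurable ?L" by (intro measurable_coord) auto
      note [measurable] = that
      show "(\<lambda>y. indicator (A i) (y i) :: real) \<in> borel_measurable ?L" by measurable
    qed
    have [measurable]: "(\<lambda>y. \<Prod>i<n. indicator {0..<1} (y i) :: real) \<in> borel_measurable ?L"
       "(\<lambda>y. \<Prod>i<n. indicator {0..R l i} (y i) :: real) \<in> borel_measurable ?L" for l
      by (auto intro!: ind_meas)
    show "(\<lambda>y. complex_of_real ((\<Prod>i<n. indicator {0..<1} (y i)) * cube_weight n (expo m mm) y) * exp (\<i> * pi * phase n (expo m mm) E y)) \<in> borel_measurable ?L"
      by measurable
    show "(\<lambda>y. complex_of_real ((\<Prod>i<n. indicator {0..R l i} (y i)) * cube_weight n (expo m mm) y) * exp (\<i> * pi * phase n (expo m mm) E y)) \<in> borel_measurable ?L" for l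
      by measurable
    show "integrable ?L (\<lambda>y. norm ((\<Prod>i<n. indicator {0..<1} (y i)) * cube_weight n (expo m mm) y))"
      using W by (rule integrable_norm)
    show "AE y in ?L. (\<lambda>l. complex_of_real ((\<Prod>i<n. indicator {0..R l i} (y i)) * cube_weight n (expo m mm) y) * exp (\<i> * pi * phase n (expo m mm) E y))
       \<longlonglongrightarrow> complex_of_real ((\<Prod>i<n. indicator {0..<1} (y i)) * cube_weight n (expo m mm) y) * exp (\<i> * pi * phase n (expo m mm) E y)"
    proof (intro AE_I2 tendsto_mult tendsto_const tendsto_of_real tendsto_prod)
      fix y i assume i: "i \<in> {..<n}"
      \<comment> \<open>The radii approach 1 from below, so the value 1 is never reached; hence the
        half-open interval in the limit.\<close>
      show "(\<lambda>l. indicator {0..R l i} (y i) :: real) \<longlonglongrightarrow> indicator {0..<1} (y i)"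
      proof (cases "0 \<le> y i \<and> y i < 1")
        case True
        hence "\<forall>\<^sub>F l in sequentially. y i < R l i" using order_tendstoD(1)[OF Rl] by auto
        hence "\<forall>\<^sub>F l in sequentially. indicator {0..R l i} (y i) = (indicator {0..<1} (y i) :: real)"
          by eventually_elim (use True in \<open>auto simp: indicator_def\<close>)
        thus ?thesis by (rule tendsto_eventually)
      next
        case False
        hence "indicator {0..R l i} (y i) = (indicator {0..<1} (y i) :: real)" for l
          using R1[of i l] i by (auto simp: indicator_def)
        thus ?thesis by simp
      qed
    qed
    show "AE y in ?L. norm (complex_of_real ((\<Prod>i<n. indicator {0..R l i} (y i)) * cube_weight n (expo m mm) y) * exp (\<i> * pi * phase n (expo m mm) E y))
       \<le> norm ((\<Prod>i<n. indicator {0..<1} (y i)) * cube_weight n (expo m mm) y)" for l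
    proof (rule AE_I2)
      fix y
      have "(\<Prod>i<n. indicator {0..R l i} (y i) :: real) \<le> (\<Prod>i<n. indicator {0..<1} (y i))"
        using R1[of _ l] by (intro prod_mono) (force simp: indicator_def)
      moreover have "0 \<le> (\<Prod>i<n. indicator {0..R l i} (y i) :: real)" by (intro prod_nonneg) auto
      ultimately show "norm (complex_of_real ((\<Prod>i<n. indicator {0..R l i} (y i)) * cube_weight n (expo m mm) y) * exp (\<i> * pi * phase n (expo m mm) E y))
       \<le> norm ((\<Prod>i<n. indicator {0..<1} (y i)) * cube_weight n (expo m mm) y)"
        unfolding norm_mult norm_of_real by (simp add: abs_mult mult_right_mono)
    qed
  qed
  from LIMSEQ_unique[OF lim1[unfolded eq] lim2] show ?thesis
    by (simp add: F_minus_def)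
qed

section \<open>The braiding factor and inversions\<close>

lemma permutes_less: "p permutes {0..<n} \<Longrightarrow> i < n \<Longrightarrow> p i < (n::nat)"
  using permutes_in_image[of p "{0..<n}" i] by simp

text \<open>The set on the left is the preimage of \<open>{..<p v}\<close>. Thus a permutation is
  determined by the order that it induces, which is how uniqueness is proved further on.\<close>

lemma card_perm_less:
  fixes p :: "nat \<Rightarrow> nat"
  assumes p: "p permutes {0..<n}" and v: "v < n"
  shows "card {u. u < n \<and> p u < p v} = p v"
proof -
  have "p ` {u. u < n \<and> p u < p v} = {..<p v}"
  proof
    show "{..<p v} \<subseteq> p ` {u. u < n \<and> p u < p v}"
    proof
      fix x assume x: "x \<in> {..<p v}"
      hence "inv p x < n" using permutes_less[OF permutes_inv[OF p]] permutes_less[OF p v] by auto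
      moreover have "p (inv p x) = x" using permutes_inverses(1)[OF p] .
      ultimately show "x \<in> p ` {u. u < n \<and> p u < p v}" using x by (intro image_eqI[of _ _ "inv p x"]) auto
    qed
  qed auto
  moreover have "inj_on p {u. u < n \<and> p u < p v}" using permutes_inj_on[OF p] by (rule inj_on_subset) auto
  ultimately show ?thesis using card_image by fastforce
qed

lemma strict_mono_permutes_id:
  fixes p :: "nat \<Rightarrow> nat"
  assumes p: "p permutes {0..<n}" and mono: "\<And>i j. i < j \<Longrightarrow> j < n \<Longrightarrow> p i < p j"
  shows "p = id"
proof
  fix v show "p v = id v"
  proof (cases "v < n")
    case True
    have "p u < p v \<longleftrightarrow> u < v" if "u < n" for u
      using mono[of u v] mono[of v u] that True by (cases u v rule: linorder_cases) auto
    hence "{u. u < n \<and> p u < p v} = {..<v}" using True by auto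
    thus ?thesis using card_perm_less[OF p True] by simp
  next
    case False thus ?thesis using permutes_not_in[OF p, of v] by simp
  qed
qed

text \<open>A permutation acts on unordered pairs, while \<open>pairs n\<close> lists each of them
  in increasing order; \<open>min\<close> and \<open>max\<close> restore that order and the symmetry
  of \<open>f\<close> absorbs the exchange.\<close>

lemma prod_pairs_permute:
  fixes f :: "nat \<Rightarrow> nat \<Rightarrow> 'a::comm_monoid_mult"
  assumes p: "p permutes {0..<n}" and f: "\<And>i j. i \<noteq> j \<Longrightarrow> f i j = f j i"
  shows "(\<Prod>(i, j)\<in>pairs n. f (p i) (p j)) = (\<Prod>(i, j)\<in>pairs n. f i j)"
proof -
  have less: "p i < n" "inv p i < n" if "i < n" for i
    using permutes_less[OF p that] permutes_less[OF permutes_inv[OF p] that] by auto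
  have ne: "p i \<noteq> p j" "inv p i \<noteq> inv p j" if "i \<noteq> j" for i j
    using that permutes_inj[OF p] permutes_inj[OF permutes_inv[OF p]] by (auto dest: injD)
  note inv = permutes_inverses[OF p]
  show ?thesis
    by (rule prod.reindex_bij_witness[of _ "\<lambda>(i, j). (min (inv p i) (inv p j), max (inv p i) (inv p j))"
          "\<lambda>(i, j). (min (p i) (p j), max (p i) (p j))"])
       (use less ne f in \<open>auto simp: pairs_def min_def max_def inv not_le not_less le_less\<close>)
qed

section \<open>Inversions, Coxeter length and the braiding factor\<close>

definition inversions :: "nat \<Rightarrow> (nat \<Rightarrow> nat) \<Rightarrow> (nat \<times> nat) set" where
  "inversions n \<sigma> = {(i, j) \<in> pairs n. \<sigma> j < \<sigma> i}"

lemma finite_inversions: "finite (inversions n \<sigma>)"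
  unfolding inversions_def by (rule finite_subset[OF _ finite_pairs]) auto

abbreviation adj :: "nat \<Rightarrow> nat \<Rightarrow> nat" where
  "adj k \<equiv> Transposition.transpose k (k + 1)"

lemma adj_permutes: "k + 1 < n \<Longrightarrow> adj k permutes {0..<n}"
  by (rule permutes_swap_id) auto

text \<open>Composition on the left exchanges the neighbouring values \<open>k\<close> and
  \<open>k + 1\<close>, which compare alike with every other value; only the pair of positions that
  carry them changes its status.\<close>

lemma inversions_adj_up:
  assumes s: "\<sigma> permutes {0..<n}" and k: "k + 1 < n" and up: "inv \<sigma> k < inv \<sigma> (k + 1)"
  shows "inversions n (adj k \<circ> \<sigma>) = insert (inv \<sigma> k, inv \<sigma> (k + 1)) (inversions n \<sigma>)"
    and "(inv \<sigma> k, inv \<sigma> (k + 1)) \<notin> inversions n \<sigma>"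
proof -
  note i = permutes_inverses[OF s]
  have n: "inv \<sigma> (k + 1) < n" using permutes_less[OF permutes_inv[OF s] k] .
  have eq: "\<sigma> u = k \<longleftrightarrow> u = inv \<sigma> k" "\<sigma> u = k + 1 \<longleftrightarrow> u = inv \<sigma> (k + 1)" for u by (metis i)+
  show "(inv \<sigma> k, inv \<sigma> (k + 1)) \<notin> inversions n \<sigma>" by (simp add: inversions_def i)
  have "adj k (\<sigma> v) < adj k (\<sigma> u) \<longleftrightarrow> \<sigma> v < \<sigma> u \<or> (u = inv \<sigma> k \<and> v = inv \<sigma> (k + 1))" if "u < v" for u v
  proof -
    have ne: "\<sigma> u \<noteq> \<sigma> v" using that permutes_inj[OF s] by (auto dest: injD)
    have no: "\<not> (\<sigma> v = k \<and> \<sigma> u = k + 1)" using that up eq by auto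
    have *: "adj k b < adj k a \<longleftrightarrow> b < a \<or> (a = k \<and> b = k + 1)" if "a \<noteq> b" "\<not> (b = k \<and> a = k + 1)" for a b
      using that unfolding Transposition.transpose_def by auto
    show ?thesis using *[OF ne no] eq by auto
  qed
  thus "inversions n (adj k \<circ> \<sigma>) = insert (inv \<sigma> k, inv \<sigma> (k + 1)) (inversions n \<sigma>)"
    using up n by (auto simp: inversions_def pairs_def)
qed

lemma adj_adj: "adj k \<circ> (adj k \<circ> \<sigma>) = \<sigma>"
  by (simp add: fun_eq_iff)

lemma inv_adj_comp:
  assumes "\<sigma> permutes {0..<n}" "k + 1 < n"
  shows "inv (adj k \<circ> \<sigma>) i = inv \<sigma> (adj k i)"
proof -
  have "inv (adj k \<circ> \<sigma>) = inv \<sigma> \<circ> inv (adj k)"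
    using permutes_bij[OF assms(1)] permutes_bij[OF adj_permutes[OF assms(2)]] by (intro o_inv_distrib)
  thus ?thesis by simp
qed

lemma inversions_adj_down:
  assumes s: "\<sigma> permutes {0..<n}" and k: "k + 1 < n" and down: "inv \<sigma> (k + 1) < inv \<sigma> k"
  shows "inversions n \<sigma> = insert (inv \<sigma> (k + 1), inv \<sigma> k) (inversions n (adj k \<circ> \<sigma>))"
    and "(inv \<sigma> (k + 1), inv \<sigma> k) \<notin> inversions n (adj k \<circ> \<sigma>)"
proof -
  have p: "adj k \<circ> \<sigma> permutes {0..<n}" using permutes_compose[OF s adj_permutes[OF k]] .
  have e: "inv (adj k \<circ> \<sigma>) k = inv \<sigma> (k + 1)" "inv (adj k \<circ> \<sigma>) (k + 1) = inv \<sigma> k"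
    by (simp_all only: inv_adj_comp[OF s k]) simp_all
  note up = inversions_adj_up[OF p k, unfolded e adj_adj, OF down]
  show "inversions n \<sigma> = insert (inv \<sigma> (k + 1), inv \<sigma> k) (inversions n (adj k \<circ> \<sigma>))"
    and "(inv \<sigma> (k + 1), inv \<sigma> k) \<notin> inversions n (adj k \<circ> \<sigma>)" using up by auto
qed

lemma exists_descent:
  fixes \<sigma> :: "nat \<Rightarrow> nat"
  assumes s: "\<sigma> permutes {0..<n}" and "\<sigma> \<noteq> id"
  shows "\<exists>k. k + 1 < n \<and> inv \<sigma> (k + 1) < inv \<sigma> k"
proof (rule ccontr)
  assume "\<not> ?thesis"
  hence no: "inv \<sigma> k \<le> inv \<sigma> (k + 1)" if "k + 1 < n" for k using that by (meson not_less)
  have p: "inv \<sigma> permutes {0..<n}" using permutes_inv[OF s] .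
  have st: "inv \<sigma> k < inv \<sigma> (Suc k)" if "Suc k < n" for k
    using no[of k] that injD[OF permutes_inj[OF p], of k "Suc k"]
    by (cases "inv \<sigma> k = inv \<sigma> (Suc k)") simp_all
  have "i < j \<Longrightarrow> j < n \<Longrightarrow> inv \<sigma> i < inv \<sigma> j" for i j
  proof (induction j)
    case (Suc j)
    show ?case
    proof (cases "i = j")
      case True thus ?thesis using st Suc.prems by simp
    next
      case False
      hence "inv \<sigma> i < inv \<sigma> j" using Suc by simp
      also have "\<dots> < inv \<sigma> (Suc j)" using st Suc.prems by simp
      finally show ?thesis .
    qed
  qed simp
  hence "inv \<sigma> = id" using strict_mono_permutes_id[OF p] by blast
  hence "\<sigma> = id" using permutes_inv_inv[OF s] by (metis inv_id)
  thus False using assms by simp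
qed

lemma word_perm_Cons: "word_perm (k # ks) = adj k \<circ> word_perm ks"
  by (simp add: word_perm_def)

text \<open>One letter creates at most one inversion; this bounds the length of every word from
  below.\<close>

lemma word_perm_bound:
  assumes "\<forall>k\<in>set ks. k + 1 < n"
  shows "word_perm ks permutes {0..<n} \<and> card (inversions n (word_perm ks)) \<le> length ks"
  using assms
proof (induction ks)
  case Nil
  have "inversions n id = {}" by (auto simp: inversions_def pairs_def)
  thus ?case by (simp add: word_perm_def permutes_id flip: id_def)
next
  case (Cons k ks)
  let ?s = "word_perm ks"
  have s: "?s permutes {0..<n}" and c: "card (inversions n ?s) \<le> length ks" and k: "k + 1 < n"
    using Cons by auto
  have "adj k \<circ> ?s permutes {0..<n}" using permutes_compose[OF s adj_permutes[OF k]] .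
  moreover have "card (inversions n (adj k \<circ> ?s)) \<le> Suc (length ks)"
  proof (cases "inv ?s k < inv ?s (k + 1)")
    case True
    thus ?thesis using inversions_adj_up[OF s k True] c finite_inversions[of n ?s] by simp
  next
    case False
    have "inv ?s k \<noteq> inv ?s (k + 1)"
      using injD[OF permutes_inj[OF permutes_inv[OF s]], of k "k + 1"] by fastforce
    with False have "inv ?s (k + 1) < inv ?s k" by linarith
    from inversions_adj_down(1)[OF s k this] have "inversions n (adj k \<circ> ?s) \<subseteq> inversions n ?s" by blast
    from card_mono[OF finite_inversions this] show ?thesis using c by simp
  qed
  ultimately show ?case unfolding word_perm_Cons length_Cons by blast
qed

text \<open>A permutation other than the identity has a descent in its inverse, and exchanging those
  two values removes exactly one inversion.\<close>

lemma exists_word: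
  assumes "\<sigma> permutes {0..<n}"
  shows "\<exists>ks. length ks = card (inversions n \<sigma>) \<and> (\<forall>k\<in>set ks. k + 1 < n) \<and> \<sigma> = word_perm ks"
  using assms
proof (induction "card (inversions n \<sigma>)" arbitrary: \<sigma> rule: less_induct)
  case less
  show ?case
  proof (cases "\<sigma> = id")
    case True
    have "inversions n id = {}" by (auto simp: inversions_def pairs_def)
    thus ?thesis using True by (intro exI[of _ "[]"]) (simp add: word_perm_def)
  next
    case False
    then obtain k where k: "k + 1 < n" "inv \<sigma> (k + 1) < inv \<sigma> k" using exists_descent[OF less.prems] by metis
    note d = inversions_adj_down[OF less.prems k]
    have c: "card (inversions n \<sigma>) = Suc (card (inversions n (adj k \<circ> \<sigma>)))"
      using d finite_inversions by (metis card_insert_disjoint)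
    have "adj k \<circ> \<sigma> permutes {0..<n}" using permutes_compose[OF less.prems adj_permutes[OF k(1)]] .
    then obtain ks where ks: "length ks = card (inversions n (adj k \<circ> \<sigma>))" "\<forall>k\<in>set ks. k + 1 < n" "adj k \<circ> \<sigma> = word_perm ks"
      using less.hyps[of "adj k \<circ> \<sigma>"] c by auto
    have "\<sigma> = word_perm (k # ks)" unfolding word_perm_Cons ks(3)[symmetric] adj_adj ..
    thus ?thesis using ks c k by (intro exI[of _ "k # ks"]) auto
  qed
qed

lemma coxeter_length_eq_card_inversions:
  assumes "\<sigma> permutes {0..<n}"
  shows "coxeter_length n \<sigma> = card (inversions n \<sigma>)"
  unfolding coxeter_length_def
proof (rule Least_equality)
  show "\<exists>ks. length ks = card (inversions n \<sigma>) \<and> (\<forall>k\<in>set ks. k + 1 < n) \<and> \<sigma> = word_perm ks"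
    by (rule exists_word[OF assms])
  show "card (inversions n \<sigma>) \<le> l" if "\<exists>ks. length ks = l \<and> (\<forall>k\<in>set ks. k + 1 < n) \<and> \<sigma> = word_perm ks" for l
    using that word_perm_bound by blast
qed

text \<open>The recursion for \<open>q\<close> speaks only of length-increasing steps. Going from
  \<open>adj k \<circ> \<sigma>\<close> back to \<open>\<sigma>\<close> at a descent is such a step,
  and its exponent belongs to the pair that becomes inverted.\<close>

lemma braiding_factor_eq_prod_inversions:
  assumes q: "is_braiding_factor n mm q" and sym: "\<And>i j. mm i j = mm j i" and s: "\<sigma> permutes {0..<n}"
  shows "q \<sigma> = (\<Prod>(i, j)\<in>inversions n \<sigma>. exp (pi * \<i> * complex_of_real (mm i j)))"
  using s
proof (induction "card (inversions n \<sigma>)" arbitrary: \<sigma> rule: less_induct)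
  case less
  show ?case
  proof (cases "\<sigma> = id")
    case True
    have "inversions n id = {}" by (auto simp: inversions_def pairs_def)
    thus ?thesis using True q by (simp add: is_braiding_factor_def)
  next
    case False
    then obtain k where k: "k + 1 < n" "inv \<sigma> (k + 1) < inv \<sigma> k" using exists_descent[OF less.prems] by metis
    note d = inversions_adj_down[OF less.prems k]
    let ?t = "adj k \<circ> \<sigma>"
    have c: "card (inversions n \<sigma>) = Suc (card (inversions n ?t))"
      using d finite_inversions by (metis card_insert_disjoint)
    have t: "?t permutes {0..<n}" using permutes_compose[OF less.prems adj_permutes[OF k(1)]] .
    have "q (adj k \<circ> ?t) = exp (pi * \<i> * complex_of_real (mm (inv ?t k) (inv ?t (k + 1)))) * q ?t"
    proof -
      have "coxeter_length n (adj k \<circ> ?t) = coxeter_length n ?t + 1"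
        unfolding adj_adj coxeter_length_eq_card_inversions[OF t] coxeter_length_eq_card_inversions[OF less.prems] c by simp
      thus ?thesis using q t k(1) unfolding is_braiding_factor_def by blast
    qed
    also have "inv ?t k = inv \<sigma> (k + 1)" by (simp only: inv_adj_comp[OF less.prems k(1)]) simp
    also have "inv ?t (k + 1) = inv \<sigma> k" by (simp only: inv_adj_comp[OF less.prems k(1)]) simp
    also have "q ?t = (\<Prod>(i, j)\<in>inversions n ?t. exp (pi * \<i> * complex_of_real (mm i j)))"
      using less.hyps[OF _ t] c by simp
    finally show ?thesis
      unfolding adj_adj d(1) using d(2) finite_inversions[of n ?t] by simp
  qed
qed

section \<open>Orderings of the coordinates\<close>

lemma distr_PiM_permute:
  assumes p: "p permutes {0..<n::nat}"
  shows "distr (PiM {0..<n} (\<lambda>_. lborel :: real measure)) (PiM {0..<n} (\<lambda>_. lborel)) (\<lambda>y. \<lambda>i\<in>{0..<n}. y (p i)) = PiM {0..<n} (\<lambda>_. lborel)"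
proof (rule lborel_product.PiM_eqI)
  let ?L = "PiM {0..<n} (\<lambda>_. lborel :: real measure)"
  have less: "p i < n" if "i < n" for i using permutes_less[OF p that] .
  have meas: "(\<lambda>y. \<lambda>i\<in>{0..<n}. y (p i)) \<in> measurable ?L ?L"
    by (intro measurable_restrict) (simp add: measurable_coord less)
  fix A :: "nat \<Rightarrow> real set" assume A: "\<And>i. i \<in> {0..<n} \<Longrightarrow> A i \<in> sets lborel"
  have inv: "inv p i < n" if "i < n" for i using permutes_less[OF permutes_inv[OF p] that] .
  have "(\<lambda>y. \<lambda>i\<in>{0..<n}. y (p i)) -` (PiE {0..<n} A) \<inter> space ?L = PiE {0..<n} (\<lambda>i. A (inv p i))"
  proof (intro equalityI subsetI)
    fix y assume y: "y \<in> (\<lambda>y. \<lambda>i\<in>{0..<n}. y (p i)) -` (PiE {0..<n} A) \<inter> space ?L"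
    have "y i \<in> A (inv p i)" if "i < n" for i
      using y inv[OF that] permutes_inverses(1)[OF p, of i] by (auto simp: PiE_iff dest!: bspec[of _ _ "inv p i"])
    thus "y \<in> PiE {0..<n} (\<lambda>i. A (inv p i))" using y by (auto simp: space_PiM PiE_iff)
  next
    fix y assume y: "y \<in> PiE {0..<n} (\<lambda>i. A (inv p i))"
    have "y (p i) \<in> A i" if "i < n" for i
      using y less[OF that] permutes_inverses(2)[OF p, of i] by (auto simp: PiE_iff dest!: bspec[of _ _ "p i"])
    thus "y \<in> (\<lambda>y. \<lambda>i\<in>{0..<n}. y (p i)) -` (PiE {0..<n} A) \<inter> space ?L"
      using y by (auto simp: space_PiM PiE_iff)
  qed
  moreover have "PiE {0..<n} A \<in> sets ?L" using A by (intro sets_PiM_I_finite) auto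
  ultimately have "emeasure (distr ?L ?L (\<lambda>y. \<lambda>i\<in>{0..<n}. y (p i))) (PiE {0..<n} A) = emeasure ?L (PiE {0..<n} (\<lambda>i. A (inv p i)))"
    using meas by (simp add: emeasure_distr)
  also have "\<dots> = (\<Prod>i\<in>{0..<n}. emeasure lborel (A (inv p i)))"
    using A inv by (intro lborel_product.emeasure_PiM) auto
  also have "\<dots> = (\<Prod>i\<in>{0..<n}. emeasure lborel (A i))"
    by (rule prod.reindex_bij_betw) (rule permutes_imp_bij[OF permutes_inv[OF p]])
  finally show "emeasure (distr ?L ?L (\<lambda>y. \<lambda>i\<in>{0..<n}. y (p i))) (PiE {0..<n} A) = (\<Prod>i\<in>{0..<n}. emeasure lborel (A i))" .
qed auto

text \<open>\<open>\<tau> u\<close> is the rank of coordinate \<open>u\<close> in decreasing order,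
  so that \<open>\<lambda>i. y (inv \<tau> i)\<close> is ordered like the Selberg simplex, with the
  largest coordinate at index 0.\<close>

definition sorted_along :: "nat \<Rightarrow> (nat \<Rightarrow> nat) \<Rightarrow> (nat \<Rightarrow> real) \<Rightarrow> bool" where
  "sorted_along n \<tau> y \<longleftrightarrow> (\<forall>u<n. \<forall>v<n. \<tau> u < \<tau> v \<longrightarrow> y v < y u)"

lemma sorted_along_iff:
  assumes "\<tau> permutes {0..<n}" "sorted_along n \<tau> y" "u < n" "v < n"
  shows "y v < y u \<longleftrightarrow> \<tau> u < \<tau> v"
proof
  assume "y v < y u"
  hence "u \<noteq> v" "\<not> \<tau> v < \<tau> u" using assms(2-4) by (auto simp: sorted_along_def dest: less_asym)
  moreover have "\<tau> u \<noteq> \<tau> v" using \<open>u \<noteq> v\<close> injD[OF permutes_inj[OF assms(1)], of u v] by blast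
  ultimately show "\<tau> u < \<tau> v" by linarith
qed (use assms in \<open>auto simp: sorted_along_def\<close>)

lemma ex1_sorted_along:
  assumes inj: "inj_on y {..<n}"
  shows "\<exists>!\<tau>. \<tau> permutes {0..<n} \<and> sorted_along n \<tau> y"
proof (rule ex_ex1I)
  \<comment> \<open>The rank from above: the number of larger coordinates. Uniqueness holds because
    the order fixes the rank.\<close>
  define t where "t v = (if v < n then card {u. u < n \<and> y v < y u} else v)" for v
  have mono: "t u < t v" if "u < n" "v < n" "y v < y u" for u v
  proof -
    have "{w. w < n \<and> y u < y w} \<subset> {w. w < n \<and> y v < y w}" using that by force
    thus ?thesis unfolding t_def using that by (simp add: psubset_card_mono)
  qed
  have tn: "t v < n" if "v < n" for v
  proof -
    have "{u. u < n \<and> y v < y u} \<subset> {..<n}" using that by force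
    from psubset_card_mono[OF _ this] show ?thesis using that by (simp add: t_def)
  qed
  have injt: "inj_on t {0..<n}"
  proof (rule inj_onI)
    fix u v assume uv: "u \<in> {0..<n}" "v \<in> {0..<n}" "t u = t v"
    hence "\<not> y v < y u" "\<not> y u < y v" using mono[of u v] mono[of v u] by auto
    hence "y u = y v" by linarith
    thus "u = v" using inj uv by (auto simp: inj_on_def)
  qed
  have "t ` {0..<n} \<subseteq> {0..<n}" using tn by auto
  hence "bij_betw t {0..<n} {0..<n}"
    using injt by (simp add: bij_betw_def endo_inj_surj)
  hence "t permutes {0..<n}" by (rule bij_imp_permutes) (simp add: t_def)
  moreover have "sorted_along n t y"
    unfolding sorted_along_def
  proof (intro allI impI)
    fix u v assume uv: "u < n" "v < n" "t u < t v"
    hence "u \<noteq> v" "\<not> y u < y v" using mono[of v u] by auto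
    moreover have "y u \<noteq> y v" using inj uv by (auto simp: inj_on_def)
    ultimately show "y v < y u" by linarith
  qed
  ultimately show "\<exists>\<tau>. \<tau> permutes {0..<n} \<and> sorted_along n \<tau> y" by blast
next
  fix s t assume st: "s permutes {0..<n} \<and> sorted_along n s y" "t permutes {0..<n} \<and> sorted_along n t y"
  have "s v = t v" for v
  proof (cases "v < n")
    case True
    have "s u < s v \<longleftrightarrow> t u < t v" if "u < n" for u
      using sorted_along_iff[of s n y u v] sorted_along_iff[of t n y u v] st that True by simp
    hence "{u. u < n \<and> s u < s v} = {u. u < n \<and> t u < t v}" by auto
    thus ?thesis using card_perm_less[of s n v] card_perm_less[of t n v] st True by simp
  next
    case False thus ?thesis using st permutes_not_in[of s "{0..<n}" v] permutes_not_in[of t "{0..<n}" v] by simp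
  qed
  thus "s = t" by blast
qed

lemma sum_sorted_along:
  fixes f :: "(nat \<Rightarrow> nat) \<Rightarrow> 'a::comm_monoid_add"
  assumes "inj_on y {..<n}" "t permutes {0..<n}" "sorted_along n t y"
  shows "(\<Sum>\<tau>\<in>{\<tau>. \<tau> permutes {0..<n}}. if sorted_along n \<tau> y then f \<tau> else 0) = f t"
proof -
  have "sorted_along n \<tau> y \<longleftrightarrow> \<tau> = t" if "\<tau> permutes {0..<n}" for \<tau>
    using ex1_sorted_along[OF assms(1)] assms(2,3) that by blast
  hence "(\<Sum>\<tau>\<in>{\<tau>. \<tau> permutes {0..<n}}. if sorted_along n \<tau> y then f \<tau> else 0) = (\<Sum>\<tau>\<in>{\<tau>. \<tau> permutes {0..<n}}. if \<tau> = t then f \<tau> else 0)"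
    by (intro sum.cong) auto
  thus ?thesis using assms(2) by (simp add: finite_permutations)
qed

lemma cube_weight_expo:
  "cube_weight n (expo m mm) y = (\<Prod>i<n. \<bar>y i\<bar> powr m i) * (\<Prod>(i, j)\<in>pairs n. \<bar>y i - y j\<bar> powr mm i j)"
proof -
  have "(\<Prod>j\<in>{i..<n}. \<bar>y i - node y i j\<bar> powr expo m mm i j) = \<bar>y i\<bar> powr m i * (\<Prod>j\<in>{i<..<n}. \<bar>y i - y j\<bar> powr mm i j)"
    if "i < n" for i
  proof -
    have "{i..<n} = insert i {i<..<n}" using that by auto
    thus ?thesis by (simp add: node_def expo_def)
  qed
  thus ?thesis unfolding cube_weight_def prod_pairs prod.distrib[symmetric] by simp
qed

lemma sel_region_decreasing:
  assumes "z \<in> sel_region n" "i < j" "j < n"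
  shows "z j < z i"
  using assms(2,3)
proof (induction j)
  case (Suc j)
  have "z (Suc j) < z j" using assms(1) Suc.prems by (auto simp: sel_region_def)
  thus ?case using Suc by (cases "i = j") (auto intro: less_trans)
qed simp

text \<open>Listing the coordinates by rank carries the sector of \<open>\<tau>\<close> to the
  simplex; the absolute weight, a product over unordered pairs, keeps its value when coordinates and
  exponents are relabelled together.\<close>

lemma sel_integrand_permuted:
  assumes n: "n \<ge> 1" and sym: "\<And>i j. mm i j = mm j i" and p: "\<tau> permutes {0..<n}"
  shows "indicator (sel_region n) (\<lambda>i\<in>{0..<n}. y (inv \<tau> i)) *\<^sub>R
     sel_integrand n (\<lambda>i. m (inv \<tau> i)) (\<lambda>_. 0) (\<lambda>i j. mm (inv \<tau> i) (inv \<tau> j)) (\<lambda>i\<in>{0..<n}. y (inv \<tau> i))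
   = (if sorted_along n \<tau> y then 1 else 0) * ((\<Prod>i<n. indicator {0..<1} (y i)) * cube_weight n (expo m mm) y)"
proof -
  define T where "T = (\<lambda>i\<in>{0..<n}. y (inv \<tau> i))"
  note inv = permutes_inverses[OF p]
  have pin: "inv \<tau> permutes {0..<n}" using permutes_inv[OF p] .
  have Ti: "T i = y (inv \<tau> i)" if "i < n" for i using that by (simp add: T_def)
  have yT: "y u = T (\<tau> u)" if "u < n" for u using Ti[of "\<tau> u"] permutes_less[OF p that] by (simp add: inv)
  have sp: "T \<in> space (sel_space n)" by (auto simp: sel_space_def space_PiM T_def)
  show ?thesis
  proof (cases "sorted_along n \<tau> y \<and> (\<forall>i<n. 0 \<le> y i \<and> y i < 1)")
    case True
    have box: "0 \<le> T i" "T i < 1" if "i < n" for i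
      using True Ti[OF that] permutes_less[OF pin that] by auto
    have dec: "T j < T i" if "i < j" "j < n" for i j
      using True that Ti[of i] Ti[of j] permutes_less[OF pin, of i] permutes_less[OF pin, of j] by (auto simp: sorted_along_def inv)
    have reg: "T \<in> sel_region n"
      using sp box[of 0] box[of "n - 1"] dec n by (auto simp: sel_region_def)
    have "sel_integrand n (\<lambda>i. m (inv \<tau> i)) (\<lambda>_. 0) (\<lambda>i j. mm (inv \<tau> i) (inv \<tau> j)) T
      = (\<Prod>i<n. \<bar>y (inv \<tau> i)\<bar> powr m (inv \<tau> i)) * (\<Prod>(i, j)\<in>pairs n. \<bar>y (inv \<tau> i) - y (inv \<tau> j)\<bar> powr mm (inv \<tau> i) (inv \<tau> j))"
    proof -
      have 1: "(\<Prod>i<n. T i powr m (inv \<tau> i)) = (\<Prod>i<n. \<bar>y (inv \<tau> i)\<bar> powr m (inv \<tau> i))"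
        using box Ti by (intro prod.cong refl) (auto simp: abs_of_nonneg)
      have 2: "(\<Prod>i<n. (1 - T i) powr 0) = 1"
        using box by (intro prod.neutral) force
      have 3: "(\<Prod>(i, j)\<in>pairs n. (T i - T j) powr mm (inv \<tau> i) (inv \<tau> j))
          = (\<Prod>(i, j)\<in>pairs n. \<bar>y (inv \<tau> i) - y (inv \<tau> j)\<bar> powr mm (inv \<tau> i) (inv \<tau> j))"
      proof (intro prod.cong refl, clarify)
        fix i j assume "(i, j) \<in> pairs n"
        hence ij: "i < j" "j < n" by (auto simp: pairs_def)
        have "T i - T j = \<bar>y (inv \<tau> i) - y (inv \<tau> j)\<bar>" using dec[OF ij] Ti[of i] Ti[of j] ij by simp
        thus "(T i - T j) powr mm (inv \<tau> i) (inv \<tau> j) = \<bar>y (inv \<tau> i) - y (inv \<tau> j)\<bar> powr mm (inv \<tau> i) (inv \<tau> j)" by simp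
      qed
      show ?thesis unfolding sel_integrand_def 1 2 3 by simp
    qed
    also have "(\<Prod>i<n. \<bar>y (inv \<tau> i)\<bar> powr m (inv \<tau> i)) = (\<Prod>i<n. \<bar>y i\<bar> powr m i)"
      unfolding lessThan_atLeast0 by (rule prod.reindex_bij_betw[of _ _ _ "\<lambda>i. \<bar>y i\<bar> powr m i"]) (rule permutes_imp_bij[OF pin])
    also have "(\<Prod>(i, j)\<in>pairs n. \<bar>y (inv \<tau> i) - y (inv \<tau> j)\<bar> powr mm (inv \<tau> i) (inv \<tau> j)) = (\<Prod>(i, j)\<in>pairs n. \<bar>y i - y j\<bar> powr mm i j)"
      using sym by (intro prod_pairs_permute[OF pin, of "\<lambda>i j. \<bar>y i - y j\<bar> powr mm i j"]) (metis abs_minus_commute)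
    finally show ?thesis
      using reg True unfolding T_def[symmetric] cube_weight_expo by (simp add: indicator_def)
  next
    case False
    have l: "indicator (sel_region n) T *\<^sub>R sel_integrand n (\<lambda>i. m (inv \<tau> i)) (\<lambda>_. 0) (\<lambda>i j. mm (inv \<tau> i) (inv \<tau> j)) T = 0"
    proof (cases "T \<in> sel_region n")
      case True
      have "sorted_along n \<tau> y"
        unfolding sorted_along_def using sel_region_decreasing[OF True] yT permutes_less[OF p] by auto
      with False obtain i where i: "i < n" "\<not> (0 \<le> y i \<and> y i < 1)" by auto
      let ?j = "\<tau> i"
      have j: "?j < n" using permutes_less[OF p i(1)] .
      have "T ?j \<le> T 0" using sel_region_decreasing[OF True, of 0 ?j] j by (cases "?j = 0") auto
      moreover have "T (n - 1) \<le> T ?j"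
      proof (cases "?j = n - 1")
        case False
        hence "?j < n - 1" "n - 1 < n" using j by linarith+
        thus ?thesis using sel_region_decreasing[OF True] less_imp_le by blast
      qed simp
      ultimately have "0 \<le> T ?j" "T ?j \<le> 1" using True by (auto simp: sel_region_def)
      \<comment> \<open>The simplex is closed at 1 and the cube is not. The remaining points have a
        coordinate equal to 1, where \<open>(1 - 1) powr 0 = 0\<close> kills the Selberg
        integrand.\<close>
      hence "T ?j = 1" using i yT[OF i(1)] by auto
      hence z: "(\<Prod>i<n. (1 - T i) powr 0) = 0" using j by (intro prod_zero bexI[of _ ?j]) auto
      show ?thesis unfolding sel_integrand_def z by simp
    qed simp
    have r: "(if sorted_along n \<tau> y then 1 else 0) * ((\<Prod>i<n. indicator {0..<1} (y i)) * cube_weight n (expo m mm) y) = 0"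
    proof (cases "sorted_along n \<tau> y")
      case True
      then obtain i where "i < n" "\<not> (0 \<le> y i \<and> y i < 1)" using False by auto
      hence "(\<Prod>i<n. indicator {0..<1} (y i) :: real) = 0" by (intro prod_zero bexI[of _ i]) auto
      thus ?thesis by simp
    qed simp
    show ?thesis unfolding l[unfolded T_def] r ..
  qed
qed

definition perm_phase :: "nat \<Rightarrow> (nat \<Rightarrow> nat \<Rightarrow> real) \<Rightarrow> nat set \<Rightarrow> (nat \<Rightarrow> nat) \<Rightarrow> real" where
  "perm_phase n M E \<tau> = (\<Sum>i<n. \<Sum>j\<in>{i..<n}. M i j * (if \<tau> j < \<tau> i then 1 else if i \<in> E then 2 else 0))"

text \<open>The diagonal terms agree because a nonnegative coordinate is never to the left of its
  node 0, just as \<open>\<tau> i < \<tau> i\<close> is false.\<close>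

lemma phase_eq_perm_phase:
  assumes "\<tau> permutes {0..<n}" "sorted_along n \<tau> y" "\<And>i. i < n \<Longrightarrow> 0 \<le> y i"
  shows "phase n M E y = perm_phase n M E \<tau>"
proof -
  have "y i < node y i j \<longleftrightarrow> \<tau> j < \<tau> i" if "i < n" "j \<in> {i..<n}" for i j
    using sorted_along_iff[OF assms(1,2), of j i] assms(3)[of i] that by (cases "j = i") (auto simp: node_def)
  thus ?thesis unfolding phase_def perm_phase_def by simp
qed

text \<open>The weight is 0 wherever two coordinates coincide, so a point of nonzero weight lies in
  exactly one sector. The weight is thus a finite sum of sector weights, each integrable by the
  convergence of its Selberg integral.\<close>

lemma cube_integral_orderings:
  assumes n: "n \<ge> 1" and sym: "\<And>i j. mm i j = mm j i"
    and conv: "\<And>\<tau>. \<tau> permutes {0..<n} \<Longrightarrow> Sel_converges n (\<lambda>i. m (inv \<tau> i)) (\<lambda>_. 0) (\<lambda>i j. mm (inv \<tau> i) (inv \<tau> j))"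
  shows "integrable (PiM {0..<n} (\<lambda>_. lborel)) (\<lambda>y. (\<Prod>i<n. indicator {0..<1} (y i)) * cube_weight n (expo m mm) y)" (is ?int)
    and "(\<integral>y. complex_of_real ((\<Prod>i<n. indicator {0..<1} (y i)) * cube_weight n (expo m mm) y) * exp (\<i> * pi * phase n (expo m mm) E y) \<partial>PiM {0..<n} (\<lambda>_. lborel))
      = (\<Sum>\<tau>\<in>{\<tau>. \<tau> permutes {0..<n}}. exp (\<i> * pi * perm_phase n (expo m mm) E \<tau>) *
          complex_of_real (Sel n (\<lambda>i. m (inv \<tau> i)) (\<lambda>_. 0) (\<lambda>i j. mm (inv \<tau> i) (inv \<tau> j))))" (is ?eq)
proof -
  let ?L = "PiM {0..<n} (\<lambda>_. lborel) :: (nat \<Rightarrow> real) measure"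
  let ?P = "{\<tau>. \<tau> permutes {0..<n}}"
  define W where "W y = (\<Prod>i<n. indicator {0..<1} (y i)) * cube_weight n (expo m mm) y" for y
  define G where "G \<tau> y = (if sorted_along n \<tau> y then 1 else 0) * W y" for \<tau> y
  have G: "integrable ?L (G \<tau>)" "(\<integral>y. G \<tau> y \<partial>?L) = Sel n (\<lambda>i. m (inv \<tau> i)) (\<lambda>_. 0) (\<lambda>i j. mm (inv \<tau> i) (inv \<tau> j))"
    if t: "\<tau> \<in> ?P" for \<tau>
  proof -
    have p: "\<tau> permutes {0..<n}" using t by simp
    let ?T = "\<lambda>y. \<lambda>i\<in>{0..<n}. y (inv \<tau> i)"
    let ?S = "\<lambda>z. indicator (sel_region n) z *\<^sub>R sel_integrand n (\<lambda>i. m (inv \<tau> i)) (\<lambda>_. 0) (\<lambda>i j. mm (inv \<tau> i) (inv \<tau> j)) z"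
    have S: "integrable ?L ?S"
      using conv[OF p] by (simp add: Sel_converges_def set_integrable_def sel_space_def)
    have T: "?T \<in> measurable ?L ?L"
      using permutes_less[OF permutes_inv[OF p]] by (intro measurable_restrict) (simp add: measurable_coord)
    have GS: "G \<tau> = (\<lambda>y. ?S (?T y))"
      unfolding G_def W_def by (intro ext sel_integrand_permuted[where mm=mm, symmetric] n sym p)
    have d: "distr ?L ?L ?T = ?L" by (rule distr_PiM_permute[OF permutes_inv[OF p]])
    show "integrable ?L (G \<tau>)"
      unfolding GS using S by (intro integrable_distr[OF T]) (simp only: d)
    have "(\<integral>y. ?S (?T y) \<partial>?L) = (\<integral>z. ?S z \<partial>distr ?L ?L ?T)"
      using S by (intro integral_distr[symmetric, OF T]) auto
    thus "(\<integral>y. G \<tau> y \<partial>?L) = Sel n (\<lambda>i. m (inv \<tau> i)) (\<lambda>_. 0) (\<lambda>i j. mm (inv \<tau> i) (inv \<tau> j))"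
      unfolding GS d Sel_def set_lebesgue_integral_def sel_space_def .
  qed
  have dist: "inj_on y {..<n}" "\<And>i. i < n \<Longrightarrow> 0 \<le> y i" if "W y \<noteq> 0" for y
  proof -
    have nz: "(\<Prod>(i, j)\<in>pairs n. \<bar>y i - y j\<bar> powr mm i j) \<noteq> 0" "(\<Prod>i<n. indicator {0..<1} (y i) :: real) \<noteq> 0"
      using that unfolding W_def cube_weight_expo by auto
    have ne: "y i \<noteq> y j" if "i < j" "j < n" for i j
    proof -
      have "(case (i, j) of (i, j) \<Rightarrow> \<bar>y i - y j\<bar> powr mm i j) \<noteq> 0"
        using nz(1) that finite_pairs[of n] by (auto simp: prod_zero_iff pairs_def)
      thus ?thesis by auto
    qed
    thus "inj_on y {..<n}" by (intro linorder_inj_onI') auto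
    show "0 \<le> y i" if "i < n" for i
      using nz(2) that by (auto simp: prod_zero_iff indicator_def split: if_splits)
  qed
  have "W y = (\<Sum>\<tau>\<in>?P. G \<tau> y)" for y
  proof (cases "W y = 0")
    case False
    obtain t where t: "t permutes {0..<n}" "sorted_along n t y" using ex1_sorted_along[OF dist(1)[OF False]] by blast
    have "(\<Sum>\<tau>\<in>?P. G \<tau> y) = (\<Sum>\<tau>\<in>?P. if sorted_along n \<tau> y then W y else 0)"
      unfolding G_def by (intro sum.cong) auto
    thus ?thesis using sum_sorted_along[OF dist(1)[OF False] t, of "\<lambda>_. W y"] by simp
  qed (simp add: G_def)
  hence WG: "W = (\<lambda>y. \<Sum>\<tau>\<in>?P. G \<tau> y)" by blast
  have "integrable ?L W" unfolding WG by (intro Bochner_Integration.integrable_sum G(1))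
  thus ?int unfolding W_def .
  have "complex_of_real (W y) * exp (\<i> * pi * phase n (expo m mm) E y)
     = (\<Sum>\<tau>\<in>?P. exp (\<i> * pi * perm_phase n (expo m mm) E \<tau>) * complex_of_real (G \<tau> y))" for y
  proof (cases "W y = 0")
    case False
    obtain t where t: "t permutes {0..<n}" "sorted_along n t y" using ex1_sorted_along[OF dist(1)[OF False]] by blast
    have "(\<Sum>\<tau>\<in>?P. exp (\<i> * pi * perm_phase n (expo m mm) E \<tau>) * complex_of_real (G \<tau> y))
       = (\<Sum>\<tau>\<in>?P. if sorted_along n \<tau> y then exp (\<i> * pi * perm_phase n (expo m mm) E \<tau>) * complex_of_real (W y) else 0)"
      unfolding G_def by (intro sum.cong) auto
    also have "\<dots> = exp (\<i> * pi * perm_phase n (expo m mm) E t) * complex_of_real (W y)"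
      by (rule sum_sorted_along[OF dist(1)[OF False] t])
    finally show ?thesis using phase_eq_perm_phase[OF t dist(2)[OF False]] by simp
  qed (simp add: G_def)
  hence "(\<integral>y. complex_of_real (W y) * exp (\<i> * pi * phase n (expo m mm) E y) \<partial>?L)
     = (\<integral>y. (\<Sum>\<tau>\<in>?P. exp (\<i> * pi * perm_phase n (expo m mm) E \<tau>) * complex_of_real (G \<tau> y)) \<partial>?L)"
    by simp
  also have "\<dots> = (\<Sum>\<tau>\<in>?P. \<integral>y. exp (\<i> * pi * perm_phase n (expo m mm) E \<tau>) * complex_of_real (G \<tau> y) \<partial>?L)"
    using G(1) by (intro Bochner_Integration.integral_sum integrable_mult_right integrable_of_real)
  also have "\<dots> = (\<Sum>\<tau>\<in>?P. exp (\<i> * pi * perm_phase n (expo m mm) E \<tau>) *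
          complex_of_real (Sel n (\<lambda>i. m (inv \<tau> i)) (\<lambda>_. 0) (\<lambda>i j. mm (inv \<tau> i) (inv \<tau> j))))"
    by (intro sum.cong refl) (simp only: integral_mult_right_zero integral_complex_of_real G(2))
  finally show ?eq unfolding W_def .
qed

section \<open>Signed orderings and shuffles\<close>

definition order_rank :: "(nat \<Rightarrow> nat) \<Rightarrow> nat set \<Rightarrow> nat \<Rightarrow> nat" where
  "order_rank \<tau> A v = card {u \<in> A. \<tau> u < \<tau> v}"

lemma order_rank_mono:
  assumes "finite A" "u \<in> A" "\<tau> u < \<tau> v"
  shows "order_rank \<tau> A u < order_rank \<tau> A v"
proof -
  have "{w \<in> A. \<tau> w < \<tau> u} \<subset> {w \<in> A. \<tau> w < \<tau> v}" using assms by force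
  thus ?thesis unfolding order_rank_def using assms(1) by (intro psubset_card_mono) auto
qed

lemma order_rank_less_card:
  assumes "finite A" "v \<in> A"
  shows "order_rank \<tau> A v < card A"
  unfolding order_rank_def using assms by (intro psubset_card_mono) auto

text \<open>The inverse of the map \<open>(\<sigma>, k, \<eta>) \<mapsto> (E, \<tau>)\<close>, \<open>E = {v. \<sigma> v \<ge> k}\<close> and \<open>\<tau> = \<eta> \<circ> \<sigma>\<close>:
  the elements outside \<open>E\<close> come first, in increasing order of \<open>\<tau>\<close>, followed by those of \<open>E\<close> in
  decreasing order of \<open>\<tau>\<close>.\<close>

definition shuffle_sort :: "nat \<Rightarrow> nat set \<Rightarrow> (nat \<Rightarrow> nat) \<Rightarrow> nat \<Rightarrow> nat" where
  "shuffle_sort n E \<tau> v = (if v < n then if v \<in> E then n - 1 - order_rank \<tau> E v else order_rank \<tau> ({..<n} - E) v else v)"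

context
  fixes n :: nat and E :: "nat set" and \<tau> :: "nat \<Rightarrow> nat"
  assumes E: "E \<subseteq> {..<n}" and t: "\<tau> permutes {0..<n}"
begin

lemma card_complement_facts: "finite E" "card E \<le> n" "card ({..<n} - E) = n - card E"
  using E finite_subset[OF E] card_mono[of "{..<n}" E] by (auto simp: card_Diff_subset)

lemma shuffle_sort_range:
  assumes "v < n"
  shows "v \<in> E \<Longrightarrow> n - card E \<le> shuffle_sort n E \<tau> v \<and> shuffle_sort n E \<tau> v < n"
    and "v \<notin> E \<Longrightarrow> shuffle_sort n E \<tau> v < n - card E"
  using order_rank_less_card[of E v \<tau>] order_rank_less_card[of "{..<n} - E" v \<tau>] card_complement_facts assms
  by (auto simp: shuffle_sort_def)

lemma permutes_neq: "u \<noteq> v \<Longrightarrow> \<tau> u \<noteq> \<tau> v"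
  using injD[OF permutes_inj[OF t]] by blast

lemma shuffle_sort_less_outside:
  assumes "u < n" "v < n" "u \<notin> E" "v \<notin> E"
  shows "shuffle_sort n E \<tau> u < shuffle_sort n E \<tau> v \<longleftrightarrow> \<tau> u < \<tau> v"
proof -
  have "\<tau> u < \<tau> v \<Longrightarrow> shuffle_sort n E \<tau> u < shuffle_sort n E \<tau> v" if "u < n" "v < n" "u \<notin> E" "v \<notin> E" for u v
    using order_rank_mono[of "{..<n} - E" u \<tau> v] that by (simp add: shuffle_sort_def)
  from this[of u v] this[of v u] assms permutes_neq[of u v] show ?thesis
    by (cases rule: linorder_cases[of "\<tau> u" "\<tau> v"]) auto
qed

lemma shuffle_sort_less_inside:
  assumes "u < n" "v < n" "u \<in> E" "v \<in> E"
  shows "shuffle_sort n E \<tau> u < shuffle_sort n E \<tau> v \<longleftrightarrow> \<tau> v < \<tau> u"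
proof -
  have "\<tau> v < \<tau> u \<Longrightarrow> shuffle_sort n E \<tau> u < shuffle_sort n E \<tau> v" if "u < n" "v < n" "u \<in> E" "v \<in> E" for u v
    using order_rank_mono[of E v \<tau> u] order_rank_less_card[of E u \<tau>] card_complement_facts that by (simp add: shuffle_sort_def)
  from this[of u v] this[of v u] assms permutes_neq[of u v] show ?thesis
    by (cases rule: linorder_cases[of "\<tau> u" "\<tau> v"]) auto
qed

lemma shuffle_sort_permutes: "shuffle_sort n E \<tau> permutes {0..<n}"
proof -
  let ?s = "shuffle_sort n E \<tau>"
  have inj: "inj_on ?s {0..<n}"
  proof (rule inj_onI, rule ccontr)
    fix u v assume uv: "u \<in> {0..<n}" "v \<in> {0..<n}" "?s u = ?s v" "u \<noteq> v"
    consider "u \<in> E" "v \<in> E" | "u \<in> E" "v \<notin> E" | "u \<notin> E" "v \<in> E" | "u \<notin> E" "v \<notin> E" by blast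
    thus False
    proof cases
      case 1 thus ?thesis using shuffle_sort_less_inside[of u v] shuffle_sort_less_inside[of v u] uv permutes_neq[of u v] by auto
    next
      case 2 thus ?thesis using shuffle_sort_range(1)[of u] shuffle_sort_range(2)[of v] uv by auto
    next
      case 3 thus ?thesis using shuffle_sort_range(2)[of u] shuffle_sort_range(1)[of v] uv by auto
    next
      case 4 thus ?thesis using shuffle_sort_less_outside[of u v] shuffle_sort_less_outside[of v u] uv permutes_neq[of u v] by auto
    qed
  qed
  have "?s ` {0..<n} \<subseteq> {0..<n}" using shuffle_sort_range by force
  hence "bij_betw ?s {0..<n} {0..<n}" using inj by (simp add: bij_betw_def endo_inj_surj)
  thus ?thesis by (rule bij_imp_permutes) (simp add: shuffle_sort_def)
qed

lemma shuffle_sort_upper: "{v. v < n \<and> n - card E \<le> shuffle_sort n E \<tau> v} = E"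
  using shuffle_sort_range E by (auto simp: not_le subset_iff) (metis not_le)

lemma shuffle_sort_shuffle: "\<tau> \<circ> inv (shuffle_sort n E \<tau>) \<in> S_shuffle n (n - card E)"
proof -
  let ?s = "shuffle_sort n E \<tau>"
  note p = shuffle_sort_permutes
  have inv: "?s (inv ?s i) = i" for i using permutes_inverses(1)[OF p] .
  have less: "inv ?s i < n" if "i < n" for i using permutes_less[OF permutes_inv[OF p] that] .
  have out: "inv ?s i \<notin> E" if "i < n - card E" for i
    using shuffle_sort_range(1)[of "inv ?s i"] less[of i] that by (auto simp: inv)
  have ins: "inv ?s i \<in> E" if "n - card E \<le> i" "i < n" for i
    using shuffle_sort_range(2)[of "inv ?s i"] less[of i] that by (auto simp: inv)
  show ?thesis
    unfolding S_shuffle_def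
  proof (intro CollectI conjI allI impI)
    show "\<tau> \<circ> inv ?s permutes {0..<n}" using permutes_compose[OF permutes_inv[OF p] t] .
    fix i j
    show "(\<tau> \<circ> inv ?s) i < (\<tau> \<circ> inv ?s) j" if "i < j \<and> j < n - card E"
    proof -
      have "i < n" "j < n" using that by linarith+
      thus ?thesis
        using shuffle_sort_less_outside[of "inv ?s i" "inv ?s j"] out[of i] out[of j] less[of i] less[of j] that by (simp add: inv)
    qed
    show "(\<tau> \<circ> inv ?s) j < (\<tau> \<circ> inv ?s) i" if "n - card E \<le> i \<and> i < j \<and> j < n"
      using shuffle_sort_less_inside[of "inv ?s i" "inv ?s j"] ins[of i] ins[of j] less[of i] less[of j] that by (simp add: inv)
  qed
qed

end

context
  fixes n k :: nat and \<sigma> \<eta> :: "nat \<Rightarrow> nat"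
  assumes s: "\<sigma> permutes {0..<n}" and k: "k \<le> n" and h: "\<eta> \<in> S_shuffle n k"
begin

lemma shuffle_permutes: "\<eta> permutes {0..<n}"
  using h by (simp add: S_shuffle_def)

lemma shuffle_less_lower: "i < k \<Longrightarrow> j < k \<Longrightarrow> \<eta> i < \<eta> j \<longleftrightarrow> i < j"
  using h unfolding S_shuffle_def by (cases i j rule: linorder_cases) (auto dest: less_asym)

lemma shuffle_less_upper: "k \<le> i \<Longrightarrow> i < n \<Longrightarrow> k \<le> j \<Longrightarrow> j < n \<Longrightarrow> \<eta> i < \<eta> j \<longleftrightarrow> j < i"
  using h unfolding S_shuffle_def by (cases i j rule: linorder_cases) (auto dest: less_asym)

lemma card_upper: "card {v. v < n \<and> k \<le> \<sigma> v} = n - k"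
proof -
  have "\<sigma> ` {v. v < n \<and> k \<le> \<sigma> v} = {k..<n}"
  proof
    show "\<sigma> ` {v. v < n \<and> k \<le> \<sigma> v} \<subseteq> {k..<n}" using permutes_less[OF s] by auto
    show "{k..<n} \<subseteq> \<sigma> ` {v. v < n \<and> k \<le> \<sigma> v}"
    proof
      fix i assume "i \<in> {k..<n}"
      thus "i \<in> \<sigma> ` {v. v < n \<and> k \<le> \<sigma> v}"
        using permutes_less[OF permutes_inv[OF s], of i] permutes_inverses(1)[OF s, of i]
        by (intro image_eqI[of _ _ "inv \<sigma> i"]) auto
    qed
  qed
  moreover have "inj_on \<sigma> {v. v < n \<and> k \<le> \<sigma> v}" using permutes_inj_on[OF s] .
  ultimately show ?thesis using card_image by fastforce
qed

text \<open>On the lower block \<open>\<eta>\<close> keeps the order, so ranks under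
  \<open>\<eta> \<circ> \<sigma>\<close> count smaller values of \<open>\<sigma>\<close>. On the
  upper block it reverses the order; ranks then count the \<open>n - Suc (\<sigma> v)\<close> larger
  values, which \<open>n - 1 - _\<close> turns back into \<open>\<sigma> v\<close>.\<close>

lemma shuffle_sort_unique: "shuffle_sort n {v. v < n \<and> k \<le> \<sigma> v} (\<eta> \<circ> \<sigma>) = \<sigma>"
proof
  fix v
  let ?E = "{v. v < n \<and> k \<le> \<sigma> v}"
  show "shuffle_sort n ?E (\<eta> \<circ> \<sigma>) v = \<sigma> v"
  proof (cases "v < n")
    case v: True
    show ?thesis
    proof (cases "k \<le> \<sigma> v")
      case True
      have "{u \<in> ?E. (\<eta> \<circ> \<sigma>) u < (\<eta> \<circ> \<sigma>) v} = {u. u < n \<and> \<sigma> v < \<sigma> u}"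
        using shuffle_less_upper permutes_less[OF s] v True by auto
      also have "\<dots> = {..<n} - insert v {u. u < n \<and> \<sigma> u < \<sigma> v}"
        using injD[OF permutes_inj[OF s]] by (auto simp: not_less le_less)
      finally have "order_rank (\<eta> \<circ> \<sigma>) ?E v = card ({..<n} - insert v {u. u < n \<and> \<sigma> u < \<sigma> v})" by (simp add: order_rank_def)
      also have "\<dots> = n - card (insert v {u. u < n \<and> \<sigma> u < \<sigma> v})"
        using v by (subst card_Diff_subset) auto
      also have "card (insert v {u. u < n \<and> \<sigma> u < \<sigma> v}) = Suc (\<sigma> v)"
        using card_perm_less[OF s v] by (subst card_insert_disjoint) auto
      finally have r: "order_rank (\<eta> \<circ> \<sigma>) ?E v = n - Suc (\<sigma> v)" .
      show ?thesis unfolding shuffle_sort_def r using True v permutes_less[OF s v] by simp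
    next
      case False
      have "{u \<in> {..<n} - ?E. (\<eta> \<circ> \<sigma>) u < (\<eta> \<circ> \<sigma>) v} = {u. u < n \<and> \<sigma> u < \<sigma> v}"
        using shuffle_less_lower False by auto
      thus ?thesis using False v card_perm_less[OF s v] by (simp add: shuffle_sort_def order_rank_def)
    qed
  next
    case False thus ?thesis using permutes_not_in[OF s, of v] by (simp add: shuffle_sort_def)
  qed
qed

text \<open>For each pair the multiplicity 0, 1 or 2 of pi is the sum of two bits: whether
  \<open>\<sigma>\<close> inverts the pair, and whether \<open>\<eta>\<close> inverts its image. The
  diagonal terms give the factors with 2 pi for the variables in the upper block.\<close>

lemma perm_phase_factorization:
  assumes sym: "\<And>i j. mm i j = mm j i"
  shows "exp (\<i> * pi * perm_phase n (expo m mm) {v. v < n \<and> k \<le> \<sigma> v} (\<eta> \<circ> \<sigma>)) =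
     (\<Prod>(i, j)\<in>inversions n \<sigma>. exp (pi * \<i> * complex_of_real (mm i j))) *
     (\<Prod>i\<in>{k..<n}. exp (2 * pi * \<i> * complex_of_real (m (inv \<sigma> i)))) *
     (\<Prod>(i, j)\<in>{(i, j)\<in>pairs n. \<eta> i > \<eta> j}. exp (pi * \<i> * complex_of_real (mm (inv \<sigma> i) (inv \<sigma> j))))"
proof -
  let ?E = "{v. v < n \<and> k \<le> \<sigma> v}" and ?t = "\<eta> \<circ> \<sigma>"
  note inv = permutes_inverses[OF s]
  let ?e = "\<lambda>u v. exp (pi * \<i> * complex_of_real (mm u v))"
  let ?c = "\<lambda>u v. if ?t v < ?t u then 1 else if u \<in> ?E then 2 else 0 :: real"
  have split: "{i..<n} = insert i {i<..<n}" if "i < n" for i using that by auto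
  have "perm_phase n (expo m mm) ?E ?t = (\<Sum>i<n. m i * (if i \<in> ?E then 2 else 0)) + (\<Sum>i<n. \<Sum>j\<in>{i<..<n}. mm i j * ?c i j)"
    unfolding perm_phase_def sum.distrib[symmetric]
  proof (rule sum.cong[OF refl])
    fix i assume "i \<in> {..<n}"
    thus "(\<Sum>j\<in>{i..<n}. expo m mm i j * ?c i j) = m i * (if i \<in> ?E then 2 else 0) + (\<Sum>j\<in>{i<..<n}. mm i j * ?c i j)"
      by (subst split) (auto simp: expo_def)
  qed
  hence "exp (\<i> * pi * perm_phase n (expo m mm) ?E ?t) =
     exp (\<Sum>i<n. \<i> * pi * complex_of_real (m i * (if i \<in> ?E then 2 else 0))) * exp (\<Sum>i<n. \<Sum>j\<in>{i<..<n}. \<i> * pi * complex_of_real (mm i j * ?c i j))"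
    by (simp only: of_real_add of_real_sum distrib_left exp_add sum_distrib_left)
  also have "exp (\<Sum>i<n. \<i> * pi * complex_of_real (m i * (if i \<in> ?E then 2 else 0))) = (\<Prod>i\<in>{k..<n}. exp (2 * pi * \<i> * complex_of_real (m (inv \<sigma> i))))"
  proof -
    have "exp (\<Sum>i<n. \<i> * pi * complex_of_real (m i * (if i \<in> ?E then 2 else 0))) = (\<Prod>i<n. if i \<in> ?E then exp (2 * pi * \<i> * complex_of_real (m i)) else 1)"
      unfolding exp_sum[OF finite_lessThan] by (intro prod.cong refl) (auto simp: mult_ac)
    also have "\<dots> = (\<Prod>i\<in>?E. exp (2 * pi * \<i> * complex_of_real (m i)))"
      by (subst prod.inter_restrict[symmetric]) (auto intro!: prod.cong)
    also have "\<dots> = (\<Prod>i\<in>{k..<n}. exp (2 * pi * \<i> * complex_of_real (m (inv \<sigma> i))))"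
      by (rule prod.reindex_bij_witness[of _ "inv \<sigma>" \<sigma>])
         (use permutes_less[OF s] permutes_less[OF permutes_inv[OF s]] in \<open>auto simp: inv\<close>)
    finally show ?thesis .
  qed
  also have "exp (\<Sum>i<n. \<Sum>j\<in>{i<..<n}. \<i> * pi * complex_of_real (mm i j * ?c i j)) =
      (\<Prod>(i, j)\<in>pairs n. exp (\<i> * pi * complex_of_real (mm i j * ?c i j)))"
    unfolding prod_pairs by (simp only: exp_sum finite_lessThan finite_greaterThanLessThan)
  also have "\<dots> = (\<Prod>(i, j)\<in>pairs n. (if \<sigma> j < \<sigma> i then ?e i j else 1) * (if (\<sigma> i < \<sigma> j) \<noteq> (?t i < ?t j) then ?e i j else 1))"
  proof (intro prod.cong refl, clarify)
    fix u v assume "(u, v) \<in> pairs n"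
    hence uv: "u < v" "v < n" "u < n" by (auto simp: pairs_def)
    have ne: "\<sigma> u \<noteq> \<sigma> v" "?t u \<noteq> ?t v"
      using uv injD[OF permutes_inj[OF s], of u v] injD[OF permutes_inj[OF permutes_compose[OF s shuffle_permutes]], of u v] by auto
    have lt: "\<sigma> u < n" "\<sigma> v < n" using permutes_less[OF s] uv by auto
    \<comment> \<open>Within the lower block \<open>\<eta>\<close> inverts nothing, within the upper
      block everything. In the mixed cases the blocks decide the first bit and the order under
      \<open>\<eta> \<circ> \<sigma>\<close> the second.\<close>
    have c: "?c u v = (if \<sigma> v < \<sigma> u then 1 else 0) + (if (\<sigma> u < \<sigma> v) \<noteq> (?t u < ?t v) then 1 else 0)"
    proof (cases "k \<le> \<sigma> u"; cases "k \<le> \<sigma> v")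
      assume *: "k \<le> \<sigma> u" "k \<le> \<sigma> v"
      show ?thesis using * uv ne lt shuffle_less_upper[of "\<sigma> u" "\<sigma> v"] shuffle_less_upper[of "\<sigma> v" "\<sigma> u"] by auto
    next
      assume *: "k \<le> \<sigma> u" "\<not> k \<le> \<sigma> v"
      hence "\<sigma> v < \<sigma> u" by simp
      thus ?thesis using * uv ne by auto
    next
      assume *: "\<not> k \<le> \<sigma> u" "k \<le> \<sigma> v"
      hence "\<sigma> u < \<sigma> v" by simp
      thus ?thesis using * uv ne by auto
    next
      assume *: "\<not> k \<le> \<sigma> u" "\<not> k \<le> \<sigma> v"
      show ?thesis using * uv ne shuffle_less_lower[of "\<sigma> u" "\<sigma> v"] shuffle_less_lower[of "\<sigma> v" "\<sigma> u"] by auto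
    qed
    have e: "exp (\<i> * pi * complex_of_real (mm u v * (a + b))) = exp (pi * \<i> * complex_of_real (mm u v * a)) * exp (pi * \<i> * complex_of_real (mm u v * b))" for a b :: real
      by (simp add: distrib_left mult_ac flip: exp_add)
    show "exp (\<i> * pi * complex_of_real (mm u v * ?c u v)) =
       (if \<sigma> v < \<sigma> u then ?e u v else 1) * (if (\<sigma> u < \<sigma> v) \<noteq> (?t u < ?t v) then ?e u v else 1)"
      unfolding c e by (intro arg_cong2[where f="(*)"]) (simp_all split: if_split)
  qed
  also have "\<dots> = (\<Prod>(i, j)\<in>pairs n. if \<sigma> j < \<sigma> i then ?e i j else 1) * (\<Prod>(i, j)\<in>pairs n. if (\<sigma> i < \<sigma> j) \<noteq> (?t i < ?t j) then ?e i j else 1)"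
    by (rule prod_case_prod_mult)
  also have "(\<Prod>(i, j)\<in>pairs n. if \<sigma> j < \<sigma> i then ?e i j else 1) = (\<Prod>(i, j)\<in>inversions n \<sigma>. ?e i j)"
    unfolding inversions_def by (rule prod.mono_neutral_cong_right[OF finite_pairs]) (auto split: if_splits)
  also have "(\<Prod>(i, j)\<in>pairs n. if (\<sigma> i < \<sigma> j) \<noteq> (?t i < ?t j) then ?e i j else 1)
     = (\<Prod>(i, j)\<in>pairs n. if (i < j) \<noteq> (\<eta> i < \<eta> j) then ?e (inv \<sigma> i) (inv \<sigma> j) else 1)"
  proof -
    \<comment> \<open>Being inverted by \<open>\<eta>\<close>, written as a disagreement of two
      comparisons, is symmetric in \<open>i\<close> and \<open>j\<close>; the product over pairs can
      therefore be reindexed by \<open>\<sigma>\<close>.\<close>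
    let ?f = "\<lambda>i j. if (i < j) \<noteq> (\<eta> i < \<eta> j) then ?e (inv \<sigma> i) (inv \<sigma> j) else 1"
    have fs: "?f i j = ?f j i" if "i \<noteq> j" for i j
      using that injD[OF permutes_inj[OF shuffle_permutes], of i j] sym[of "inv \<sigma> i" "inv \<sigma> j"] by (auto simp: not_less_iff_gr_or_eq)
    have "(\<Prod>(i, j)\<in>pairs n. ?f (\<sigma> i) (\<sigma> j)) = (\<Prod>(i, j)\<in>pairs n. ?f i j)"
      by (rule prod_pairs_permute[OF s fs])
    thus ?thesis by (simp only: inv o_apply)
  qed
  also have "\<dots> = (\<Prod>(i, j)\<in>{(i, j)\<in>pairs n. \<eta> i > \<eta> j}. ?e (inv \<sigma> i) (inv \<sigma> j))"
  proof (rule prod.mono_neutral_cong_right[OF finite_pairs])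
    show "\<forall>x\<in>pairs n - {(i, j)\<in>pairs n. \<eta> i > \<eta> j}. (case x of (i, j) \<Rightarrow> if (i < j) \<noteq> (\<eta> i < \<eta> j) then ?e (inv \<sigma> i) (inv \<sigma> j) else 1) = 1"
    proof
      fix x assume "x \<in> pairs n - {(i, j)\<in>pairs n. \<eta> i > \<eta> j}"
      then obtain i j where x: "x = (i, j)" and "(i, j) \<in> pairs n" "\<not> \<eta> j < \<eta> i" by auto
      moreover from this have "\<eta> i \<noteq> \<eta> j"
        using injD[OF permutes_inj[OF shuffle_permutes], of i j] by (auto simp: pairs_def)
      ultimately have "i < j" "\<eta> i < \<eta> j" by (auto simp: pairs_def)
      thus "(case x of (i, j) \<Rightarrow> if (i < j) \<noteq> (\<eta> i < \<eta> j) then ?e (inv \<sigma> i) (inv \<sigma> j) else 1) = 1"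
        by (simp add: x)
    qed
  qed (auto simp: pairs_def)
  finally show ?thesis by (simp only: mult_ac)
qed

end


theorem theorem5p11:
  fixes n :: nat and m :: "nat \<Rightarrow> real" and mm :: "nat \<Rightarrow> nat \<Rightarrow> real"
    and q :: "(nat \<Rightarrow> nat) \<Rightarrow> complex"
  assumes "n \<ge> 1"
    and "\<And>i j. mm i j = mm j i"
    and "F_minus_converges n m mm"
    and "\<And>\<sigma> k \<eta>. \<sigma> permutes {0..<n} \<Longrightarrow> k \<le> n \<Longrightarrow> \<eta> \<in> S_shuffle n k \<Longrightarrow>
           Sel_converges n (\<lambda>i. m (inv \<sigma> (inv \<eta> i))) (\<lambda>_. 0)
             (\<lambda>i j. mm (inv \<sigma> (inv \<eta> i)) (inv \<sigma> (inv \<eta> j)))"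
    and "is_braiding_factor n mm q"
  shows "F_minus n m mm =
    (\<Sum>\<sigma>\<in>{\<sigma>. \<sigma> permutes {0..<n}}. q \<sigma> * F_tilde n (\<lambda>i. m (inv \<sigma> i)) (\<lambda>i j. mm (inv \<sigma> i) (inv \<sigma> j)))"
proof -
  let ?P = "{\<sigma>. \<sigma> permutes {0..<n}}"
  define SEL where "SEL \<tau> = complex_of_real (Sel n (\<lambda>i. m (inv \<tau> i)) (\<lambda>_. 0) (\<lambda>i j. mm (inv \<tau> i) (inv \<tau> j)))" for \<tau>
  define Y where "Y = (\<lambda>(E, \<tau>). (-1) ^ card ({..<n} - E) * (exp (\<i> * pi * perm_phase n (expo m mm) E \<tau>) * SEL \<tau>))"
  define X where "X = (\<lambda>(\<sigma>, k, \<eta>). q \<sigma> * ((-1) ^ k * (\<Prod>i\<in>{k..<n}. exp (2 * pi * \<i> * complex_of_real (m (inv \<sigma> i)))) *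
     ((\<Prod>(i, j)\<in>{(i, j)\<in>pairs n. \<eta> i > \<eta> j}. exp (pi * \<i> * complex_of_real (mm (inv \<sigma> i) (inv \<sigma> j)))) * SEL (\<eta> \<circ> \<sigma>))))"
  have finP: "finite ?P" by (rule finite_permutations) simp
  have finS: "finite (S_shuffle n k)" for k
    by (rule finite_subset[OF _ finP]) (auto simp: S_shuffle_def)
  \<comment> \<open>With \<open>k = n\<close> and \<open>\<eta> = id\<close> the convergence
    hypothesis covers the Selberg integral of every ordering.\<close>
  have idS: "id \<in> S_shuffle n n" by (auto simp: S_shuffle_def permutes_id)
  have conv: "Sel_converges n (\<lambda>i. m (inv \<tau> i)) (\<lambda>_. 0) (\<lambda>i j. mm (inv \<tau> i) (inv \<tau> j))" if "\<tau> permutes {0..<n}" for \<tau>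
    using assms(4)[OF that order_refl idS] by simp
  have "(2 * pi * \<i>) ^ n * F_minus n m mm = (\<Sum>E\<in>Pow {..<n}. (-1) ^ card ({..<n} - E) * (\<Sum>\<tau>\<in>?P. exp (\<i> * pi * perm_phase n (expo m mm) E \<tau>) * SEL \<tau>))"
    unfolding SEL_def
    using F_minus_eq_sum_cube_integrals[OF assms(3) cube_integral_orderings(1)[OF assms(1,2) conv]]
      cube_integral_orderings(2)[OF assms(1,2) conv] by simp
  also have "\<dots> = (\<Sum>b\<in>Pow {..<n} \<times> ?P. Y b)"
    unfolding Y_def by (simp add: sum_distrib_left sum.cartesian_product)
  also have "\<dots> = (\<Sum>a\<in>?P \<times> (SIGMA k:{0..n}. S_shuffle n k). X a)"
  \<comment> \<open>Both index sets have \<open>2 ^ n * fact n\<close> elements, since the shuffles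
    for fixed \<open>k\<close> number \<open>n choose k\<close>. The sign matches because exactly
    \<open>k\<close> variables lie outside \<open>E\<close>.\<close>
  proof (rule sum.reindex_bij_witness[symmetric,
        of _ "\<lambda>(E, \<tau>). (shuffle_sort n E \<tau>, n - card E, \<tau> \<circ> inv (shuffle_sort n E \<tau>))" "\<lambda>(\<sigma>, k, \<eta>). ({v. v < n \<and> k \<le> \<sigma> v}, \<eta> \<circ> \<sigma>)"])
    fix a assume "a \<in> ?P \<times> (SIGMA k:{0..n}. S_shuffle n k)"
    then obtain \<sigma> k \<eta> where a: "a = (\<sigma>, k, \<eta>)" and s: "\<sigma> permutes {0..<n}" and k: "k \<le> n" and h: "\<eta> \<in> S_shuffle n k"
      by auto
    let ?E = "{v. v < n \<and> k \<le> \<sigma> v}"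
    have hp: "\<eta> permutes {0..<n}" using h by (simp add: S_shuffle_def)
    have u: "shuffle_sort n ?E (\<eta> \<circ> \<sigma>) = \<sigma>" by (rule shuffle_sort_unique[OF s k h])
    have c: "card ?E = n - k" by (rule card_upper[OF s k h])
    have "\<eta> \<circ> \<sigma> \<circ> inv \<sigma> = \<eta>" using permutes_inverses(1)[OF s] by (simp add: fun_eq_iff)
    thus "(\<lambda>(E, \<tau>). (shuffle_sort n E \<tau>, n - card E, \<tau> \<circ> inv (shuffle_sort n E \<tau>))) ((\<lambda>(\<sigma>, k, \<eta>). ({v. v < n \<and> k \<le> \<sigma> v}, \<eta> \<circ> \<sigma>)) a) = a"
      unfolding a prod.case u c using k by simp
    show "(\<lambda>(\<sigma>, k, \<eta>). ({v. v < n \<and> k \<le> \<sigma> v}, \<eta> \<circ> \<sigma>)) a \<in> Pow {..<n} \<times> ?P"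
      unfolding a prod.case using permutes_compose[OF s hp] by auto
    have "card ({..<n} - ?E) = k"
      using c k by (subst card_Diff_subset) auto
    thus "Y ((\<lambda>(\<sigma>, k, \<eta>). ({v. v < n \<and> k \<le> \<sigma> v}, \<eta> \<circ> \<sigma>)) a) = X a"
      unfolding a prod.case Y_def X_def perm_phase_factorization[OF s k h assms(2)]
        braiding_factor_eq_prod_inversions[OF assms(5,2) s] by (simp only: mult_ac)
  next
    fix b assume "b \<in> Pow {..<n} \<times> ?P"
    then obtain E \<tau> where b: "b = (E, \<tau>)" and E: "E \<subseteq> {..<n}" and t: "\<tau> permutes {0..<n}" by auto
    note p = shuffle_sort_permutes[OF E t]
    have "\<tau> \<circ> inv (shuffle_sort n E \<tau>) \<circ> shuffle_sort n E \<tau> = \<tau>"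
      using permutes_inverses(2)[OF p] by (simp add: fun_eq_iff)
    thus "(\<lambda>(\<sigma>, k, \<eta>). ({v. v < n \<and> k \<le> \<sigma> v}, \<eta> \<circ> \<sigma>)) ((\<lambda>(E, \<tau>). (shuffle_sort n E \<tau>, n - card E, \<tau> \<circ> inv (shuffle_sort n E \<tau>))) b) = b"
      unfolding b prod.case shuffle_sort_upper[OF E t] by simp
    show "(\<lambda>(E, \<tau>). (shuffle_sort n E \<tau>, n - card E, \<tau> \<circ> inv (shuffle_sort n E \<tau>))) b \<in> ?P \<times> (SIGMA k:{0..n}. S_shuffle n k)"
      unfolding b prod.case using p shuffle_sort_shuffle[OF E t] by auto
  qed
  also have "\<dots> = (\<Sum>\<sigma>\<in>?P. \<Sum>k\<in>{0..n}. \<Sum>\<eta>\<in>S_shuffle n k. X (\<sigma>, k, \<eta>))"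
  proof -
    have "(\<Sum>\<sigma>\<in>?P. \<Sum>k\<in>{0..n}. \<Sum>\<eta>\<in>S_shuffle n k. X (\<sigma>, k, \<eta>)) = (\<Sum>\<sigma>\<in>?P. \<Sum>b\<in>(SIGMA k:{0..n}. S_shuffle n k). X (\<sigma>, b))"
      using finS by (simp add: sum.Sigma split_def)
    also have "\<dots> = (\<Sum>a\<in>?P \<times> (SIGMA k:{0..n}. S_shuffle n k). X a)"
      unfolding sum.cartesian_product by (simp add: split_def)
    finally show ?thesis ..
  qed
  also have "\<dots> = (\<Sum>\<sigma>\<in>?P. q \<sigma> * ((2 * pi * \<i>) ^ n * F_tilde n (\<lambda>i. m (inv \<sigma> i)) (\<lambda>i j. mm (inv \<sigma> i) (inv \<sigma> j))))"
  proof (rule sum.cong[OF refl])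
    fix \<sigma> assume "\<sigma> \<in> ?P"
    hence s: "\<sigma> permutes {0..<n}" by simp
    have Sel: "complex_of_real (Sel n (\<lambda>i. m (inv \<sigma> (inv \<eta> i))) (\<lambda>_. 0) (\<lambda>i j. mm (inv \<sigma> (inv \<eta> i)) (inv \<sigma> (inv \<eta> j)))) = SEL (\<eta> \<circ> \<sigma>)"
      if "\<eta> \<in> S_shuffle n k" for \<eta> k
    proof -
      have "\<eta> permutes {0..<n}" using that by (simp add: S_shuffle_def)
      hence "inv (\<eta> \<circ> \<sigma>) = inv \<sigma> \<circ> inv \<eta>" using s by (intro o_inv_distrib permutes_bij)
      thus ?thesis by (simp add: SEL_def)
    qed
    have "(2 * pi * \<i>) ^ n * F_tilde n (\<lambda>i. m (inv \<sigma> i)) (\<lambda>i j. mm (inv \<sigma> i) (inv \<sigma> j)) =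
      (\<Sum>k\<in>{0..n}. (-1) ^ k * (\<Prod>i\<in>{k..<n}. exp (2 * pi * \<i> * complex_of_real (m (inv \<sigma> i)))) *
        (\<Sum>\<eta>\<in>S_shuffle n k. (\<Prod>(i, j)\<in>{(i, j)\<in>pairs n. \<eta> i > \<eta> j}. exp (pi * \<i> * complex_of_real (mm (inv \<sigma> i) (inv \<sigma> j)))) * SEL (\<eta> \<circ> \<sigma>)))"
      unfolding F_tilde_def using Sel by simp
    thus "(\<Sum>k\<in>{0..n}. \<Sum>\<eta>\<in>S_shuffle n k. X (\<sigma>, k, \<eta>)) = q \<sigma> * ((2 * pi * \<i>) ^ n * F_tilde n (\<lambda>i. m (inv \<sigma> i)) (\<lambda>i j. mm (inv \<sigma> i) (inv \<sigma> j)))"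
      unfolding X_def by (simp only: prod.case sum_distrib_left)
  qed
  also have "\<dots> = (2 * pi * \<i>) ^ n * (\<Sum>\<sigma>\<in>?P. q \<sigma> * F_tilde n (\<lambda>i. m (inv \<sigma> i)) (\<lambda>i j. mm (inv \<sigma> i) (inv \<sigma> j)))"
    by (simp only: sum_distrib_left mult.left_commute)
  finally show ?thesis by simp
qed

end
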